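(* Fix $A>0$ and let $x\ge 3$. \begin{enumerate} \item For integers $1\le k\le A(\log \log x)^{1/3}$, \[\mathbb{E}_{n \le x}\bigg(\frac{\omega(n)-\log \log x}{\sqrt{\log \log x}} \bigg)^k =\bigg(\mu_k +\Big(\frac{k(k-1)}{6}+ka\Big)\frac{\mu_{k-1}}{\sqrt{\log \log x}}\bigg) \bigg(1+O_A\Big( \frac{k^3}{\log \log x}\Big)\bigg),\] with implied constant depending only on $A$. \item If $k=k(x)$ satisfies $k\asymp (\log \log x)^{1/3}$, then as $x\to\infty$, \[ M_k^{-1} \mathbb{E}_{n \le x}\bigg(\frac{\omega(n)-\log \log x}{\sqrt{\log \log x}} \bigg)^k \sim \frac{1}{2}\exp\bigg( \frac{k^{3/2}}{6(\log \log x)^{1/2}}\bigg) \bigg(1 +(-1)^k \exp\Big( - \frac{k^{3/2}}{3(\log \log x)^{1/2}}\Big)\bigg) \asymp 1.\] \item If $k=k(x)$ satisfies $k/(\log \log x)^{1/3} \to \infty$ and $k=o(\sqrt{\log \log x})$, then, letting $r=\sqrt{k/\log \log x}$, as $x\to\infty$ \[ M_k^{-1} \mathbb{E}_{n \le x}\bigg(\frac{\omega(n)-\log \log x}{\sqrt{\log \log x}} \bigg)^k \sim \frac{1}{2} (\log x)^{e^{r}-(1+r+r^2/2)}\to \infty.\] \end{enumerate}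
   Context: $\omega(n)$ is the number of distinct prime divisors of $n$; $\mathbb{E}_{n\le x}$ is the average over $n$ uniform among positive integers $\le x$. For $k\in\mathbb{N}$ (and $k=0$), $\mu_k=\frac{k!}{2^{k/2}(k/2)!}$ if $k$ is even and $\mu_k=0$ if $k$ is odd (the $k$th moment of a standard Gaussian), and $M_k=\frac{k!}{2^{k/2}\Gamma(k/2+1)}$. The constant $a=\gamma+\sum_p\left(\log\left(1-\frac1p\right)+\frac1p\right)$ (sum over primes, $\gamma$ Euler's constant). $f\asymp g$ means $f\ll g\ll f$; $f\sim g$ means $f/g\to1$. *)

theory Defs
  imports
    "HOL-Analysis.Analysis"
    "HOL-Library.Landau_Symbols"
    "HOL-Computational_Algebra.Computational_Algebra"
begin

definition prime_omega :: "nat \<Rightarrow> nat" where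
  "prime_omega n = card (prime_factors n)"

definition nat_average :: "real \<Rightarrow> (nat \<Rightarrow> real) \<Rightarrow> real" where
  "nat_average x f =
     (\<Sum>n | 1 \<le> n \<and> real n \<le> x. f n) / real (card {n::nat. 1 \<le> n \<and> real n \<le> x})"

definition omega_moment :: "real \<Rightarrow> nat \<Rightarrow> real" where
  "omega_moment x k =
     nat_average x (\<lambda>n. ((real (prime_omega n) - ln (ln x)) / sqrt (ln (ln x))) ^ k)"

definition gauss_moment :: "nat \<Rightarrow> real" where
  "gauss_moment k = (if even k then fact k / (2 ^ (k div 2) * fact (k div 2)) else 0)"

definition gamma_moment :: "nat \<Rightarrow> real" where
  "gamma_moment k = fact k / (2 powr (real k / 2) * Gamma (real k / 2 + 1))"

(* The terms are O(1/p^2), so the family is absolutely summable and infsum does not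
   take its default value 0. *)
definition mertens_const :: real where
  "mertens_const =
     euler_mascheroni + (\<Sum>\<^sub>\<infinity>p | prime (p::nat). ln (1 - 1 / real p) + 1 / real p)"

end

theory Submission
  imports
    Defs
    "HOL-Complex_Analysis.Complex_Analysis"
    "HOL-Real_Asymp.Real_Asymp"
    "HOL-Number_Theory.Prime_Powers"
    "HOL-Probability.Distributions"
begin

text \<open>Expanding \<open>(1 + u) ^ \<omega>(n)\<close> over the squarefree divisors of \<open>n\<close> reduces its mean to the sums of
  \<open>u ^ \<omega>(d) / d\<close> over squarefree \<open>d\<close>. Weighting the terms by \<open>ln d = (\<Sum>p | p dvd d. ln p)\<close> and using
  Mertens' first theorem, these sums satisfy \<open>y S(y) = (1 + u) (\<integral>t\<le>y. S(t)) + O(y powr (1/8))\<close> in \<open>y = ln x\<close>,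
  so \<open>S(y) y powr (-u)\<close> converges to some \<open>G(u)\<close>. Hence the moment generating function of
  \<open>\<omega>(n) - L\<close>, with \<open>L = ln (ln x)\<close>, is \<open>H(w) exp (L (exp w - 1 - w)) + O(exp (- L / 4))\<close> near \<open>w = 0\<close>, where
  \<open>H(0) = 1\<close> and \<open>H'(0)\<close> is the Mertens constant.

  The \<open>k\<close>-th moment is read off by Cauchy's formula on the circle through the two saddle points
  \<open>\<plusminus> sqrt k\<close> of \<open>exp (s\<^sup>2 / 2) / s ^ k\<close>, where \<open>w = s / sqrt L\<close> has modulus \<open>r = sqrt (k / L)\<close>. The remaining factor
  \<open>H(w) exp (L (exp w - 1 - w - w\<^sup>2 / 2))\<close> is \<open>1 + H'(0) w + L w ^ 3 / 6\<close> up to small errors when \<open>L r ^ 3\<close> is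
  bounded; separating the even from the odd terms, as the contributions of \<open>s\<close> and \<open>- s\<close> add up or cancel
  according to the parity of \<open>k\<close>, gives the first part for large \<open>x\<close>. In the other two parts
  Laplace's method evaluates the factor at \<open>w = \<plusminus> r\<close>, and the saddle point \<open>- r\<close> is negligible as soon as
  \<open>L r ^ 3\<close> tends to infinity.\<close>

section \<open>Chebyshev and Mertens estimates\<close>

text \<open>Every error in the arithmetic part saves a fixed power of \<open>ln x\<close>. That is
  exponentially small in \<open>L\<close>, while the moments are expanded in powers of
  \<open>1 / sqrt L\<close>; this is why the bounds of Chebyshev and Mertens suffice.

  The shape of the analytic part is dictated by odd \<open>k\<close>. There the Gaussian moment
  vanishes, and the main term is smaller than \<open>gamma_moment k\<close> by a factor of order B =
  k^(3/2) / sqrt L, so a relative error k^3 / L = B^2 demands an absolute error of order B^3. Hence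
  z and -z are paired before any modulus is taken. Moreover the Mertens constant has to be positive:
  for \<open>k = 1\<close> the main term is just \<open>mertens_const / sqrt L\<close>.

  The constant enters as a derivative. Uniform convergence in \<open>u\<close> near 0 shows that the
  sum of 1/p minus ln ln has a limit at all, and a comparison of Laplace transforms with the
  harmonic sum evaluates this limit.\<close>

lemma prod_primes_dvd:
  fixes n :: nat
  assumes "finite P" "\<And>p. p \<in> P \<Longrightarrow> prime p" "\<And>p. p \<in> P \<Longrightarrow> p dvd n"
  shows "\<Prod>P dvd n"
  using assms
proof (induction P rule: finite_induct)
  case (insert p P)
  have "coprime p (\<Prod>P)"
    using insert by (intro prod_coprime_right) (auto intro!: primes_coprime)
  then show ?case
    using insert by (auto intro!: divides_mult)
qed auto

text \<open>The primes in (n, 2n] divide (2n)! but not n!, so their product divides the central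
  binomial coefficient, which is at most 4^n.\<close>

lemma primes_theta_double:
  "(\<Sum>p | prime p \<and> p \<le> 2 * n. ln (real p)) \<le> (\<Sum>p | prime p \<and> p \<le> n. ln (real p)) + 2 * ln 2 * real n"
proof -
  define P where "P = {p. prime p \<and> n < p \<and> p \<le> 2 * n}"
  have fin: "finite P" unfolding P_def by auto
  have "\<Prod>P dvd (2 * n choose n)"
  proof (rule prod_primes_dvd[OF fin])
    fix p assume p: "p \<in> P"
    show "prime p" using p by (auto simp: P_def)
    have "p dvd fact (2 * n)" using p by (auto simp: P_def prime_dvd_fact_iff)
    also have "fact (2 * n) = fact n * fact n * (2 * n choose n)"
      using binomial_fact_lemma[of n "2 * n"] by simp
    finally show "p dvd (2 * n choose n)"
      using p by (auto simp: P_def prime_dvd_mult_iff prime_dvd_fact_iff)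
  qed
  then have "\<Prod>P \<le> (2 * n choose n)" by (rule dvd_imp_le) auto
  also have "\<dots> \<le> (\<Sum>k\<le>2*n. 2 * n choose k)" by (rule member_le_sum) auto
  also have "\<dots> = 2 ^ (2 * n)" by (simp add: choose_row_sum)
  finally have "real (\<Prod>P) \<le> 2 ^ (2 * n)" by (metis of_nat_le_numeral_power_cancel_iff)
  then have "ln (real (\<Prod>P)) \<le> ln (2 ^ (2 * n))"
    using fin by (subst ln_le_cancel_iff) (auto simp: P_def intro!: prod_pos prime_gt_0_nat)
  also have "ln (real (\<Prod>P)) = (\<Sum>p\<in>P. ln (real p))"
    using fin by (subst of_nat_prod, subst ln_prod) (auto simp: P_def dest: prime_gt_0_nat)
  finally have 1: "(\<Sum>p\<in>P. ln (real p)) \<le> 2 * ln 2 * real n" by (simp add: ln_realpow mult_ac)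
  have "{p. prime p \<and> p \<le> 2 * n} = {p. prime p \<and> p \<le> n} \<union> P" by (auto simp: P_def)
  moreover have "{p. prime p \<and> p \<le> n} \<inter> P = {}" by (auto simp: P_def)
  ultimately have "(\<Sum>p | prime p \<and> p \<le> 2 * n. ln (real p)) = (\<Sum>p | prime p \<and> p \<le> n. ln (real p)) + (\<Sum>p\<in>P. ln (real p))"
    using fin by (simp add: sum.union_disjoint)
  with 1 show ?thesis by linarith
qed

lemma primes_theta_le: "(\<Sum>p | prime p \<and> p \<le> n. ln (real p)) \<le> 4 * ln 2 * real n"
proof (induction n rule: less_induct)
  case (less n)
  consider "n = 0" | "n = 1" | "n \<ge> 2" by linarith
  then show ?case
  proof cases
    case 1 then have e: "{p. prime p \<and> p \<le> n} = {}" by auto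
    show ?thesis unfolding e using 1 by simp
  next
    case 2 then have e: "{p. prime p \<and> p \<le> n} = {}" by (auto dest: prime_gt_1_nat)
    show ?thesis unfolding e using 2 by simp
  next
    case 3
    define m where "m = (n + 1) div 2"
    have m: "m < n" "n \<le> 2 * m" "2 * m \<le> n + 1" using 3 by (auto simp: m_def)
    have "(\<Sum>p | prime p \<and> p \<le> n. ln (real p)) \<le> (\<Sum>p | prime p \<and> p \<le> 2 * m. ln (real p))"
      using m by (intro sum_mono2) (auto simp: Suc_le_eq dest: prime_gt_0_nat)
    also have "\<dots> \<le> (\<Sum>p | prime p \<and> p \<le> m. ln (real p)) + 2 * ln 2 * real m"
      by (rule primes_theta_double)
    also have "\<dots> \<le> 4 * ln 2 * real m + 2 * ln 2 * real m"
      using less.IH[OF m(1)] by (simp add: mult_ac)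
    also have "\<dots> = (6 * real m) * ln 2" by simp
    \<comment> \<open>The constant 4 makes the halving close: 4m + 2m is at most 4n once m is at
      most 2n/3. As m is n/2 rounded up, this holds for n at least 3, and at n = 2 because m =
      1.\<close>
    also have "\<dots> \<le> (4 * real n) * ln 2"
    proof (intro mult_right_mono)
      show "6 * real m \<le> 4 * real n"
      proof (cases "n = 2")
        case False
        then have "3 * m \<le> 2 * n" using m 3 by linarith
        then show ?thesis by linarith
      next
        case True
        then have "m = 1" using m 3 by linarith
        then show ?thesis using True by simp
      qed
    qed auto
    finally show ?thesis by (simp add: mult_ac)
  qed
qed

text \<open>There are \<open>N div d\<close> multiples of \<open>d\<close> up to \<open>N\<close>.
  The coefficient type is general because the identity serves both the von Mangoldt function, where
  it is Legendre's formula for n!, and the complex squarefree weights.\<close>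

lemma sum_divisors_swap:
  fixes f :: "nat \<Rightarrow> 'a::comm_semiring_1"
  shows "(\<Sum>n=1..N. \<Sum>d | d dvd n. f d) = (\<Sum>d=1..N. f d * of_nat (N div d))"
proof -
  have "(\<Sum>n=1..N. \<Sum>d | d dvd n. f d) = (\<Sum>n=1..N. \<Sum>d=1..N. if d dvd n then f d else 0)"
  proof -
    have "sum f {d. d dvd m} = (\<Sum>d=1..N. if d dvd m then f d else 0)" if m: "m \<in> {1..N}" for m
    proof -
      have "{d. d dvd m} = {d\<in>{1..N}. d dvd m}" using m by (auto dest: dvd_imp_le dvd_pos_nat intro: Suc_leI)
      then show ?thesis by (simp only: sum.inter_filter finite_atLeastAtMost)
    qed
    then show ?thesis by (rule sum.cong[OF refl])
  qed
  also have "\<dots> = (\<Sum>d=1..N. \<Sum>n=1..N. if d dvd n then f d else 0)"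
    by (rule sum.swap)
  also have "\<dots> = (\<Sum>d=1..N. f d * of_nat (N div d))"
  proof (intro sum.cong refl)
    fix d assume d: "d \<in> {1..N}"
    have "(\<Sum>m=1..N. if d dvd m then f d else 0) = f d * of_nat (card {m\<in>{1..N}. d dvd m})"
      by (simp add: sum.inter_filter[symmetric] mult.commute)
    also have "{m\<in>{1..N}. d dvd m} = (\<lambda>q. d * q) ` {1..N div d}"
      using d by (auto simp: image_iff Suc_le_eq less_eq_div_iff_mult_less_eq mult.commute elim!: dvdE)
    also have "card \<dots> = N div d" using d by (subst card_image) (auto simp: inj_on_def)
    finally show "(\<Sum>m=1..N. if d dvd m then f d else 0) = f d * of_nat (N div d)" .
  qed
  finally show ?thesis .
qed

lemma ln_fact_mangoldt:
  "ln (fact n) = (\<Sum>d=1..n. mangoldt d * real (n div d))"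
proof -
  have "ln (fact n :: real) = (\<Sum>m=1..n. ln (real m))"
    by (simp add: fact_prod) (subst ln_prod, auto)
  also have "\<dots> = (\<Sum>m=1..n. sum mangoldt {d. d dvd m})"
    by (intro sum.cong refl) (subst mangoldt_sum, auto)
  finally show ?thesis by (simp only: sum_divisors_swap)
qed

lemma ln_fact_ge: "n \<ge> 1 \<Longrightarrow> ln (fact n) \<ge> real n * ln (real n) - real n"
proof -
  assume n: "n \<ge> 1"
  \<comment> \<open>A single term of the exponential series.\<close>
  have "real n ^ n / fact n \<le> exp (real n)"
    using sum_le_suminf[OF summable_exp[of "real n"], of "{n}"] sums_unique[OF exp_converges[of "real n"]]
    by (simp add: divide_inverse mult.commute)
  then have "real n ^ n \<le> exp (real n) * fact n" by (simp add: divide_simps)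
  then have "ln (real n ^ n) \<le> ln (exp (real n) * fact n)" using n by (subst ln_le_cancel_iff) auto
  then show ?thesis using n by (simp add: ln_mult ln_realpow)
qed

lemma ln_fact_le: "ln (fact n) \<le> real n * ln (real n)"
proof (cases "n = 0")
  case False
  have "(fact n::real) \<le> real n ^ n" using fact_le_power[of n, where ?'a = real] by simp
  then have "ln (fact n::real) \<le> ln (real n ^ n)" using False by (subst ln_le_cancel_iff) auto
  then show ?thesis using False by (simp add: ln_realpow)
qed auto

lemma real_div_less_Suc_div: "p > 0 \<Longrightarrow> real n / real p < real (n div p) + 1"
  by (simp add: field_simps) (metis mod_less_divisor mult.commute of_nat_add of_nat_less_iff of_nat_mult add_strict_left_mono add.commute div_mult_mod_eq)

text \<open>In Legendre's formula keep only the primes and replace \<open>n div p\<close> by n/p -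
  1. The total loss is the Chebyshev sum, which is linear in n.\<close>

lemma sum_ln_over_primes_le:
  assumes "n \<ge> 1"
  shows "(\<Sum>p | prime p \<and> p \<le> n. ln (real p) / real p) \<le> ln (real n) + 4 * ln 2"
proof -
  let ?P = "{p. prime p \<and> p \<le> n}"
  have "(\<Sum>p\<in>?P. ln (real p) * (real n / real p - 1)) \<le> (\<Sum>p\<in>?P. ln (real p) * real (n div p))"
  proof (intro sum_mono mult_left_mono)
    fix p assume "p \<in> ?P"
    then have p: "p > 0" by (auto dest: prime_gt_0_nat)
    show "real n / real p - 1 \<le> real (n div p)" using real_div_less_Suc_div[OF p, of n] by simp
    show "0 \<le> ln (real p)" using p by auto
  qed
  also have "\<dots> = (\<Sum>p\<in>?P. mangoldt p * real (n div p))"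
    by (intro sum.cong) auto
  also have "\<dots> \<le> (\<Sum>d=1..n. mangoldt d * real (n div d))"
    by (intro sum_mono2) (auto simp: mangoldt_nonneg Suc_le_eq dest: prime_gt_0_nat)
  also have "\<dots> = ln (fact n)" by (rule ln_fact_mangoldt[symmetric])
  also have "\<dots> \<le> real n * ln (real n)" by (rule ln_fact_le)
  finally have "(\<Sum>p\<in>?P. ln (real p) * (real n / real p - 1)) \<le> real n * ln (real n)" .
  moreover have "(\<Sum>p\<in>?P. ln (real p) * (real n / real p - 1))
      = real n * (\<Sum>p\<in>?P. ln (real p) / real p) - (\<Sum>p\<in>?P. ln (real p))"
    by (simp add: sum_distrib_left algebra_simps sum_subtractf)
  ultimately have "real n * (\<Sum>p\<in>?P. ln (real p) / real p) \<le> real n * (ln (real n) + 4 * ln 2)"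
    using primes_theta_le[of n] by (simp add: algebra_simps)
  then show ?thesis using assms by simp
qed

lemma summable_ln_over_square: "summable (\<lambda>n. 2 * ln (real n) / real n ^ 2)"
proof (rule summable_comparison_test_bigo)
  show "summable (\<lambda>n. norm (real n powr (-3/2)))" by (simp add: summable_real_powr_iff)
  show "(\<lambda>n. 2 * ln (real n) / real n ^ 2) \<in> O(\<lambda>n. real n powr (-3/2))" by real_asymp
qed

lemma ln_real_nonneg: "0 \<le> ln (real n)"
  by (cases "n = 0") auto

text \<open>For each prime the powers with exponent at least 2 form a geometric series of size at
  most 2 ln p / p^2. Extending the sum over p to all integers gives a bound independent of
  \<open>n\<close>.\<close>

lemma sum_mangoldt_nonprime_le:
  "(\<Sum>d | d \<in> {1..n} \<and> \<not> prime d. mangoldt d / real d) \<le> (\<Sum>k. 2 * ln (real k) / real k ^ 2)"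
proof -
  define I where "I = {p. prime p \<and> p \<le> n} \<times> {2..n}"
  have finI: "finite I" by (auto simp: I_def)
  have "(\<Sum>d | d \<in> {1..n} \<and> \<not> prime d. mangoldt d / real d)
      = (\<Sum>d | d \<in> {1..n} \<and> primepow d \<and> \<not> prime d. mangoldt d / real d)"
    by (intro sum.mono_neutral_right) (auto simp: mangoldt_def)
  also have "\<dots> \<le> (\<Sum>d \<in> (\<lambda>(p,j). p ^ j) ` I. mangoldt d / real d)"
  proof (intro sum_mono2)
    show "{d \<in> {1..n}. primepow d \<and> \<not> prime d} \<subseteq> (\<lambda>(p,j). p ^ j) ` I"
    proof
      fix d assume d: "d \<in> {d \<in> {1..n}. primepow d \<and> \<not> prime d}"
      then obtain p j where pj: "prime p" "j > 0" "d = p ^ j" by (auto simp: primepow_def)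
      have "j \<noteq> 1" using d pj by auto
      moreover have "p \<le> p ^ j" using pj by (intro self_le_power) (auto simp: Suc_le_eq prime_gt_0_nat)
      moreover have "j < p ^ j" using pj by (intro power_gt_expt) (use prime_gt_1_nat in auto)
      ultimately have "(p, j) \<in> I" using pj d by (auto simp: I_def)
      then show "d \<in> (\<lambda>(p,j). p ^ j) ` I" using pj by force
    qed
  qed (use finI in \<open>auto simp: mangoldt_nonneg\<close>)
  also have "\<dots> \<le> (\<Sum>(p,j) \<in> I. mangoldt (p ^ j) / real (p ^ j))"
    using sum_image_le[OF finI, of "\<lambda>d. mangoldt d / real d" "\<lambda>(p,j). p ^ j"]
    by (simp add: o_def case_prod_unfold mangoldt_nonneg)
  also have "\<dots> = (\<Sum>p | prime p \<and> p \<le> n. \<Sum>j=2..n. ln (real p) / real p ^ j)"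
    unfolding I_def sum.cartesian_product[symmetric] by (intro sum.cong refl) auto
  also have "\<dots> \<le> (\<Sum>p | prime p \<and> p \<le> n. 2 * ln (real p) / real p ^ 2)"
  proof (intro sum_mono)
    fix p assume "p \<in> {p. prime p \<and> p \<le> n}"
    then have p: "p \<ge> 2" by (auto dest: prime_ge_2_nat)
    define x where "x = 1 / real p"
    have x: "0 < x" "x \<le> 1/2" using p by (auto simp: x_def field_simps)
    have "(\<Sum>j=2..n. x ^ j) \<le> 2 * x ^ 2"
    proof (cases "n \<ge> 2")
      case True
      have "(1 - x) * (\<Sum>j=2..n. x ^ j) = x ^ 2 - x ^ Suc n"
        using sum_gp_multiplied[of 2 n x] True by simp
      also have "\<dots> \<le> x ^ 2" using x by simp
      also have "\<dots> \<le> (1 - x) * (2 * x ^ 2)" using x by (simp add: algebra_simps)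
      finally show ?thesis using x by simp
    qed (use x in auto)
    then have "ln (real p) * (\<Sum>j=2..n. x ^ j) \<le> ln (real p) * (2 * x ^ 2)"
      using p by (intro mult_left_mono) auto
    then show "(\<Sum>j=2..n. ln (real p) / real p ^ j) \<le> 2 * ln (real p) / real p ^ 2"
      by (simp add: x_def sum_distrib_left power_one_over mult.commute)
  qed
  also have "\<dots> \<le> (\<Sum>k. 2 * ln (real k) / real k ^ 2)"
    by (intro sum_le_suminf summable_ln_over_square) (auto intro!: divide_nonneg_nonneg ln_real_nonneg)
  finally show ?thesis .
qed

text \<open>In this direction the integer part is dropped for free, since \<open>n div d\<close> is
  at most n/d; the price is the contribution of the proper prime powers.\<close>

lemma sum_ln_over_primes_ge:
  assumes "n \<ge> 1"
  shows "(\<Sum>p | prime p \<and> p \<le> n. ln (real p) / real p) \<ge> ln (real n) - 1 - (\<Sum>k. 2 * ln (real k) / real k ^ 2)"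
proof -
  have "real n * ln (real n) - real n \<le> ln (fact n)" using assms by (rule ln_fact_ge)
  also have "\<dots> = (\<Sum>d=1..n. mangoldt d * real (n div d))" by (rule ln_fact_mangoldt)
  also have "\<dots> \<le> (\<Sum>d=1..n. mangoldt d * (real n / real d))"
    by (intro sum_mono mult_left_mono of_nat_div_le_of_nat mangoldt_nonneg)
  also have "\<dots> = real n * (\<Sum>d=1..n. mangoldt d / real d)"
    by (simp add: sum_distrib_left mult_ac)
  finally have "ln (real n) - 1 \<le> (\<Sum>d=1..n. mangoldt d / real d)"
  proof -
    assume "real n * ln (real n) - real n \<le> real n * (\<Sum>d=1..n. mangoldt d / real d)"
    then have "real n * (ln (real n) - 1) \<le> real n * (\<Sum>d=1..n. mangoldt d / real d)"
      by (simp only: right_diff_distrib mult_1_right)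
    then show ?thesis using assms by (simp only: mult_le_cancel_left_pos of_nat_0_less_iff Suc_le_eq One_nat_def)
  qed
  also have "{1..n} = {p. prime p \<and> p \<le> n} \<union> {d. d \<in> {1..n} \<and> \<not> prime d}"
    by (auto simp: Suc_le_eq prime_gt_0_nat)
  also have "(\<Sum>d\<in>\<dots>. mangoldt d / real d) = (\<Sum>p | prime p \<and> p \<le> n. mangoldt p / real p)
      + (\<Sum>d | d \<in> {1..n} \<and> \<not> prime d. mangoldt d / real d)"
    by (subst sum.union_disjoint) auto
  also have "(\<Sum>p | prime p \<and> p \<le> n. mangoldt p / real p) = (\<Sum>p | prime p \<and> p \<le> n. ln (real p) / real p)"
    by (intro sum.cong) auto
  finally show ?thesis using sum_mangoldt_nonprime_le[of n] by simp
qed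

lemma nat_floor_primes:
  "t \<ge> 0 \<Longrightarrow> {p. prime p \<and> real p \<le> t} = {p. prime p \<and> p \<le> nat \<lfloor>t\<rfloor>}"
  by (auto simp: le_nat_floor le_floor_iff nat_le_iff le_nat_iff)

lemma mertens_first:
  obtains C where "C > 0" "\<And>t. t \<ge> 1 \<Longrightarrow> \<bar>(\<Sum>p | prime p \<and> real p \<le> t. ln (real p) / real p) - ln t\<bar> \<le> C"
proof -
  define Z where "Z = (\<Sum>k. 2 * ln (real k) / real k ^ 2)"
  have Z: "Z \<ge> 0" unfolding Z_def
    by (intro suminf_nonneg summable_ln_over_square) (auto intro!: divide_nonneg_nonneg ln_real_nonneg)
  show ?thesis
  proof (rule that[of "Z + 1 + 4 * ln 2"])
    show "Z + 1 + 4 * ln 2 > 0" using Z by (simp add: add_nonneg_pos)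
    fix t :: real assume t: "t \<ge> 1"
    define n where "n = nat \<lfloor>t\<rfloor>"
    have n: "n \<ge> 1" "real n \<le> t" "t < real n + 1" using t by (auto simp: n_def le_nat_iff le_floor_iff nat_less_real_le)
    have "t \<le> 2 * real n" using n by simp
    then have "ln t \<le> ln (2 * real n)" using t n by (subst ln_le_cancel_iff) auto
    then have "ln t \<le> ln 2 + ln (real n)" using n by (simp add: ln_mult)
    moreover have "ln (real n) \<le> ln t" using n t by (subst ln_le_cancel_iff) auto
    moreover have "(\<Sum>p | prime p \<and> real p \<le> t. ln (real p) / real p) = (\<Sum>p | prime p \<and> p \<le> n. ln (real p) / real p)"
      using t by (subst nat_floor_primes) (auto simp: n_def)
    moreover have "ln 2 \<ge> (0::real)" by simp
    ultimately show "\<bar>(\<Sum>p | prime p \<and> real p \<le> t. ln (real p) / real p) - ln t\<bar> \<le> Z + 1 + 4 * ln 2"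
      using sum_ln_over_primes_le[OF n(1)] sum_ln_over_primes_ge[OF n(1), folded Z_def] Z by linarith
  qed
qed

lemma prime_powr_bounds:
  fixes s :: real
  assumes "prime p" "s > 1"
  shows "0 < real p powr -s" "real p powr -s \<le> 1/2"
proof -
  have p: "real p \<ge> 2" using prime_ge_2_nat[OF assms(1)] by simp
  have "real p powr -s \<le> real p powr -1" using p assms by (intro powr_mono) auto
  also have "\<dots> = 1 / real p" using p by (simp add: powr_minus divide_inverse)
  also have "\<dots> \<le> 1/2" using p by (simp add: field_simps)
  finally show "real p powr -s \<le> 1/2" .
  show "0 < real p powr -s" using p by simp
qed

section \<open>Identification of the Mertens constant\<close>

text \<open>Unique factorisation n = p^j * m with p not dividing m: adjoining a prime to
  \<open>P\<close> multiplies the sum by a geometric series.\<close>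

lemma has_sum_smooth:
  fixes s :: real
  assumes "finite P" "\<And>p. p \<in> P \<Longrightarrow> prime p" "s > 1"
  shows "((\<lambda>n. real n powr -s) has_sum (\<Prod>p\<in>P. 1 / (1 - real p powr -s))) {n. n > 0 \<and> prime_factors n \<subseteq> P}"
  using assms(1,2)
proof (induction P rule: finite_induct)
  case empty
  have "{n::nat. n > 0 \<and> prime_factors n \<subseteq> {}} = {1}"
    by (auto simp: prime_factorization_empty_iff)
  then show ?case using has_sum_finite[of "{1::nat}" "\<lambda>n. real n powr -s"] by simp
next
  case (insert p P)
  define x where "x = real p powr -s"
  define A where "A = {n::nat. n > 0 \<and> prime_factors n \<subseteq> P}"
  define F where "F = (\<Prod>p\<in>P. 1 / (1 - real p powr -s))"
  have p: "prime p" using insert by auto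
  have x: "0 < x" "x \<le> 1/2" unfolding x_def using prime_powr_bounds[OF p assms(3)] by auto
  have IH: "((\<lambda>n. real n powr -s) has_sum F) A" unfolding A_def F_def using insert by auto
  have geo: "((\<lambda>j. x ^ j) has_sum (1 / (1 - x))) UNIV"
    using x by (intro norm_summable_imp_has_sum geometric_sums) auto
  have "((\<lambda>(j,m). x ^ j * real m powr -s) has_sum (1 / (1 - x) * F)) (UNIV \<times> A)"
  proof (rule has_sum_SigmaI)
    show "((\<lambda>m. (case (j, m) of (j, m) \<Rightarrow> x ^ j * real m powr -s)) has_sum (x ^ j * F)) A" for j
      using has_sum_cmult_right[OF IH] by simp
    show "((\<lambda>j. x ^ j * F) has_sum (1 / (1 - x) * F)) UNIV"
      by (rule has_sum_cmult_left[OF geo])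
    show "(\<lambda>(j, m). x ^ j * real m powr -s) summable_on UNIV \<times> A"
    proof (rule summable_on_SigmaI)
      show "((\<lambda>m. (case (j, m) of (j, m) \<Rightarrow> x ^ j * real m powr -s)) has_sum (x ^ j * F)) A" for j
        using has_sum_cmult_right[OF IH] by simp
      show "(\<lambda>j. x ^ j * F) summable_on UNIV"
        using has_sum_cmult_left[OF geo] by (rule has_sum_imp_summable)
    qed (use x in auto)
  qed
  also have "?this \<longleftrightarrow> ((\<lambda>n. real n powr -s) has_sum (1 / (1 - x) * F)) {n. n > 0 \<and> prime_factors n \<subseteq> insert p P}"
  proof (rule has_sum_reindex_bij_witness[where i = "\<lambda>n. (multiplicity p n, n div p ^ multiplicity p n)" and j = "\<lambda>(j,m). p ^ j * m"], goal_cases)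
    case (1 a)
    obtain j m where a: "a = (j, m)" by (cases a)
    have m: "m > 0" "\<not> p dvd m" using 1 insert(2) p unfolding a A_def by (auto simp: prime_factors_dvd)
    have "multiplicity p (p ^ j * m) = j"
      using m p by (intro multiplicity_eqI) (auto simp: prime_gt_0_nat)
    then show ?case using p by (simp add: a prime_gt_0_nat)
  next
    case (2 a)
    obtain j m where a: "a = (j, m)" by (cases a)
    have m: "m > 0" "prime_factors m \<subseteq> P" using 2 unfolding a A_def by auto
    have "q \<in> insert p P" if q: "prime q" "q dvd p ^ j * m" for q
    proof (cases "q dvd m")
      case True
      then show ?thesis using q m by (auto simp: prime_factors_dvd)
    next
      case False
      then have "q dvd p" using q by (metis prime_dvd_mult_iff prime_dvd_power)
      then show ?thesis using q p primes_dvd_imp_eq by blast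
    qed
    then show ?case using m p by (auto simp: a prime_gt_0_nat prime_factors_dvd)
  next
    case (3 n)
    then show ?case by (simp add: multiplicity_dvd)
  next
    case (4 n)
    have n: "n > 0" "prime_factors n \<subseteq> insert p P" using 4 by auto
    obtain m where m: "n = p ^ multiplicity p n * m" "\<not> p dvd m"
      using multiplicity_decompose'[of n p] n p by (metis not_prime_unit gr_implies_not0)
    have "n div p ^ multiplicity p n = m" using m p by (metis nonzero_mult_div_cancel_left not_prime_0 power_not_zero)
    moreover have "m > 0" using m n by (metis gr0I mult_0_right neq0_conv)
    moreover have "prime_factors m \<subseteq> P"
    proof
      fix q assume q: "q \<in> prime_factors m"
      then have "q dvd n" "prime q" using m by (metis dvd_mult in_prime_factors_iff, auto)
      then have "q \<in> prime_factors n" using n by (auto simp: prime_factors_dvd)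
      then show "q \<in> P" using n q m by auto
    qed
    ultimately show ?case by (simp add: A_def)
  next
    case (5 a)
    obtain j m where a: "a = (j, m)" by (cases a)
    have "real (p ^ j) powr -s = (real p powr real j) powr -s"
      using p by (simp add: powr_realpow prime_gt_0_nat)
    also have "\<dots> = x powr real j" by (simp add: x_def powr_powr mult.commute)
    also have "\<dots> = x ^ j" using x by (simp add: powr_realpow)
    finally have "real (p ^ j) powr -s = x ^ j" .
    then show ?case by (simp add: a powr_mult)
  qed (rule refl)
  finally show ?case using insert.hyps by (simp add: F_def x_def)
qed

text \<open>The mean value theorem for z^(-\<sigma>). The middle terms telescope, so the zeta sum at
  1 + \<sigma> is compared with 1/\<sigma>.\<close>

lemma powr_telescope_bounds:
  fixes \<sigma> :: real
  assumes "\<sigma> > 0" "n \<ge> 1"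
  shows "\<sigma> * (real n + 1) powr (-1-\<sigma>) \<le> real n powr -\<sigma> - (real n + 1) powr -\<sigma>"
    and "real n powr -\<sigma> - (real n + 1) powr -\<sigma> \<le> \<sigma> * real n powr (-1-\<sigma>)"
proof -
  have "\<exists>z>real n. z < real n + 1 \<and> (real n + 1) powr -\<sigma> - real n powr -\<sigma> = (real n + 1 - real n) * (-\<sigma> * z powr (-\<sigma>-1))"
    using assms by (intro MVT2) (auto intro!: derivative_eq_intros)
  then obtain z where z: "z > real n" "z < real n + 1"
    "real n powr -\<sigma> - (real n + 1) powr -\<sigma> = \<sigma> * z powr (-\<sigma>-1)" by auto
  have e: "-1-\<sigma> = -\<sigma>-1" by simp
  have "(real n + 1) powr (-\<sigma>-1) \<le> z powr (-\<sigma>-1)" "z powr (-\<sigma>-1) \<le> real n powr (-\<sigma>-1)"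
    using z assms by (auto intro!: powr_mono2')
  then have "\<sigma> * (real n + 1) powr (-\<sigma>-1) \<le> \<sigma> * z powr (-\<sigma>-1)" "\<sigma> * z powr (-\<sigma>-1) \<le> \<sigma> * real n powr (-\<sigma>-1)"
    using assms by (intro mult_left_mono; simp)+
  then show "\<sigma> * (real n + 1) powr (-1-\<sigma>) \<le> real n powr -\<sigma> - (real n + 1) powr -\<sigma>"
    and "real n powr -\<sigma> - (real n + 1) powr -\<sigma> \<le> \<sigma> * real n powr (-1-\<sigma>)"
    unfolding e using z(3) by linarith+
qed

lemma zeta_partial_upper:
  fixes \<sigma> :: real
  assumes "\<sigma> > 0" "N \<ge> 1"
  shows "\<sigma> * (\<Sum>n=1..N. real n powr (-1-\<sigma>)) \<le> \<sigma> + 1 - real N powr -\<sigma>"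
  using assms(2)
proof (induction N rule: nat_induct_at_least)
  case (Suc N)
  have r: "real (Suc N) = real N + 1" by simp
  have "\<sigma> * (\<Sum>n=1..Suc N. real n powr (-1-\<sigma>)) = \<sigma> * (\<Sum>n=1..N. real n powr (-1-\<sigma>)) + \<sigma> * real (Suc N) powr (-1-\<sigma>)"
    by (simp add: distrib_left)
  then show ?case using Suc.IH powr_telescope_bounds(1)[OF assms(1) Suc.hyps] unfolding r by linarith
qed auto

lemma zeta_partial_lower:
  fixes \<sigma> :: real
  assumes "\<sigma> > 0"
  shows "\<sigma> * (\<Sum>n=1..N. real n powr (-1-\<sigma>)) \<ge> 1 - (real N + 1) powr -\<sigma>"
proof (induction N)
  case (Suc N)
  have r: "real N + 1 = real (Suc N)" by simp
  have s: "1 \<le> Suc N" by simp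
  have "\<sigma> * (\<Sum>n=1..Suc N. real n powr (-1-\<sigma>)) = \<sigma> * (\<Sum>n=1..N. real n powr (-1-\<sigma>)) + \<sigma> * real (Suc N) powr (-1-\<sigma>)"
    by (simp add: distrib_left)
  then show ?case using Suc.IH powr_telescope_bounds(2)[OF assms(1) s] unfolding r by linarith
qed auto

text \<open>The product over primes up to \<open>N\<close> is the sum of n^(-1-\<sigma>) over the
  numbers whose prime factors are at most \<open>N\<close>. These contain 1, ..., N, and every
  finite set of them lies in some {1..M}, so partial zeta sums bound the product from both
  sides.\<close>

lemma euler_product_bounds:
  fixes \<sigma> :: real
  assumes "\<sigma> > 0"
  defines "E \<equiv> \<lambda>N. (\<Prod>p | prime p \<and> p \<le> N. 1 / (1 - real p powr (-1-\<sigma>)))"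
  shows "E N \<le> 1 + 1 / \<sigma>" and "E N \<ge> (1 - (real N + 1) powr -\<sigma>) / \<sigma>"
proof -
  define P where "P = {p. prime p \<and> p \<le> N}"
  define A where "A = {n. n > 0 \<and> prime_factors n \<subseteq> P}"
  have hs: "((\<lambda>n. real n powr (-1-\<sigma>)) has_sum (E N)) A"
  proof -
    have e: "-(1 + \<sigma>) = -1-\<sigma>" by simp
    have "finite P" "\<And>p. p \<in> P \<Longrightarrow> prime p" "1 + \<sigma> > 1" using assms(1) by (auto simp: P_def)
    from has_sum_smooth[OF this, unfolded e] show ?thesis unfolding A_def E_def P_def .
  qed
  have "infsum (\<lambda>n. real n powr (-1-\<sigma>)) A \<le> 1 + 1 / \<sigma>"
  proof (rule infsum_le_finite_sums)
    show "(\<lambda>n. real n powr (-1-\<sigma>)) summable_on A" using hs by (rule has_sum_imp_summable)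
    fix F assume F: "finite F" "F \<subseteq> A"
    define M where "M = max 1 (Max (insert 1 F))"
    have "F \<subseteq> {1..M}" 
    proof
      fix n assume n: "n \<in> F"
      then have "n \<le> Max (insert 1 F)" using F(1) by (intro Max_ge) auto
      then show "n \<in> {1..M}" using n F(2) by (auto simp: A_def M_def)
    qed
    then have "(\<Sum>n\<in>F. real n powr (-1-\<sigma>)) \<le> (\<Sum>n=1..M. real n powr (-1-\<sigma>))"
      by (intro sum_mono2) auto
    moreover have "\<sigma> * (\<Sum>n=1..M. real n powr (-1-\<sigma>)) \<le> \<sigma> + 1"
    proof -
      have "1 \<le> M" by (simp add: M_def)
      from zeta_partial_upper[OF assms(1) this] powr_ge_zero[of "real M" "-\<sigma>"] show ?thesis by linarith
    qed
    then have "(\<Sum>n=1..M. real n powr (-1-\<sigma>)) \<le> (\<sigma> + 1) / \<sigma>"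
      using assms(1) by (simp add: pos_le_divide_eq mult.commute)
    moreover have "(\<sigma> + 1) / \<sigma> = 1 + 1 / \<sigma>" using assms(1) by (simp add: add_divide_distrib)
    ultimately show "(\<Sum>n\<in>F. real n powr (-1-\<sigma>)) \<le> 1 + 1 / \<sigma>" by linarith
  qed
  then show "E N \<le> 1 + 1 / \<sigma>" using hs by (simp add: infsumI)
  have "{1..N} \<subseteq> A"
  proof
    fix n assume n: "n \<in> {1..N}"
    then have "p \<le> N" if "p dvd n" for p using dvd_imp_le[OF that] by simp
    then show "n \<in> A" using n by (auto simp: A_def P_def prime_factors_dvd)
  qed
  then have "(\<Sum>n=1..N. real n powr (-1-\<sigma>)) \<le> infsum (\<lambda>n. real n powr (-1-\<sigma>)) A"
    using hs by (intro finite_sum_le_infsum has_sum_imp_summable[OF hs]) simp_all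
  then have "(\<Sum>n=1..N. real n powr (-1-\<sigma>)) \<le> E N" using hs by (simp add: infsumI)
  moreover have "(1 - (real N + 1) powr -\<sigma>) / \<sigma> \<le> (\<Sum>n=1..N. real n powr (-1-\<sigma>))"
    using zeta_partial_lower[OF assms(1), of N] assms(1) by (simp only: pos_divide_le_eq mult.commute)
  ultimately show "E N \<ge> (1 - (real N + 1) powr -\<sigma>) / \<sigma>" by linarith
qed

lemma finite_primes_real_le: "finite {p::nat. prime p \<and> real p \<le> t}"
  by (rule finite_subset[of _ "{..nat \<lfloor>t\<rfloor>}"]) (auto simp: le_nat_floor)

lemma ln_euler_product:
  "ln (\<Prod>p | prime p \<and> p \<le> N. 1 / (1 - real p powr (-1-\<sigma>))) = (\<Sum>p | prime p \<and> p \<le> N. - ln (1 - real p powr (-1-\<sigma>)))"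
  if "\<sigma> > 0"
proof -
  have b: "0 < real p powr (-1-\<sigma>)" "real p powr (-1-\<sigma>) \<le> 1/2" if "prime p" for p
  proof -
    have e: "-(1 + \<sigma>) = -1-\<sigma>" by simp
    have "1 + \<sigma> > 1" using \<open>\<sigma> > 0\<close> by simp
    from prime_powr_bounds[OF that this, unfolded e] show "0 < real p powr (-1-\<sigma>)" "real p powr (-1-\<sigma>) \<le> 1/2" .
  qed
  have nz: "1 / (1 - real p powr (-1-\<sigma>)) \<noteq> 0" if "prime p" for p using b[OF that] by simp
  have "ln (\<Prod>p | prime p \<and> p \<le> N. 1 / (1 - real p powr (-1-\<sigma>))) = (\<Sum>p | prime p \<and> p \<le> N. ln (1 / (1 - real p powr (-1-\<sigma>))))"
    by (rule ln_prod) (use nz in auto)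
  also have "\<dots> = (\<Sum>p | prime p \<and> p \<le> N. - ln (1 - real p powr (-1-\<sigma>)))"
  proof (rule sum.cong[OF refl])
    fix p assume "p \<in> {p. prime p \<and> p \<le> N}"
    then show "ln (1 / (1 - real p powr (-1-\<sigma>))) = - ln (1 - real p powr (-1-\<sigma>))"
      using b[of p] by (simp add: ln_div)
  qed
  finally show ?thesis .
qed

lemma powr_minus_one_minus: "p > 0 \<Longrightarrow> p powr (-1-\<sigma>) = 1 / p * exp (- (\<sigma> * ln p))" for p :: real
  by (simp add: powr_def exp_diff exp_minus divide_inverse algebra_simps)

text \<open>Rankin's choice \<sigma> = 1 / ln t: shifting the exponent from 1 to 1 + \<sigma> costs
  at most \<sigma> times the sum of ln p / p, which Mertens' first theorem bounds by a constant,
  while the Euler product at 1 + \<sigma> is at most 1 + ln t.\<close>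

lemma mertens_second_upper:
  obtains C where "C > 0" "\<And>t. t \<ge> 3 \<Longrightarrow> (\<Sum>p | prime p \<and> real p \<le> t. 1 / real p) \<le> ln (ln t) + C"
proof -
  obtain C where C: "C > 0" "\<And>t. t \<ge> 1 \<Longrightarrow> \<bar>(\<Sum>p | prime p \<and> real p \<le> t. ln (real p) / real p) - ln t\<bar> \<le> C"
    by (rule mertens_first) blast
  show ?thesis
  proof (rule that[of "C + 2"])
    show "C + 2 > 0" using C by simp
    fix t :: real assume t: "t \<ge> 3"
    define y where "y = ln t"
    define \<sigma> where "\<sigma> = 1 / y"
    have "exp 1 \<le> t" using exp_le t by linarith
    then have "ln (exp 1) \<le> ln t" by (subst ln_le_cancel_iff) (use t in auto)
    then have y: "y \<ge> 1" by (simp add: y_def)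
    have \<sigma>: "\<sigma> > 0" "\<sigma> \<le> 1" using y by (auto simp: \<sigma>_def)
    define P where "P = {p. prime p \<and> real p \<le> t}"
    have P: "P = {p. prime p \<and> p \<le> nat \<lfloor>t\<rfloor>}" unfolding P_def using t by (intro nat_floor_primes) auto
    have fin: "finite P" unfolding P by auto
    have b: "0 < real p powr (-1-\<sigma>)" "real p powr (-1-\<sigma>) \<le> 1/2" if "p \<in> P" for p
    proof -
      have e: "-(1 + \<sigma>) = -1-\<sigma>" by simp
      have "prime p" "1 + \<sigma> > 1" using that \<sigma> by (auto simp: P_def)
      from prime_powr_bounds[OF this, unfolded e] show "0 < real p powr (-1-\<sigma>)" "real p powr (-1-\<sigma>) \<le> 1/2" .
    qed
    have "(\<Sum>p\<in>P. real p powr (-1-\<sigma>)) \<le> (\<Sum>p\<in>P. - ln (1 - real p powr (-1-\<sigma>)))"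
    proof (rule sum_mono)
      fix p assume "p \<in> P"
      from b[OF this] show "real p powr (-1-\<sigma>) \<le> - ln (1 - real p powr (-1-\<sigma>))"
        using ln_le_minus_one[of "1 - real p powr (-1-\<sigma>)"] by simp
    qed
    also have "\<dots> = ln (\<Prod>p\<in>P. 1 / (1 - real p powr (-1-\<sigma>)))"
      unfolding P by (rule ln_euler_product[OF \<sigma>(1), symmetric])
    also have "\<dots> \<le> ln (1 + 1 / \<sigma>)"
    proof (subst ln_le_cancel_iff)
      show "0 < (\<Prod>p\<in>P. 1 / (1 - real p powr (-1-\<sigma>)))"
        using b by (intro prod_pos) force
      show "(\<Prod>p\<in>P. 1 / (1 - real p powr (-1-\<sigma>))) \<le> 1 + 1 / \<sigma>"
        unfolding P by (rule euler_product_bounds(1)[OF \<sigma>(1)])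
    qed (use \<sigma> in \<open>auto intro: add_pos_pos\<close>)
    also have "\<dots> \<le> ln y + 1"
    proof -
      have "0 < 1 + 1 / y" "y * (1 + 1 / y) = 1 + y" using y by (auto simp: field_simps intro: add_pos_pos)
      then have "ln (1 + y) = ln y + ln (1 + 1 / y)" using y ln_mult[of y "1 + 1 / y"] by simp
      also have "ln (1 + 1 / y) \<le> 1 / y" using y by (intro ln_add_one_self_le_self) auto
      also have "1 / y \<le> 1" using y by simp
      finally show ?thesis by (simp add: \<sigma>_def)
    qed
    finally have 1: "(\<Sum>p\<in>P. real p powr (-1-\<sigma>)) \<le> ln y + 1" .
    have "(\<Sum>p\<in>P. 1 / real p) \<le> (\<Sum>p\<in>P. real p powr (-1-\<sigma>) + \<sigma> * (ln (real p) / real p))"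
    proof (rule sum_mono)
      fix p assume "p \<in> P"
      then have p: "real p > 0" by (auto simp: P_def prime_gt_0_nat)
      have "1 - \<sigma> * ln (real p) \<le> exp (- (\<sigma> * ln (real p)))"
        using exp_ge_add_one_self[of "- (\<sigma> * ln (real p))"] by simp
      then have "1 / real p * (1 - \<sigma> * ln (real p)) \<le> 1 / real p * exp (- (\<sigma> * ln (real p)))"
        using p by (intro mult_left_mono) auto
      then show "1 / real p \<le> real p powr (-1-\<sigma>) + \<sigma> * (ln (real p) / real p)"
        unfolding powr_minus_one_minus[OF p] by (simp add: algebra_simps)
    qed
    also have "\<dots> = (\<Sum>p\<in>P. real p powr (-1-\<sigma>)) + \<sigma> * (\<Sum>p\<in>P. ln (real p) / real p)"
      by (simp add: sum.distrib sum_distrib_left)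
    also have "\<dots> \<le> (ln y + 1) + \<sigma> * (y + C)"
    proof -
      have "(\<Sum>p\<in>P. ln (real p) / real p) \<le> y + C"
        using C(2)[of t] t unfolding P_def y_def by linarith
      then have "\<sigma> * (\<Sum>p\<in>P. ln (real p) / real p) \<le> \<sigma> * (y + C)" using \<sigma> by (intro mult_left_mono) auto
      with 1 show ?thesis by linarith
    qed
    also have "\<dots> \<le> ln y + (C + 2)"
    proof -
      have "\<sigma> * (y + C) = 1 + \<sigma> * C" using y by (simp add: \<sigma>_def field_simps)
      moreover have "\<sigma> * C \<le> 1 * C" using \<sigma> C by (intro mult_right_mono) auto
      ultimately show ?thesis by simp
    qed
    finally show "(\<Sum>p | prime p \<and> real p \<le> t. 1 / real p) \<le> ln (ln t) + (C + 2)"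
      by (simp add: y_def P_def)
  qed
qed

text \<open>The negated summand of \<open>mertens_const\<close>. With this sign the terms are
  nonnegative for all n at least 2, so a sum over primes can be compared with the sum over all such
  n, which telescopes.\<close>

definition mertens_defect :: "nat \<Rightarrow> real" where
  "mertens_defect n = - ln (1 - 1 / real n) - 1 / real n"

lemma mertens_defect_nonneg: "n \<ge> 2 \<Longrightarrow> mertens_defect n \<ge> 0"
  using ln_le_minus_one[of "1 - 1 / real n"] by (simp add: mertens_defect_def)

lemma sum_mertens_defect:
  "N \<ge> 1 \<Longrightarrow> (\<Sum>n=2..N. mertens_defect n) = 1 - (harm N - ln (real N))"
proof (induction N rule: nat_induct_at_least)
  case (Suc N)
  have "mertens_defect (Suc N) = ln (real (Suc N)) - ln (real N) - 1 / real (Suc N)"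
  proof -
    have "1 - 1 / real (Suc N) = real N / real (Suc N)" by (simp add: field_simps)
    then show ?thesis unfolding mertens_defect_def using Suc.hyps by (simp add: ln_div)
  qed
  then show ?case using Suc by (simp add: harm_Suc inverse_eq_divide)
qed (auto simp: harm_def)

lemma sum_mertens_defect_le: "(\<Sum>n=2..N. mertens_defect n) \<le> 1 - euler_mascheroni"
proof (cases "N \<ge> 1")
  case True
  have "euler_mascheroni \<le> harm N - ln (real N)"
    using euler_mascheroni_LIMSEQ
    by (rule LIMSEQ_le_const2) (use True in \<open>auto intro!: exI[of _ N] euler_mascheroni_sequence_decreasing\<close>)
  then show ?thesis using sum_mertens_defect[OF True] by simp
next
  case False
  then show ?thesis using euler_mascheroni_LIMSEQ
    using LIMSEQ_le_const2[OF euler_mascheroni_LIMSEQ, of 1] euler_mascheroni_sequence_decreasing[of 1]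
    by (force simp: harm_def)
qed

lemma mertens_defect_summable: "mertens_defect summable_on {p. prime p}"
  and mertens_defect_infsum_le: "infsum mertens_defect {p. prime p} \<le> 1 - euler_mascheroni"
proof -
  have fin: "sum mertens_defect F \<le> 1 - euler_mascheroni" if "finite F" "F \<subseteq> {p. prime p}" for F
  proof -
    have "F \<subseteq> {2..Max (insert 0 F)}"
      using that by (auto intro!: Max_ge prime_ge_2_nat)
    then have "sum mertens_defect F \<le> (\<Sum>n=2..Max (insert 0 F). mertens_defect n)"
      by (intro sum_mono2) (auto intro: mertens_defect_nonneg)
    also have "\<dots> \<le> 1 - euler_mascheroni" by (rule sum_mertens_defect_le)
    finally show ?thesis .
  qed
  show s: "mertens_defect summable_on {p. prime p}"
  proof (rule nonneg_bdd_above_summable_on)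
    show "bdd_above (sum mertens_defect ` {F. F \<subseteq> {p. prime p} \<and> finite F})"
      using fin by (auto intro!: bdd_aboveI2)
  qed (auto intro: mertens_defect_nonneg prime_ge_2_nat)
  show "infsum mertens_defect {p. prime p} \<le> 1 - euler_mascheroni"
    by (rule infsum_le_finite_sums[OF s]) (use fin in auto)
qed

lemma mertens_const_eq: "mertens_const = euler_mascheroni - infsum mertens_defect {p. prime p}"
proof -
  have "infsum mertens_defect {p. prime p} = infsum (\<lambda>p. - (ln (1 - 1 / real p) + 1 / real p)) {p. prime p}"
    by (simp add: mertens_defect_def[abs_def])
  also have "\<dots> = - infsum (\<lambda>p. ln (1 - 1 / real p) + 1 / real p) {p. prime p}"
    by (rule infsum_uminus)
  finally show ?thesis by (simp add: mertens_const_def)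
qed

text \<open>The defects of the primes are at most those of all n at least 2, which add up to 1 -
  \<gamma>. Hence the constant is at least 2\<gamma> - 1, and \<gamma> > 19/33. Positivity keeps the
  main term of the odd moments away from 0.\<close>

lemma mertens_const_pos: "mertens_const > 0"
  using mertens_defect_infsum_le euler_mascheroni_gt_19_over_33 by (simp add: mertens_const_eq)

lemma has_bochner_integral_exp_atLeast:
  "has_bochner_integral lborel (\<lambda>v. indicator {c..} v * exp (- v)) (exp (- c) :: real)"
proof -
  have hi: "((\<lambda>x::real. exp (- x)) has_integral exp (- c)) {c..}"
    using has_integral_exp_minus_to_infinity[of 1 c] by simp
  have "((\<lambda>x::real. indicator {c..} x * exp (- x)) has_integral exp (- c)) UNIV"
  proof -
    have "(\<lambda>x::real. indicator {c..} x * exp (- x)) = (\<lambda>x. if x \<in> {c..} then exp (- x) else 0)"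
      by (auto simp: indicator_def)
    then show ?thesis using has_integral_restrict_UNIV[THEN iffD2, OF hi] by simp
  qed
  then show ?thesis
    by (intro has_bochner_integral_nn_integral nn_integral_has_integral_lborel) auto
qed

text \<open>exp (-l/c) is the integral of exp (-v) over v at least l/c; interchanging sum and
  integral turns the series into the average of its summatory function at scale \<open>c\<close>
  against exp (-v). Two instances are compared below: 1/p over primes with l = ln p, and 1/n over
  all n with l = n.\<close>

lemma laplace_sums:
  fixes a l :: "nat \<Rightarrow> real"
  assumes a: "\<And>n. a n \<ge> 0" and l: "\<And>n. l n \<ge> 0"
    and fin: "\<And>y. finite {n. a n \<noteq> 0 \<and> l n \<le> y}"
    and c: "c > 0" and s: "summable (\<lambda>n. a n * exp (- (l n / c)))"
  shows "integrable lborel (\<lambda>v. indicator {0..} v * exp (- v) * (\<Sum>n | a n \<noteq> 0 \<and> l n \<le> v * c. a n))"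
    and "(\<integral>v. indicator {0..} v * exp (- v) * (\<Sum>n | a n \<noteq> 0 \<and> l n \<le> v * c. a n) \<partial>lborel) = (\<Sum>n. a n * exp (- (l n / c)))"
proof -
  define f where "f = (\<lambda>n v. a n * (indicator {l n / c..} v * exp (- v)) :: real)"
  have f: "has_bochner_integral lborel (f n) (a n * exp (- (l n / c)))" for n
    unfolding f_def by (intro has_bochner_integral_mult_right has_bochner_integral_exp_atLeast)
  have i: "integrable lborel (f n)" "integral\<^sup>L lborel (f n) = a n * exp (- (l n / c))" for n
    using f[of n] by (auto simp: has_bochner_integral_iff)
  have nf: "norm (f n v) = f n v" for n v using a by (simp add: f_def)
  have fs: "f n v = 0" if "n \<notin> {n. a n \<noteq> 0 \<and> l n \<le> v * c}" for n v
    using that c by (auto simp: f_def indicator_def pos_divide_le_eq)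
  have eq: "(\<Sum>n. f n v) = indicator {0..} v * exp (- v) * (\<Sum>n | a n \<noteq> 0 \<and> l n \<le> v * c. a n)" for v
  proof -
    have "(\<Sum>n. f n v) = (\<Sum>n | a n \<noteq> 0 \<and> l n \<le> v * c. f n v)"
      by (intro suminf_finite fin fs)
    also have "\<dots> = (\<Sum>n | a n \<noteq> 0 \<and> l n \<le> v * c. indicator {0..} v * exp (- v) * a n)"
    proof (rule sum.cong[OF refl])
      fix n assume "n \<in> {n. a n \<noteq> 0 \<and> l n \<le> v * c}"
      then have "l n \<le> v * c" by simp
      moreover from this have "v \<ge> 0" using l[of n] c by (smt (verit) mult_neg_pos)
      ultimately show "f n v = indicator {0..} v * exp (- v) * a n"
        using c by (simp add: f_def indicator_def pos_divide_le_eq)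
    qed
    finally show ?thesis by (simp add: sum_distrib_left)
  qed
  have sf: "summable (\<lambda>n. norm (f n v))" for v
    unfolding nf by (rule summable_finite[OF fin[of "v * c"] fs])
  have sum: "summable (\<lambda>n. \<integral>v. norm (f n v) \<partial>lborel)"
    unfolding nf i(2) by (rule s)
  show "integrable lborel (\<lambda>v. indicator {0..} v * exp (- v) * (\<Sum>n | a n \<noteq> 0 \<and> l n \<le> v * c. a n))"
    using integrable_suminf[OF i(1) AE_I2[OF sf] sum] unfolding eq .
  show "(\<integral>v. indicator {0..} v * exp (- v) * (\<Sum>n | a n \<noteq> 0 \<and> l n \<le> v * c. a n) \<partial>lborel) = (\<Sum>n. a n * exp (- (l n / c)))"
    using integral_suminf[OF i(1) AE_I2[OF sf] sum] unfolding eq i(2) .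
qed

lemma mertens_defect_perturbed_le:
  assumes "0 < x" "x \<le> (1/2 :: real)"
  shows "- ln (1 - x) - x \<ge> 0" and "- ln (1 - x) - x \<le> 2 * x\<^sup>2"
proof -
  show "- ln (1 - x) - x \<ge> 0" using ln_le_minus_one[of "1 - x"] assms by simp
  show "- ln (1 - x) - x \<le> 2 * x\<^sup>2" using ln_one_minus_pos_lower_bound[of x] assms by (simp add: power2_eq_square)
qed

text \<open>The prime sum and the harmonic sum have almost the same growth in the logarithmic and the
  linear scale; comparing their Laplace transforms at \<open>1 / N\<close> turns the
  difference of the constants into the Euler product of the zeta function.\<close>

lemma mertens_const_unique:
  assumes M: "((\<lambda>t. (\<Sum>p | prime p \<and> real p \<le> t. 1 / real p) - ln (ln t)) \<longlongrightarrow> M) at_top"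
  shows "M = mertens_const"
proof -
  define a where "a = (\<lambda>n. if prime n then 1 / real n else 0)"
  define b where "b = (\<lambda>n. 1 / real n)"
  define A where "A = (\<lambda>y. \<Sum>n | a n \<noteq> 0 \<and> ln (real n) \<le> y. a n)"
  define B where "B = (\<lambda>y. \<Sum>n | b n \<noteq> 0 \<and> real n \<le> y. b n)"
  have Aset: "{n. a n \<noteq> 0 \<and> ln (real n) \<le> y} = {p. prime p \<and> real p \<le> exp y}" for y
  proof -
    have "ln (real p) \<le> y \<longleftrightarrow> real p \<le> exp y" if "prime p" for p
    proof -
      have "real p > 0" using that by (simp add: prime_gt_0_nat)
      then show ?thesis using exp_le_cancel_iff[of "ln (real p)" y] by simp
    qed
    then show ?thesis by (auto simp: a_def prime_gt_0_nat)
  qed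
  have A_eq: "A y = (\<Sum>p | prime p \<and> real p \<le> exp y. 1 / real p)" for y
    unfolding A_def Aset by (intro sum.cong) (auto simp: a_def)
  have B_eq: "B y = harm (nat \<lfloor>y\<rfloor>)" if "y \<ge> 0" for y
  proof -
    have "{n. b n \<noteq> 0 \<and> real n \<le> y} = {1..nat \<lfloor>y\<rfloor>}"
      using that by (auto simp: b_def le_nat_floor le_nat_iff le_floor_iff Suc_le_eq)
    then show ?thesis by (simp add: B_def b_def harm_def inverse_eq_divide)
  qed
  have finA: "finite {n. a n \<noteq> 0 \<and> ln (real n) \<le> y}" for y unfolding Aset by (rule finite_primes_real_le)
  have finB: "finite {n. b n \<noteq> 0 \<and> real n \<le> y}" for y
    by (rule finite_subset[of _ "{..nat \<lfloor>y\<rfloor>}"]) (auto simp: le_nat_floor)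
  have monoA: "0 \<le> A y" "y \<le> y' \<Longrightarrow> A y \<le> A y'" for y y'
  proof -
    show "0 \<le> A y" unfolding A_def by (intro sum_nonneg) (simp add: a_def)
    show "A y \<le> A y'" if "y \<le> y'"
      unfolding A_def using that by (intro sum_mono2 finA) (auto simp: a_def)
  qed
  have monoB: "0 \<le> B y" "y \<le> y' \<Longrightarrow> B y \<le> B y'" for y y'
  proof -
    show "0 \<le> B y" unfolding B_def by (intro sum_nonneg) (simp add: b_def)
    show "B y \<le> B y'" if "y \<le> y'"
      unfolding B_def using that by (intro sum_mono2 finB) (auto simp: b_def)
  qed
  define D where "D = (\<lambda>y. A y - B y)"
  have limA: "((\<lambda>y. A y - ln y) \<longlongrightarrow> M) at_top"
    using filterlim_compose[OF M exp_at_top] by (simp add: A_eq)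
  have limB: "((\<lambda>y. B y - ln y) \<longlongrightarrow> euler_mascheroni) at_top"
  proof -
    have fl: "filterlim (\<lambda>y::real. nat \<lfloor>y\<rfloor>) sequentially at_top"
      by (rule filterlim_compose[OF filterlim_nat_sequentially filterlim_floor_sequentially])
    have "((\<lambda>y. (harm (nat \<lfloor>y\<rfloor>) - ln (real (nat \<lfloor>y\<rfloor>))) + (ln (real (nat \<lfloor>y\<rfloor>)) - ln y)) \<longlongrightarrow> euler_mascheroni + 0) at_top"
    proof (intro tendsto_add)
      show "((\<lambda>y::real. harm (nat \<lfloor>y\<rfloor>) - ln (real (nat \<lfloor>y\<rfloor>))) \<longlongrightarrow> (euler_mascheroni::real)) at_top"
        using filterlim_compose[OF euler_mascheroni_LIMSEQ fl] by simp
      have "((\<lambda>y. ln (real_of_int \<lfloor>y\<rfloor>) - ln y) \<longlongrightarrow> 0) at_top" by real_asymp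
      moreover have "eventually (\<lambda>y::real. ln (real_of_int \<lfloor>y\<rfloor>) - ln y = ln (real (nat \<lfloor>y\<rfloor>)) - ln y) at_top"
        using eventually_ge_at_top[of 1] by eventually_elim simp
      ultimately show "((\<lambda>y::real. ln (real (nat \<lfloor>y\<rfloor>)) - ln y) \<longlongrightarrow> 0) at_top"
        by (rule Lim_transform_eventually)
    qed
    moreover have "eventually (\<lambda>y. (harm (nat \<lfloor>y\<rfloor>) - ln (real (nat \<lfloor>y\<rfloor>))) + (ln (real (nat \<lfloor>y\<rfloor>)) - ln y) = B y - ln y) at_top"
      using eventually_ge_at_top[of 0] by eventually_elim (simp add: B_eq)
    ultimately show ?thesis by (simp add: Lim_transform_eventually)
  qed
  have limD: "(D \<longlongrightarrow> M - euler_mascheroni) at_top"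
    using tendsto_diff[OF limA limB] by (simp add: D_def[abs_def])
  \<comment> \<open>Convergence bounds \<open>D\<close> only from some \<open>Y\<close> on. Below
    \<open>Y\<close> both sums are nonnegative and at most their values at \<open>Y\<close> by
    monotonicity. The resulting constant dominates the integrands below.\<close>
  obtain K where K: "K > 0" "\<And>y. \<bar>D y\<bar> \<le> K"
  proof -
    from limD have "eventually (\<lambda>y. dist (D y) (M - euler_mascheroni) < 1) at_top" by (rule tendstoD) auto
    then obtain Y where Y: "\<And>y. y \<ge> Y \<Longrightarrow> dist (D y) (M - euler_mascheroni) < 1"
      by (auto simp: eventually_at_top_linorder)
    define K where "K = \<bar>M - euler_mascheroni\<bar> + 1 + A Y + B Y"
    have "\<bar>D y\<bar> \<le> K" for y
    proof (cases "y \<ge> Y")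
      case True
      then show ?thesis using Y[OF True] monoA(1)[of Y] monoB(1)[of Y] by (simp add: K_def dist_real_def)
    next
      case False
      then have "y \<le> Y" by simp
      then show ?thesis using monoA(1)[of y] monoB(1)[of y] monoA(2)[of y Y] monoB(2)[of y Y]
        unfolding K_def D_def by linarith
    qed
    moreover have "K > 0" using monoA(1)[of Y] monoB(1)[of Y] by (simp add: K_def)
    ultimately show ?thesis using that by blast
  qed
  \<comment> \<open>\<open>g N\<close> is the prime zeta function at 1 + 1/N and \<open>h N\<close>
    the transform of the harmonic sum. \<open>e N\<close> collects the higher prime powers in the
    logarithm of the Euler product, so that \<open>g N + suminf (e N)\<close> is the logarithm of
    zeta at 1 + 1/N.\<close>
  define g where "g = (\<lambda>N::nat. \<Sum>n. a n * exp (- (ln (real n) / real N)))"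
  define h where "h = (\<lambda>N::nat. - ln (1 - exp (- (1 / real N))))"
  define e where "e = (\<lambda>N n. if prime n then - ln (1 - real n powr (-1 - 1 / real N)) - real n powr (-1 - 1 / real N) else 0)"
  have pw: "0 < real n powr (-1 - 1 / real N)" "real n powr (-1 - 1 / real N) \<le> 1/2"
      "real n powr (-1 - 1 / real N) \<le> 1 / real n" if "prime n" for n N :: nat
  proof -
    have n: "real n \<ge> 2" using that prime_ge_2_nat by simp
    then show "0 < real n powr (-1 - 1 / real N)" by simp
    have "real n powr (-1 - 1 / real N) \<le> real n powr (-1)" using n by (intro powr_mono) auto
    also have "\<dots> = 1 / real n" using n by (simp add: powr_minus inverse_eq_divide)
    finally show 1: "real n powr (-1 - 1 / real N) \<le> 1 / real n" .
    also have "\<dots> \<le> 1/2" using n by (simp add: field_simps)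
    finally show "real n powr (-1 - 1 / real N) \<le> 1/2" .
  qed
  have e_le: "norm (e N n) \<le> 2 * (1 / real n ^ 2)" for N n
  proof (cases "prime n")
    case True
    have "\<bar>e N n\<bar> \<le> 2 * (real n powr (-1 - 1 / real N))\<^sup>2"
      using mertens_defect_perturbed_le[OF pw(1,2)[OF True]] True by (simp add: e_def)
    also have "\<dots> \<le> 2 * (1 / real n)\<^sup>2"
      using pw[OF True, of N] by (intro mult_left_mono power_mono) auto
    finally show ?thesis by (simp add: power_one_over)
  qed (auto simp: e_def)
  have sM: "summable (\<lambda>n. 2 * (1 / real n ^ 2))"
    using inverse_power_summable[of 2, where ?'a = real] by (intro summable_mult) (simp add: inverse_eq_divide)
  have se: "summable (e N)" for N
    by (rule summable_comparison_test'[OF sM e_le])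
  \<comment> \<open>The exponent tends to -1, so the terms tend to the Mertens defects, and
    Tannery's theorem applies with the majorant 2 / n^2.\<close>
  have lime: "(\<lambda>N. suminf (e N)) \<longlonglongrightarrow> (\<Sum>n. if prime n then mertens_defect n else 0)"
  proof -
    have le: "((\<lambda>N. e N n) \<longlonglongrightarrow> (if prime n then mertens_defect n else 0))" for n
    proof (cases "prime n")
      case True
      then have n: "real n \<ge> 2" using prime_ge_2_nat by simp
      have z: "(\<lambda>N. -1 - 1 / real N) \<longlonglongrightarrow> -1 - 0" by (intro tendsto_intros lim_1_over_n)
      have "(\<lambda>N. real n powr (-1 - 1 / real N)) \<longlonglongrightarrow> real n powr (-1 - 0)"
        by (intro tendsto_powr z tendsto_const) (use n in auto)
      then have w: "(\<lambda>N. real n powr (-1 - 1 / real N)) \<longlonglongrightarrow> 1 / real n"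
        using n by (simp add: powr_minus inverse_eq_divide)
      have "(\<lambda>N. - ln (1 - real n powr (-1 - 1 / real N)) - real n powr (-1 - 1 / real N)) \<longlonglongrightarrow> - ln (1 - 1 / real n) - 1 / real n"
        by (intro tendsto_intros w) (use n in auto)
      then show ?thesis using True by (simp add: e_def mertens_defect_def)
    qed (auto simp: e_def)
    have ev: "eventually (\<lambda>(n, N). norm (e N n) \<le> 2 * (1 / real n ^ 2)) (at_top \<times>\<^sub>F sequentially)"
      using e_le by (intro always_eventually) (simp add: case_prod_unfold)
    show ?thesis
      using tannerys_theorem[where a = "\<lambda>n N. e N n" and b = "\<lambda>n. if prime n then mertens_defect n else 0" and F = sequentially, OF le ev sM sequentially_bot]
      by simp
  qed
  have defect: "(\<Sum>n. if prime n then mertens_defect n else 0) = infsum mertens_defect {p. prime p}"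
  proof -
    have "(mertens_defect has_sum infsum mertens_defect {p. prime p}) {p. prime p}"
      using mertens_defect_summable by (rule has_sum_infsum)
    then have "((\<lambda>n. if prime n then mertens_defect n else 0) has_sum infsum mertens_defect {p. prime p}) UNIV"
      by (rule has_sum_cong_neutral[THEN iffD1, rotated -1]) auto
    then show ?thesis by (intro sums_unique[symmetric] has_sum_imp_sums)
  qed
  \<comment> \<open>The logarithm of zeta at 1 + 1/N lies between ln N and ln (N + 1), by the Euler
    product bounds with \<sigma> = 1/N. For the lower bound the truncation \<open>m\<close> tends to
    infinity, where (m + 1)^(-1/N) vanishes.\<close>
  have key: "summable (\<lambda>n. a n * exp (- (ln (real n) / real N))) \<and>
      ln (real N) - suminf (e N) \<le> g N \<and> g N \<le> ln (1 + real N) - suminf (e N)" if N: "N > 0" for N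
  proof -
    define q where "q = (\<lambda>n. if prime n then - ln (1 - real n powr (-1 - 1 / real N)) else 0)"
    have q0: "q n \<ge> 0" for n using pw[of n N] by (auto simp: q_def)
    have ps: "(\<Sum>n\<le>m. q n) = ln (\<Prod>p | prime p \<and> p \<le> m. 1 / (1 - real p powr (-1-1 / real N)))" for m
    proof -
      have "1 / real N > 0" using N by simp
      from ln_euler_product[OF this, of m]
      have "ln (\<Prod>p | prime p \<and> p \<le> m. 1 / (1 - real p powr (-1-1 / real N))) = (\<Sum>p | prime p \<and> p \<le> m. - ln (1 - real p powr (-1-1 / real N)))" .
      also have "\<dots> = (\<Sum>n\<le>m. q n)"
      proof (rule sum.mono_neutral_cong_left)
        show "{p. prime p \<and> p \<le> m} \<subseteq> {..m}" by auto
        show "\<forall>i\<in>{..m} - {p. prime p \<and> p \<le> m}. q i = 0" unfolding q_def by auto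
        show "- ln (1 - real p powr (-1-1 / real N)) = q p" if "p \<in> {p. prime p \<and> p \<le> m}" for p
          using that unfolding q_def by simp
      qed simp
      finally show ?thesis by simp
    qed
    have Epos: "0 < (\<Prod>p | prime p \<and> p \<le> m. 1 / (1 - real p powr (-1-1 / real N)))" for m
    proof (intro prod_pos divide_pos_pos)
      fix p assume "p \<in> {p. prime p \<and> p \<le> m}"
      then show "0 < 1 - real p powr (-1-1 / real N)" using pw(2)[of p N] by simp
    qed simp
    have s0: "1 / real N > 0" using N by simp
    have up: "(\<Sum>n\<le>m. q n) \<le> ln (1 + real N)" for m
    proof -
      have "(\<Prod>p | prime p \<and> p \<le> m. 1 / (1 - real p powr (-1-1 / real N))) \<le> 1 + real N"
        using euler_product_bounds(1)[OF s0, of m] by simp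
      then show ?thesis unfolding ps using Epos[of m] by (subst ln_le_cancel_iff) linarith+
    qed
    have sq: "summable q"
    proof (rule summableI_nonneg_bounded[OF q0])
      show "(\<Sum>n<m. q n) \<le> ln (1 + real N)" for m
      proof -
        have "(\<Sum>n<m. q n) \<le> (\<Sum>n\<le>m. q n)" using q0 by (intro sum_mono2) auto
        with up[of m] show ?thesis by linarith
      qed
    qed
    have lim: "(\<lambda>m. \<Sum>n\<le>m. q n) \<longlonglongrightarrow> suminf q" using summable_LIMSEQ'[OF sq] .
    have qu: "suminf q \<le> ln (1 + real N)"
      by (rule LIMSEQ_le_const2[OF lim]) (use up in auto)
    have ql: "ln (real N) \<le> suminf q"
    proof (rule tendsto_le[OF _ lim])
      have "filterlim (\<lambda>m. real m + 1) at_top sequentially" by real_asymp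
      then have "(\<lambda>m. (real m + 1) powr -(1 / real N)) \<longlonglongrightarrow> 0" using N by (intro tendsto_neg_powr) auto
      then have "((\<lambda>m. ln ((1 - (real m + 1) powr -(1 / real N)) / (1 / real N))) \<longlonglongrightarrow> ln ((1 - 0) / (1 / real N)))"
        using N by (intro tendsto_ln tendsto_divide tendsto_diff tendsto_const) auto
      then show "((\<lambda>m. ln ((1 - (real m + 1) powr -(1 / real N)) / (1 / real N))) \<longlonglongrightarrow> ln (real N))" by simp
      show "eventually (\<lambda>m. ln ((1 - (real m + 1) powr -(1 / real N)) / (1 / real N)) \<le> (\<Sum>n\<le>m. q n)) sequentially"
        using eventually_gt_at_top[of 0]
      proof eventually_elim
        case (elim m)
        have "(real m + 1) powr -(1 / real N) < 1 powr -(1 / real N)" using N elim by (intro powr_less_mono2_neg) auto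
        then have "0 < (1 - (real m + 1) powr -(1 / real N)) / (1 / real N)" using N by simp
        then show ?case unfolding ps using euler_product_bounds(2)[OF s0, of m] Epos[of m]
          by (subst ln_le_cancel_iff) assumption+
      qed
    qed auto
    have ge: "a n * exp (- (ln (real n) / real N)) = q n - e N n" for n
      using powr_minus_one_minus[of "real n" "1 / real N"]
      by (auto simp: a_def q_def e_def prime_gt_0_nat)
    have "suminf q - suminf (e N) = g N" "summable (\<lambda>n. a n * exp (- (ln (real n) / real N)))"
      unfolding g_def ge by (auto intro!: suminf_diff summable_diff sq se)
    then show ?thesis using qu ql by auto
  qed
  have keyB: "summable (\<lambda>n. b n * exp (- (real n / real N))) \<and> (\<Sum>n. b n * exp (- (real n / real N))) = h N" if N: "N > 0" for N
  proof -
    define x where "x = exp (- (1 / real N))"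
    have x: "0 < x" "x < 1" using N by (auto simp: x_def)
    have "(\<lambda>n. - (x ^ n) / real n) sums ln (1 - x)"
      using ln_series'[of "-x"] x by simp
    from sums_minus[OF this] have "(\<lambda>n. x ^ n / real n) sums (- ln (1 - x))"
      by simp
    moreover have "b n * exp (- (real n / real N)) = x ^ n / real n" for n
      by (simp add: b_def x_def exp_of_nat_mult[symmetric])
    ultimately show ?thesis by (auto simp: h_def x_def sums_iff)
  qed
  have int: "(\<lambda>N. \<integral>v. indicator {0..} v * exp (- v) * D (v * real (Suc N)) \<partial>lborel) \<longlonglongrightarrow> (\<integral>v. indicator {0..} v * exp (- v) * (M - euler_mascheroni) \<partial>lborel)"
    and intD: "(\<integral>v. indicator {0..} v * exp (- v) * D (v * real (Suc N)) \<partial>lborel) = g (Suc N) - h (Suc N)" for N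
  proof -
    have N0: "real (Suc N) > 0" "Suc N > 0" for N by auto
    have a0: "a n \<ge> 0" "b n \<ge> 0" for n by (auto simp: a_def b_def)
    have l0: "real n \<ge> 0" for n by simp
    have A_fold: "(\<Sum>n | a n \<noteq> 0 \<and> ln (real n) \<le> y. a n) = A y" for y by (simp add: A_def)
    have B_fold: "(\<Sum>n | b n \<noteq> 0 \<and> real n \<le> y. b n) = B y" for y by (simp add: B_def)
    note iA = laplace_sums[OF a0(1) ln_real_nonneg finA N0(1) conjunct1[OF key[OF N0(2)]], unfolded A_fold]
    note iB = laplace_sums[OF a0(2) l0 finB N0(1) conjunct1[OF keyB[OF N0(2)]], unfolded B_fold]
    have iD: "integrable lborel (\<lambda>v. indicator {0..} v * exp (- v) * D (v * real (Suc N)))" for N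
      using Bochner_Integration.integrable_diff[OF iA(1)[of N] iB(1)[of N]] by (simp add: D_def right_diff_distrib)
    show "(\<integral>v. indicator {0..} v * exp (- v) * D (v * real (Suc N)) \<partial>lborel) = g (Suc N) - h (Suc N)" for N
      using Bochner_Integration.integral_diff[OF iA(1)[of N] iB(1)[of N]] iA(2)[of N] iB(2)[of N] conjunct2[OF keyB[OF N0(2)[of N]]]
      by (simp add: D_def right_diff_distrib g_def)
    show "(\<lambda>N. \<integral>v. indicator {0..} v * exp (- v) * D (v * real (Suc N)) \<partial>lborel) \<longlonglongrightarrow> (\<integral>v. indicator {0..} v * exp (- v) * (M - euler_mascheroni) \<partial>lborel)"
    proof (rule integral_dominated_convergence[where w = "\<lambda>v. K * (indicator {0..} v * exp (- v))"])
      show "integrable lborel (\<lambda>v. K * (indicator {0..} v * exp (- v)))"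
        using has_bochner_integral_exp_atLeast[of 0] by (auto simp: has_bochner_integral_iff)
      show "(\<lambda>v. indicator {0..} v * exp (- v) * D (v * real (Suc N))) \<in> borel_measurable lborel" for N
        using iD[of N] by (rule borel_measurable_integrable)
      show "AE v in lborel. norm (indicator {0..} v * exp (- v) * D (v * real (Suc N))) \<le> K * (indicator {0..} v * exp (- v))" for N
      proof (rule AE_I2)
        fix v
        have "indicator {0..} v * exp (- v) * \<bar>D (v * real (Suc N))\<bar> \<le> indicator {0..} v * exp (- v) * K"
          by (intro mult_left_mono K(2)) auto
        then show "norm (indicator {0..} v * exp (- v) * D (v * real (Suc N))) \<le> K * (indicator {0..} v * exp (- v))"
          by (simp add: abs_mult mult_ac)
      qed
      show "AE v in lborel. (\<lambda>N. indicator {0..} v * exp (- v) * D (v * real (Suc N))) \<longlonglongrightarrow> indicator {0..} v * exp (- v) * (M - euler_mascheroni)"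
      \<comment> \<open>At v = 0 the argument of \<open>D\<close> stays at 0 instead of growing with
        \<open>N\<close>; this single point is a null set.\<close>
      proof (rule AE_mp[OF AE_lborel_singleton[of 0]], rule AE_I2, rule impI)
        fix v :: real assume v: "v \<noteq> 0"
        show "(\<lambda>N. indicator {0..} v * exp (- v) * D (v * real (Suc N))) \<longlonglongrightarrow> indicator {0..} v * exp (- v) * (M - euler_mascheroni)"
        proof (cases "v > 0")
          case True
          have "filterlim (\<lambda>N. v * real (Suc N)) at_top sequentially"
            using True by (intro filterlim_tendsto_pos_mult_at_top[OF tendsto_const] filterlim_compose[OF filterlim_real_sequentially filterlim_Suc]) auto
          from filterlim_compose[OF limD this] show ?thesis by (intro tendsto_mult_left)
        qed (use v in auto)
      qed
    qed auto
  qed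
  have intM: "(\<integral>v. indicator {0..} v * exp (- v) * (M - euler_mascheroni) \<partial>lborel) = M - euler_mascheroni"
    using has_bochner_integral_exp_atLeast[of 0] by (simp add: has_bochner_integral_iff)
  have lim1: "(\<lambda>N. g (Suc N) - h (Suc N)) \<longlonglongrightarrow> M - euler_mascheroni"
    using int unfolding intD intM .
  \<comment> \<open>Both ln N - h N and ln (N + 1) - h N tend to 0, because 1 - exp (-1/N) is
    asymptotic to 1/N. Only the defects survive.\<close>
  have "(\<lambda>N. g (Suc N) - h (Suc N)) \<longlonglongrightarrow> - infsum mertens_defect {p. prime p}"
  proof (rule tendsto_sandwich)
    have lime': "(\<lambda>N. suminf (e (Suc N))) \<longlonglongrightarrow> infsum mertens_defect {p. prime p}"
      using lime unfolding defect by (rule LIMSEQ_Suc)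
    have "(\<lambda>N. (ln (real (Suc N)) - h (Suc N)) - suminf (e (Suc N))) \<longlonglongrightarrow> 0 - infsum mertens_defect {p. prime p}"
    proof (intro tendsto_diff lime')
      show "(\<lambda>N. ln (real (Suc N)) - h (Suc N)) \<longlonglongrightarrow> 0" unfolding h_def by real_asymp
    qed
    then show "(\<lambda>N. ln (real (Suc N)) - suminf (e (Suc N)) - h (Suc N)) \<longlonglongrightarrow> - infsum mertens_defect {p. prime p}"
      by (simp add: algebra_simps)
    have "(\<lambda>N. (ln (1 + real (Suc N)) - h (Suc N)) - suminf (e (Suc N))) \<longlonglongrightarrow> 0 - infsum mertens_defect {p. prime p}"
    proof (intro tendsto_diff lime')
      show "(\<lambda>N. ln (1 + real (Suc N)) - h (Suc N)) \<longlonglongrightarrow> 0" unfolding h_def by real_asymp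
    qed
    then show "(\<lambda>N. ln (1 + real (Suc N)) - suminf (e (Suc N)) - h (Suc N)) \<longlonglongrightarrow> - infsum mertens_defect {p. prime p}"
      by (simp add: algebra_simps)
    have k: "ln (real (Suc N)) - suminf (e (Suc N)) \<le> g (Suc N)" "g (Suc N) \<le> ln (1 + real (Suc N)) - suminf (e (Suc N))" for N
      using key[of "Suc N"] by blast+
    show "eventually (\<lambda>N. ln (real (Suc N)) - suminf (e (Suc N)) - h (Suc N) \<le> g (Suc N) - h (Suc N)) sequentially"
      using k(1) by (intro always_eventually allI diff_right_mono)
    show "eventually (\<lambda>N. g (Suc N) - h (Suc N) \<le> ln (1 + real (Suc N)) - suminf (e (Suc N)) - h (Suc N)) sequentially"
      using k(2) by (intro always_eventually allI diff_right_mono)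
  qed
  with lim1 have "M - euler_mascheroni = - infsum mertens_defect {p. prime p}" by (rule LIMSEQ_unique)
  then show ?thesis by (simp add: mertens_const_eq)
qed

section \<open>Logarithmic sums of the squarefree weights\<close>

text \<open>The type is generic because the norm of a complex weight is again a weight, taken at the
  real parameter \<open>norm u\<close>; the error terms are sums of that kind.\<close>

definition sqf_weight :: "'a::comm_ring_1 \<Rightarrow> nat \<Rightarrow> 'a" where
  "sqf_weight u d = (if squarefree d then u ^ prime_omega d else 0)"

lemma norm_sqf_weight: "norm (sqf_weight u d) = sqf_weight (norm u) d"
  for u :: "'a::{real_normed_div_algebra, comm_ring_1}"
  by (simp add: sqf_weight_def norm_power)

lemma sqf_weight_nonneg: "u \<ge> 0 \<Longrightarrow> sqf_weight u d \<ge> (0::real)"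
  by (simp add: sqf_weight_def)

lemma sqf_weight_mono: "0 \<le> u \<Longrightarrow> u \<le> v \<Longrightarrow> sqf_weight u d \<le> (sqf_weight v d :: real)"
  by (simp add: sqf_weight_def power_mono)

lemma sqf_weight_prime_mult:
  assumes "prime p" "\<not> p dvd m"
  shows "sqf_weight u (p * m) = u * sqf_weight u m"
proof (cases "squarefree m")
  case True
  then have m: "m > 0" by (intro Nat.gr0I) auto
  have "coprime p m" using assms by (simp add: prime_imp_coprime)
  then have "squarefree (p * m)" using True assms squarefree_prime[of p] by (simp add: squarefree_mult_coprime)
  moreover have "prime_factors (p * m) = insert p (prime_factors m)"
    using assms m by (simp add: prime_factors_product prime_gt_0_nat prime_prime_factors)
  moreover have "p \<notin> prime_factors m" using assms by auto
  ultimately show ?thesis using True by (simp add: sqf_weight_def prime_omega_def)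
next
  case False
  then have "\<not> squarefree (p * m)" using squarefree_multD(2) by blast
  then show ?thesis using False by (simp add: sqf_weight_def)
qed

text \<open>A squarefree d with a marked prime factor p is a squarefree m = d / p together with a
  prime p not dividing it, and the weight gains a factor \<open>u\<close>. \<open>W\<close> is
  arbitrary because ln p, ln p / d and ln p / (p d) all occur below.\<close>

lemma sqf_weight_prime_swap:
  fixes W :: "nat \<Rightarrow> nat \<Rightarrow> 'a::comm_ring_1"
  shows "(\<Sum>d=1..N. \<Sum>p\<in>prime_factors d. sqf_weight u d * W d p)
       = u * (\<Sum>m=1..N. sqf_weight u m * (\<Sum>p | prime p \<and> p * m \<le> N \<and> \<not> p dvd m. W (p * m) p))"
proof -
  define X where "X = (SIGMA d:{1..N}. prime_factors d)"
  define X' where "X' = {(d, p) \<in> X. squarefree d}"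
  define Q where "Q = (\<lambda>m. {p. prime p \<and> p * m \<le> N \<and> \<not> p dvd m})"
  define Y where "Y = (SIGMA m:{1..N}. Q m)"
  define Y' where "Y' = {(m, p) \<in> Y. squarefree m}"
  have finQ: "finite (Q m)" if "m \<in> {1..N}" for m
  proof (rule finite_subset)
    show "Q m \<subseteq> {..N}"
    proof
      fix p assume "p \<in> Q m"
      then have "p * m \<le> N" by (simp add: Q_def)
      moreover have "p * 1 \<le> p * m" using that by (intro mult_le_mono2) auto
      ultimately have "p \<le> N" by linarith
      then show "p \<in> {..N}" by simp
    qed
  qed simp
  have finX: "finite X" unfolding X_def by auto
  have finY: "finite Y" unfolding Y_def using finQ by auto
  have "(\<Sum>d=1..N. \<Sum>p\<in>prime_factors d. sqf_weight u d * W d p) = (\<Sum>(d,p)\<in>X. sqf_weight u d * W d p)"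
    unfolding X_def by (subst sum.Sigma) auto
  \<comment> \<open>The correspondence is a bijection only between squarefree numbers; the other
    pairs have weight 0 and are removed here and restored at the end.\<close>
  also have "\<dots> = (\<Sum>(d,p)\<in>X'. sqf_weight u d * W d p)"
    unfolding X'_def using finX by (intro sum.mono_neutral_right) (auto simp: sqf_weight_def split: if_splits)
  also have "\<dots> = (\<Sum>(m,p)\<in>Y'. u * (sqf_weight u m * W (p * m) p))"
  proof (rule sum.reindex_bij_witness[where i = "\<lambda>(m,p). (p * m, p)" and j = "\<lambda>(d,p). (d div p, p)"], goal_cases)
    case (1 a)
    then obtain d p where a: "a = (d, p)" "d \<in> {1..N}" "p \<in> prime_factors d" by (auto simp: X'_def X_def)
    then show ?case by auto
  next
    case (2 a)
    then obtain d p where a: "a = (d, p)" "d \<in> {1..N}" "prime p" "p dvd d" "squarefree d" by (auto simp: X'_def X_def)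
    then obtain m where m: "d = p * m" by (auto elim: dvdE)
    have p: "p > 0" using a by (simp add: prime_gt_0_nat)
    have "\<not> p dvd m"
    proof
      assume "p dvd m"
      then have "p ^ 2 dvd d" unfolding m power2_eq_square by (intro mult_dvd_mono) auto
      then have "is_unit p" using a(5) by (auto simp: squarefree_def)
      then show False using a(3) by auto
    qed
    moreover have "squarefree m" using a(5) m squarefree_multD(2) by blast
    moreover have "m \<le> p * m" using p by simp
    moreover have "p * m \<le> N" using a(2) m by simp
    ultimately have "\<not> p dvd m" "squarefree m" "m \<le> N" by (blast, blast, linarith)
    moreover have "m \<ge> 1" using a m by (cases m) auto
    ultimately show ?case using a p by (auto simp: m Y'_def Y_def Q_def)
  next
    case (3 b)
    then show ?case by (auto simp: Y'_def Y_def Q_def prime_gt_0_nat)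
  next
    case (4 b)
    then obtain m p where b: "b = (m, p)" "m \<ge> 1" "prime p" "p * m \<le> N" "\<not> p dvd m" "squarefree m"
      by (auto simp: Y'_def Y_def Q_def)
    have "coprime p m" using b by (simp add: prime_imp_coprime)
    then have "squarefree (p * m)" using b squarefree_prime[of p] by (simp add: squarefree_mult_coprime)
    moreover have "p * m > 0" using b by (simp add: prime_gt_0_nat)
    ultimately show ?case using b by (auto simp: X'_def X_def prime_factors_dvd)
  next
    case (5 a)
    then obtain d p where a: "a = (d, p)" "d \<in> {1..N}" "prime p" "p dvd d" "squarefree d" by (auto simp: X'_def X_def)
    then obtain m where m: "d = p * m" by (auto elim: dvdE)
    have p: "p > 0" using a by (simp add: prime_gt_0_nat)
    have "\<not> p dvd m"
    proof
      assume "p dvd m"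
      then have "p ^ 2 dvd d" unfolding m power2_eq_square by (intro mult_dvd_mono) auto
      then have "is_unit p" using a(5) by (auto simp: squarefree_def)
      then show False using a(3) by auto
    qed
    then have "sqf_weight u (p * m) = u * sqf_weight u m" using a by (intro sqf_weight_prime_mult)
    then show ?case using p by (simp add: a(1) m mult.assoc)
  qed
  also have "\<dots> = (\<Sum>(m,p)\<in>Y. u * (sqf_weight u m * W (p * m) p))"
    unfolding Y'_def using finY by (intro sum.mono_neutral_left) (auto simp: sqf_weight_def split: if_splits)
  also have "\<dots> = (\<Sum>m=1..N. \<Sum>p\<in>Q m. u * (sqf_weight u m * W (p * m) p))"
    unfolding Y_def using finQ by (subst sum.Sigma) auto
  also have "\<dots> = u * (\<Sum>m=1..N. sqf_weight u m * (\<Sum>p\<in>Q m. W (p * m) p))"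
    by (simp add: sum_distrib_left)
  finally show ?thesis unfolding Q_def .
qed

lemma prod_prime_factors_squarefree:
  assumes "squarefree (d::nat)"
  shows "(\<Prod>p\<in>prime_factors d. p) = d"
proof -
  have d: "d \<noteq> 0" using assms by (intro notI) auto
  have "d = (\<Prod>p\<in>prime_factors d. p ^ multiplicity p d)" using d by (simp add: prime_factorization_nat)
  also have "\<dots> = (\<Prod>p\<in>prime_factors d. p)"
    using assms squarefree_factorial_semiring'[OF d] by (intro prod.cong) auto
  finally show ?thesis ..
qed

lemma ln_squarefree:
  assumes "squarefree (d::nat)"
  shows "ln (real d) = (\<Sum>p\<in>prime_factors d. ln (real p))"
proof -
  have "real d = (\<Prod>p\<in>prime_factors d. real p)"
    by (subst (1) prod_prime_factors_squarefree[OF assms, symmetric]) (rule of_nat_prod)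
  also have "ln \<dots> = (\<Sum>p\<in>prime_factors d. ln (real p))"
    by (rule ln_prod) (auto intro: prime_gt_0_nat)
  finally show ?thesis .
qed

text \<open>Different squarefree numbers up to \<open>N\<close> have different sets of prime
  factors, so the sum is at most the product of 1 + u/p over primes up to \<open>N\<close>, and 1 +
  t is at most exp t.\<close>

lemma sum_sqf_weight_over_le:
  assumes u: "u \<ge> 0"
  shows "(\<Sum>d=1..N. sqf_weight u d / real d) \<le> exp (u * (\<Sum>p | prime p \<and> p \<le> N. 1 / real p))"
proof -
  let ?P = "{p. prime p \<and> p \<le> N}"
  define D where "D = {d\<in>{1..N}. squarefree d}"
  have "(\<Sum>d=1..N. sqf_weight u d / real d) = (\<Sum>d\<in>D. sqf_weight u d / real d)"
    unfolding D_def by (intro sum.mono_neutral_right) (auto simp: sqf_weight_def)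
  also have "\<dots> = (\<Sum>d\<in>D. \<Prod>p\<in>prime_factors d. u / real p)"
  proof (rule sum.cong[OF refl])
    fix d assume "d \<in> D"
    then have d: "squarefree d" "d > 0" by (auto simp: D_def)
    have "real d = (\<Prod>p\<in>prime_factors d. real p)"
      by (subst (1) prod_prime_factors_squarefree[OF d(1), symmetric]) (rule of_nat_prod)
    then show "sqf_weight u d / real d = (\<Prod>p\<in>prime_factors d. u / real p)"
      using d by (simp add: sqf_weight_def prime_omega_def prod_dividef)
  qed
  also have "\<dots> = (\<Sum>X\<in>prime_factors ` D. \<Prod>p\<in>X. u / real p)"
  proof (subst sum.reindex)
    show "inj_on prime_factors D"
    proof (rule inj_onI)
      fix d e assume de: "d \<in> D" "e \<in> D" "prime_factors d = prime_factors e"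
      have "(\<Prod>p\<in>prime_factors x. p) = x" if "x \<in> D" for x
        using that by (intro prod_prime_factors_squarefree) (simp add: D_def)
      with de show "d = e" by metis
    qed
  qed simp
  also have "\<dots> \<le> (\<Sum>X\<in>Pow ?P. \<Prod>p\<in>X. u / real p)"
    using u by (intro sum_mono2 prod_nonneg) (auto simp: D_def prime_factors_dvd dest: dvd_imp_le)
  also have "\<dots> = (\<Prod>p\<in>?P. u / real p + 1)"
    by (subst prod_add) auto
  also have "\<dots> \<le> (\<Prod>p\<in>?P. exp (u / real p))"
    using u by (intro prod_mono) (auto intro!: add_nonneg_nonneg simp: exp_ge_add_one_self add.commute)
  also have "\<dots> = exp (u * (\<Sum>p\<in>?P. 1 / real p))"
    by (simp add: exp_sum sum_distrib_left)
  finally show ?thesis .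
qed

text \<open>Bounding 1 by N/d would lose a logarithm. Instead split ln N = ln d + ln (N/d): the
  first part becomes a sum over d = p m, estimated by Chebyshev's bound, and the second uses that ln
  t is at most t. The factor ln N gained here makes the rounding in \<open>N div d\<close>
  negligible later.\<close>

lemma sum_sqf_weight_le:
  assumes u: "0 \<le> u" "u \<le> 1"
  shows "ln (real N) * (\<Sum>d=1..N. sqf_weight u d) \<le> (4 * ln 2 + 1) * real N * (\<Sum>d=1..N. sqf_weight u d / real d)"
proof -
  have "ln (real N) * (\<Sum>d=1..N. sqf_weight u d) = (\<Sum>d=1..N. sqf_weight u d * ln (real d) + sqf_weight u d * (ln (real N) - ln (real d)))"
    by (simp add: sum_distrib_left algebra_simps)
  also have "\<dots> = (\<Sum>d=1..N. sqf_weight u d * ln (real d)) + (\<Sum>d=1..N. sqf_weight u d * (ln (real N) - ln (real d)))"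
    by (rule sum.distrib)
  also have "(\<Sum>d=1..N. sqf_weight u d * ln (real d)) = (\<Sum>d=1..N. \<Sum>p\<in>prime_factors d. sqf_weight u d * ln (real p))"
    by (intro sum.cong refl) (auto simp: sqf_weight_def ln_squarefree sum_distrib_left)
  also have "\<dots> = u * (\<Sum>m=1..N. sqf_weight u m * (\<Sum>p | prime p \<and> p * m \<le> N \<and> \<not> p dvd m. ln (real p)))"
    by (rule sqf_weight_prime_swap)
  also have "\<dots> \<le> 1 * (\<Sum>m=1..N. sqf_weight u m * (4 * ln 2 * (real N / real m)))"
  proof (intro mult_mono sum_mono mult_left_mono sqf_weight_nonneg u sum_nonneg mult_nonneg_nonneg)
    fix m assume m: "m \<in> {1..N}"
    have "{p. prime p \<and> p * m \<le> N \<and> \<not> p dvd m} \<subseteq> {p. prime p \<and> p \<le> N div m}"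
      using m by (auto simp: less_eq_div_iff_mult_less_eq)
    then have "(\<Sum>p | prime p \<and> p * m \<le> N \<and> \<not> p dvd m. ln (real p)) \<le> (\<Sum>p | prime p \<and> p \<le> N div m. ln (real p))"
      by (intro sum_mono2) (auto intro: ln_real_nonneg)
    also have "\<dots> \<le> 4 * ln 2 * real (N div m)" by (rule primes_theta_le)
    also have "\<dots> \<le> 4 * ln 2 * (real N / real m)" by (intro mult_left_mono of_nat_div_le_of_nat) auto
    finally show "(\<Sum>p | prime p \<and> p * m \<le> N \<and> \<not> p dvd m. ln (real p)) \<le> 4 * ln 2 * (real N / real m)" .
  qed (auto intro: ln_real_nonneg)
  also have "(\<Sum>d=1..N. sqf_weight u d * (ln (real N) - ln (real d))) \<le> (\<Sum>d=1..N. sqf_weight u d * (real N / real d))"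
  proof (intro sum_mono mult_left_mono sqf_weight_nonneg u)
    fix d assume d: "d \<in> {1..N}"
    then have "ln (real N / real d) \<le> real N / real d - 1" by (intro ln_le_minus_one) auto
    then show "ln (real N) - ln (real d) \<le> real N / real d" using d by (simp add: ln_div)
  qed
  also have "1 * (\<Sum>m=1..N. sqf_weight u m * (4 * ln 2 * (real N / real m))) + (\<Sum>d=1..N. sqf_weight u d * (real N / real d))
      = (4 * ln 2 + 1) * real N * (\<Sum>d=1..N. sqf_weight u d / real d)"
    by (simp add: sum_distrib_left sum.distrib[symmetric] algebra_simps)
  finally show ?thesis by simp
qed

section \<open>An approximate differential equation for the weighted sums in the variable y = ln
  x\<close>

definition sqf_sum :: "'a::field \<Rightarrow> nat \<Rightarrow> 'a" where
  "sqf_sum u N = (\<Sum>d=1..N. sqf_weight u d / of_nat d)"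

definition floor_exp :: "real \<Rightarrow> nat" where
  "floor_exp y = nat \<lfloor>exp y\<rfloor>"

text \<open>For y at least 0 this is the integral of the step function
  \<open>sqf_sum u (floor_exp t)\<close> over t from 0 to y: the jump at ln d has then been present
  for a length y - ln d.\<close>

definition sqf_integral :: "complex \<Rightarrow> real \<Rightarrow> complex" where
  "sqf_integral u y = (\<Sum>d=1..floor_exp y. sqf_weight u d / of_nat d * of_real (y - ln (real d)))"

lemma le_floor_exp_iff: "n \<le> floor_exp y \<longleftrightarrow> real n \<le> exp y"
  by (simp add: floor_exp_def le_nat_iff le_floor_iff)

lemma le_floor_exp_iff_ln: "n > 0 \<Longrightarrow> n \<le> floor_exp y \<longleftrightarrow> ln (real n) \<le> y"
  unfolding le_floor_exp_iff using exp_le_cancel_iff[of "ln (real n)" y] by simp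

lemma sqf_sum_real_nonneg: "u \<ge> 0 \<Longrightarrow> sqf_sum u N \<ge> (0::real)"
  unfolding sqf_sum_def by (intro sum_nonneg divide_nonneg_nonneg sqf_weight_nonneg) auto

lemma sqf_sum_real_mono: "0 \<le> u \<Longrightarrow> u \<le> v \<Longrightarrow> sqf_sum u N \<le> (sqf_sum v N :: real)"
  unfolding sqf_sum_def by (intro sum_mono divide_right_mono sqf_weight_mono) auto

lemma sqf_sum_real_bound:
  obtains K where "K > 0" "\<And>u y. 0 \<le> u \<Longrightarrow> u \<le> 1/8 \<Longrightarrow> y \<ge> ln 3 \<Longrightarrow> sqf_sum u (floor_exp y) \<le> K * y powr (1/8)"
proof -
  obtain C where C: "C > 0" "\<And>t. t \<ge> 3 \<Longrightarrow> (\<Sum>p | prime p \<and> real p \<le> t. 1 / real p) \<le> ln (ln t) + C"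
    by (rule mertens_second_upper) blast
  show ?thesis
  proof (rule that[of "exp (C / 8)"])
    fix u y :: real assume u: "0 \<le> u" "u \<le> 1/8" and y: "y \<ge> ln 3"
    have y0: "y > 0" using y ln_gt_zero[of 3] by linarith
    have e3: "exp y \<ge> 3" using y exp_le_cancel_iff[of "ln 3" y] by simp
    have "sqf_sum u (floor_exp y) \<le> sqf_sum (1/8) (floor_exp y)" using u by (rule sqf_sum_real_mono)
    also have "\<dots> \<le> exp (1/8 * (\<Sum>p | prime p \<and> p \<le> floor_exp y. 1 / real p))"
      unfolding sqf_sum_def by (rule sum_sqf_weight_over_le) simp
    also have "\<dots> = exp (1/8 * (\<Sum>p | prime p \<and> real p \<le> exp y. 1 / real p))"
      by (simp add: le_floor_exp_iff)
    also have "\<dots> \<le> exp (1/8 * (ln y + C))"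
      using C(2)[OF e3] by simp
    also have "\<dots> = exp (C / 8) * y powr (1/8)"
      using y0 by (simp add: powr_def exp_add[symmetric] field_simps)
    finally show "sqf_sum u (floor_exp y) \<le> exp (C / 8) * y powr (1/8)" .
  qed simp
qed

text \<open>Write y = ln d + (y - ln d). The second part gives \<open>sqf_integral\<close>. In the
  first, ln d is a sum of ln p and d = p m, which leaves an inner sum of ln p / p over primes up to
  exp y / m. That sum is close to y - ln m, so \<open>u\<close> times \<open>sqf_integral\<close>
  splits off and the right-hand side consists of errors only.\<close>

lemma sqf_sum_ode:
  fixes u :: complex and y :: real
  defines "N \<equiv> floor_exp y"
  shows "of_real y * sqf_sum u N - (1 + u) * sqf_integral u y =
    u * (\<Sum>m=1..N. sqf_weight u m / of_nat m * of_real ((\<Sum>p | prime p \<and> p * m \<le> N \<and> \<not> p dvd m. ln (real p) / real p) - (y - ln (real m))))"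
proof -
  have "of_real y * sqf_sum u N - sqf_integral u y = (\<Sum>d=1..N. sqf_weight u d / of_nat d * of_real (ln (real d)))"
    unfolding sqf_sum_def sqf_integral_def N_def[symmetric]
    by (simp add: sum_distrib_left sum_subtractf[symmetric] algebra_simps)
  also have "\<dots> = (\<Sum>d=1..N. \<Sum>p\<in>prime_factors d. sqf_weight u d * (of_real (ln (real p)) / of_nat d))"
    by (intro sum.cong refl) (auto simp: sqf_weight_def ln_squarefree sum_distrib_left sum_divide_distrib)
  also have "\<dots> = u * (\<Sum>m=1..N. sqf_weight u m * (\<Sum>p | prime p \<and> p * m \<le> N \<and> \<not> p dvd m. of_real (ln (real p)) / of_nat (p * m)))"
    by (rule sqf_weight_prime_swap)
  also have "\<dots> = u * (\<Sum>m=1..N. sqf_weight u m / of_nat m * of_real (\<Sum>p | prime p \<and> p * m \<le> N \<and> \<not> p dvd m. ln (real p) / real p))"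
    by (intro arg_cong[of _ _ "\<lambda>z. u * z"] sum.cong refl)
      (simp add: sum_distrib_left sum_divide_distrib field_simps)
  finally have 1: "of_real y * sqf_sum u N - sqf_integral u y = u * (\<Sum>m=1..N. sqf_weight u m / of_nat m * of_real (\<Sum>p | prime p \<and> p * m \<le> N \<and> \<not> p dvd m. ln (real p) / real p))" .
  show ?thesis
    unfolding of_real_diff[of "sum _ _"] right_diff_distrib[of "_ / _"] sum_subtractf
    unfolding sqf_integral_def[of u y, folded N_def, symmetric]
    using 1 by (simp only: of_real_diff right_diff_distrib[of u] distrib_right mult_1_left) (simp add: sqf_integral_def N_def algebra_simps)
qed

lemma sqf_sum_ode_bound:
  obtains K where "K > 0" "\<And>u y. norm u \<le> 1/8 \<Longrightarrow> y \<ge> ln 3 \<Longrightarrow>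
     norm (of_real y * sqf_sum u (floor_exp y) - (1 + u) * sqf_integral u y) \<le> K * y powr (1/8)"
proof -
  obtain K where K: "K > 0" "\<And>u y. 0 \<le> u \<Longrightarrow> u \<le> 1/8 \<Longrightarrow> y \<ge> ln 3 \<Longrightarrow> sqf_sum u (floor_exp y) \<le> K * y powr (1/8)"
    by (rule sqf_sum_real_bound) blast
  obtain C where C: "C > 0" "\<And>t. t \<ge> 1 \<Longrightarrow> \<bar>(\<Sum>p | prime p \<and> real p \<le> t. ln (real p) / real p) - ln t\<bar> \<le> C"
    by (rule mertens_first) blast
  define Z where "Z = (\<Sum>k. 2 * ln (real k) / real k ^ 2)"
  have Z: "Z \<ge> 0" unfolding Z_def
    by (intro suminf_nonneg summable_ln_over_square) (auto intro!: divide_nonneg_nonneg ln_real_nonneg)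
  show ?thesis
  proof (rule that[of "(C + Z) * K"])
    show "(C + Z) * K > 0" using K C Z by (intro mult_pos_pos) auto
    fix u :: complex and y :: real
    assume u: "norm u \<le> 1/8" and y: "y \<ge> ln 3"
    define N where "N = floor_exp y"
    let ?P = "\<lambda>m. {p. prime p \<and> p * m \<le> N \<and> \<not> p dvd m}"
    define v where "v = norm u"
    have v: "0 \<le> v" "v \<le> 1/8" using u by (auto simp: v_def)
    \<comment> \<open>The inner sum omits the primes dividing \<open>m\<close>, at a cost of at most
      \<open>b m\<close>. This is unbounded in \<open>m\<close> but harmless on average: splitting
      off the marked prime once more turns ln p / p into the convergent sum of ln p / p^2.\<close>
    define b where "b = (\<lambda>m. \<Sum>p\<in>prime_factors m. ln (real p) / real p)"
    have inner: "\<bar>(\<Sum>p\<in>?P m. ln (real p) / real p) - (y - ln (real m))\<bar> \<le> C + b m"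
      if m: "m \<in> {1..N}" for m
    proof -
      have m0: "real m > 0" "m > 0" using m by auto
      define t where "t = exp y / real m"
      have t: "t \<ge> 1" using m m0 le_floor_exp_iff[of m y] by (simp add: t_def N_def)
      have lnt: "ln t = y - ln (real m)" using m0 by (simp add: t_def ln_div)
      define Q where "Q = {p. prime p \<and> real p \<le> t}"
      have fQ: "finite Q" unfolding Q_def by (rule finite_primes_real_le)
      have Qeq: "?P m = Q - {p \<in> Q. p dvd m}"
        using m0 by (auto simp: Q_def t_def N_def le_floor_exp_iff pos_le_divide_eq)
      have "(\<Sum>p\<in>?P m. ln (real p) / real p)
          = (\<Sum>p\<in>Q. ln (real p) / real p) - (\<Sum>p | p \<in> Q \<and> p dvd m. ln (real p) / real p)"
        unfolding Qeq using fQ by (intro sum_diff) auto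
      moreover have "(\<Sum>p | p \<in> Q \<and> p dvd m. ln (real p) / real p) \<le> b m"
        unfolding b_def using m0 by (intro sum_mono2) (auto simp: Q_def prime_factors_dvd intro!: divide_nonneg_nonneg ln_real_nonneg)
      moreover have "(\<Sum>p | p \<in> Q \<and> p dvd m. ln (real p) / real p) \<ge> 0"
        by (intro sum_nonneg divide_nonneg_nonneg ln_real_nonneg) auto
      ultimately show ?thesis using C(2)[OF t] unfolding lnt Q_def[symmetric] by linarith
    qed
    have "(\<Sum>m=1..N. sqf_weight v m / real m * b m) = (\<Sum>m=1..N. \<Sum>p\<in>prime_factors m. sqf_weight v m * (ln (real p) / (real p * real m)))"
      by (simp add: b_def sum_distrib_left mult.commute)
    also have "\<dots> = v * (\<Sum>m=1..N. sqf_weight v m * (\<Sum>p\<in>?P m. ln (real p) / (real p * real (p * m))))"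
      by (rule sqf_weight_prime_swap)
    also have "\<dots> \<le> 1 * (\<Sum>m=1..N. sqf_weight v m * (Z / real m))"
    proof (intro mult_mono sum_mono mult_left_mono sqf_weight_nonneg v sum_nonneg mult_nonneg_nonneg)
      fix m assume m: "m \<in> {1..N}"
      have fin: "finite (?P m)"
      proof (rule finite_subset)
        show "?P m \<subseteq> {..N}"
        proof
          fix p assume p: "p \<in> ?P m"
          have "p * 1 \<le> p * m" using m by (intro mult_le_mono2) auto
          moreover have "p * m \<le> N" using p by blast
          ultimately have "p \<le> N" by linarith
          then show "p \<in> {..N}" by simp
        qed
      qed simp
      have "(\<Sum>p\<in>?P m. ln (real p) / (real p * real (p * m)))
         = (\<Sum>p\<in>?P m. ln (real p) / real p ^ 2) / real m"
        by (simp add: sum_divide_distrib power2_eq_square mult.assoc)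
      also have "\<dots> \<le> Z / real m"
      proof (intro divide_right_mono)
        have "(\<Sum>p\<in>?P m. ln (real p) / real p ^ 2) \<le> (\<Sum>p\<in>?P m. 2 * ln (real p) / real p ^ 2)"
          using ln_real_nonneg by (intro sum_mono divide_right_mono) auto
        also have "\<dots> \<le> Z" unfolding Z_def
          by (intro sum_le_suminf summable_ln_over_square fin) (auto intro!: divide_nonneg_nonneg ln_real_nonneg)
        finally show "(\<Sum>p\<in>?P m. ln (real p) / real p ^ 2) \<le> Z" .
      qed auto
      finally show "(\<Sum>p\<in>?P m. ln (real p) / (real p * real (p * m))) \<le> Z / real m" .
    qed (use v in \<open>auto intro!: divide_nonneg_nonneg ln_real_nonneg\<close>)
    also have "\<dots> = Z * sqf_sum v N"
      by (simp add: sqf_sum_def sum_distrib_left mult_ac)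
    finally have b: "(\<Sum>m=1..N. sqf_weight v m / real m * b m) \<le> Z * sqf_sum v N" .
    have "norm (of_real y * sqf_sum u N - (1 + u) * sqf_integral u y) =
      v * norm (\<Sum>m=1..N. sqf_weight u m / of_nat m * of_real ((\<Sum>p\<in>?P m. ln (real p) / real p) - (y - ln (real m))))"
      unfolding N_def sqf_sum_ode norm_mult v_def ..
    also have "\<dots> \<le> 1 * (\<Sum>m=1..N. sqf_weight v m / real m * (C + b m))"
    proof (intro mult_mono)
      show "norm (\<Sum>m=1..N. sqf_weight u m / of_nat m * of_real ((\<Sum>p\<in>?P m. ln (real p) / real p) - (y - ln (real m))))
         \<le> (\<Sum>m=1..N. sqf_weight v m / real m * (C + b m))"
      proof (rule order.trans[OF norm_sum], rule sum_mono)
        fix m assume m: "m \<in> {1..N}"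
        have "norm (sqf_weight u m / of_nat m * of_real ((\<Sum>p\<in>?P m. ln (real p) / real p) - (y - ln (real m))))
            = sqf_weight v m / real m * \<bar>(\<Sum>p\<in>?P m. ln (real p) / real p) - (y - ln (real m))\<bar>"
          by (simp only: norm_mult norm_divide norm_sqf_weight norm_of_real norm_of_nat v_def)
        also have "\<dots> \<le> sqf_weight v m / real m * (C + b m)"
          by (intro mult_left_mono inner m divide_nonneg_nonneg sqf_weight_nonneg v) simp
        finally show "norm (sqf_weight u m / of_nat m * of_real ((\<Sum>p\<in>?P m. ln (real p) / real p) - (y - ln (real m))))
           \<le> sqf_weight v m / real m * (C + b m)" .
      qed
    qed (use v in auto)
    also have "\<dots> = C * sqf_sum v N + (\<Sum>m=1..N. sqf_weight v m / real m * b m)"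
      by (simp add: sqf_sum_def sum_distrib_left sum.distrib[symmetric] algebra_simps add_divide_distrib)
    also have "\<dots> \<le> (C + Z) * sqf_sum v N" using b by (simp add: algebra_simps)
    also have "\<dots> \<le> (C + Z) * (K * y powr (1/8))"
      using K(2)[OF v y] C Z unfolding N_def by (intro mult_left_mono) auto
    finally show "norm (of_real y * sqf_sum u (floor_exp y) - (1 + u) * sqf_integral u y) \<le> (C + Z) * K * y powr (1/8)"
      by (simp add: N_def mult.assoc)
  qed
qed

lemma has_real_derivative_ramp:
  "y \<noteq> c \<Longrightarrow> ((\<lambda>y. max 0 (y - c)) has_real_derivative (if c \<le> y then 1 else 0)) (at y)"
proof (cases "y > c")
  case True
  have "((\<lambda>y. y - c) has_real_derivative 1) (at y)" by (auto intro!: derivative_eq_intros)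
  then have "((\<lambda>y. max 0 (y - c)) has_real_derivative 1) (at y)"
    by (rule has_field_derivative_transform_within_open[of _ _ _ "{c<..}"]) (use True in auto)
  then show ?thesis using True by simp
next
  case False
  assume "y \<noteq> c"
  have "((\<lambda>y. 0) has_real_derivative 0) (at y)" by simp
  then have "((\<lambda>y. max 0 (y - c)) has_real_derivative 0) (at y)"
    by (rule has_field_derivative_transform_within_open[of _ _ _ "{..<c}"]) (use False \<open>y \<noteq> c\<close> in auto)
  then show ?thesis using False \<open>y \<noteq> c\<close> by simp
qed

text \<open>Division by y^(1 + u), the solution of the homogeneous equation y f' = (1 + u)
  f.\<close>

definition sqf_normalized :: "complex \<Rightarrow> real \<Rightarrow> complex" where
  "sqf_normalized u y = sqf_integral u y * exp (- (1 + u) * of_real (ln y))"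

lemma norm_exp_weight_le:
  fixes u :: complex
  assumes "norm u \<le> 1/8" "y \<ge> 1"
  shows "norm (exp (- (1 + u) * of_real (ln y))) \<le> y powr (-7/8)"
proof -
  have "\<bar>Re u\<bar> \<le> 1/8" using abs_Re_le_cmod[of u] assms by linarith
  then have r: "- (1 + Re u) \<le> -7/8" by linarith
  have "norm (exp (- (1 + u) * of_real (ln y))) = y powr (- (1 + Re u))"
    using assms by (simp add: norm_exp_eq_Re powr_def)
  also have "\<dots> \<le> y powr (-7/8)" using r assms by (intro powr_mono) auto
  finally show ?thesis .
qed

lemma ln_3_gt_1: "ln 3 > (1::real)"
proof -
  have "ln (exp 1) < ln (3::real)" using e_less_272 by (subst ln_less_cancel_iff) auto
  then show ?thesis by simp
qed

text \<open>The derivative is \<open>E y * D y / y\<close> with \<open>D\<close> the defect in the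
  equation. Its size is at most y^(-7/8) y^(1/8) y^(-1) = y^(-7/4) up to the factor
  \<open>K\<close>, and the integral of this from \<open>a\<close> on is 4/3 a^(-3/4).\<close>

lemma sqf_normalized_increment:
  assumes K: "K > 0" "\<And>y. y \<ge> ln 3 \<Longrightarrow>
     norm (of_real y * sqf_sum u (floor_exp y) - (1 + u) * sqf_integral u y) \<le> K * y powr (1/8)"
    and u: "norm u \<le> 1/8" and ab: "ln 3 \<le> a" "a \<le> b"
  shows "norm (sqf_normalized u b - sqf_normalized u a) \<le> 2 * K * a powr (-3/4)"
proof -
  have ln3: "ln 3 > (1::real)" by (rule ln_3_gt_1)
  define M where "M = floor_exp b"
  define S where "S = {ln (real d) |d. d \<in> {1..M}}"
  define E where "E = (\<lambda>y. exp (- (1 + u) * of_real (ln y)))"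
  define D where "D = (\<lambda>y. of_real y * sqf_sum u (floor_exp y) - (1 + u) * sqf_integral u y)"
  define w where "w = (\<lambda>d. sqf_weight u d / of_nat d)"
  \<comment> \<open>With the number of summands frozen at its value for \<open>b\<close>, the
    integral is one finite sum of ramps on all of [a, b], differentiable except at the finitely many
    points in \<open>S\<close>.\<close>
  define T where "T = (\<lambda>y. \<Sum>d=1..M. w d * of_real (max 0 (y - ln (real d))))"
  have mono: "floor_exp y \<le> M" if "y \<le> b" for y
    unfolding M_def floor_exp_def using that by (intro nat_mono floor_mono) simp
  have T: "sqf_integral u y = T y" if y: "y \<le> b" for y
    unfolding sqf_integral_def T_def w_def
  proof (rule sum.mono_neutral_cong_left)
    show "{1..floor_exp y} \<subseteq> {1..M}" using mono[OF y] by auto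
    show "\<forall>d\<in>{1..M} - {1..floor_exp y}. sqf_weight u d / of_nat d * of_real (max 0 (y - ln (real d))) = 0"
      using le_floor_exp_iff_ln[of _ y] by auto
    show "sqf_weight u d / of_nat d * of_real (y - ln (real d)) = sqf_weight u d / of_nat d * of_real (max 0 (y - ln (real d)))"
      if "d \<in> {1..floor_exp y}" for d
    proof -
      have "ln (real d) \<le> y" using le_floor_exp_iff_ln[of d y] that by simp
      then show ?thesis by simp
    qed
  qed simp
  have Ssum: "sqf_sum u (floor_exp y) = (\<Sum>d=1..M. w d * of_real (if ln (real d) \<le> y then 1 else 0))" if y: "y \<le> b" for y
    unfolding sqf_sum_def w_def
  proof (rule sum.mono_neutral_cong_left)
    show "{1..floor_exp y} \<subseteq> {1..M}" using mono[OF y] by auto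
    show "\<forall>d\<in>{1..M} - {1..floor_exp y}. sqf_weight u d / of_nat d * of_real (if ln (real d) \<le> y then 1 else 0) = 0"
      using le_floor_exp_iff_ln[of _ y] by auto
    show "sqf_weight u d / of_nat d = sqf_weight u d / of_nat d * of_real (if ln (real d) \<le> y then 1 else 0)"
      if "d \<in> {1..floor_exp y}" for d
    proof -
      have "ln (real d) \<le> y" using le_floor_exp_iff_ln[of d y] that by simp
      then show ?thesis by simp
    qed
  qed simp
  have E_deriv: "(E has_vector_derivative (of_real (1 / y) * (- (1 + u) * E y))) (at y)" if "y > 0" for y
  proof -
    have "((\<lambda>y. complex_of_real (ln y)) has_vector_derivative of_real (1 / y)) (at y)"
      using that by (intro bounded_linear.has_vector_derivative[OF bounded_linear_of_real])
        (auto simp flip: has_real_derivative_iff_has_vector_derivative intro!: derivative_eq_intros)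
    moreover have "((\<lambda>z. exp (- (1 + u) * z)) has_field_derivative (- (1 + u) * exp (- (1 + u) * of_real (ln y)))) (at (of_real (ln y)))"
      by (auto intro!: derivative_eq_intros)
    ultimately have "((\<lambda>z. exp (- (1 + u) * z)) \<circ> (\<lambda>y. complex_of_real (ln y)) has_vector_derivative
        (of_real (1 / y) * (- (1 + u) * exp (- (1 + u) * of_real (ln y))))) (at y)"
      by (rule field_vector_diff_chain_at)
    then show ?thesis by (simp add: E_def o_def)
  qed
  have hi: "((\<lambda>y. E y * D y / of_real y) has_integral (T b * E b - T a * E a)) {a..b}"
  proof (rule fundamental_theorem_of_calculus_strong[of S])
    show "finite S" unfolding S_def by auto
    fix y assume y: "y \<in> {a..b} - S"
    then have y0: "y > 0" "y \<le> b" using ab ln3 by auto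
    have "(T has_vector_derivative (\<Sum>d=1..M. w d * of_real (if ln (real d) \<le> y then 1 else 0))) (at y)"
      unfolding T_def
    proof (intro has_vector_derivative_sum has_vector_derivative_mult_right bounded_linear.has_vector_derivative[OF bounded_linear_of_real])
      fix d assume "d \<in> {1..M}"
      then have "y \<noteq> ln (real d)" using y by (auto simp: S_def)
      from has_real_derivative_ramp[OF this]
      show "((\<lambda>y. max 0 (y - ln (real d))) has_vector_derivative (if ln (real d) \<le> y then 1 else 0)) (at y)"
        by (simp add: has_real_derivative_iff_has_vector_derivative)
    qed
    then have "(T has_vector_derivative (sqf_sum u (floor_exp y))) (at y)" using Ssum[OF y0(2)] by simp
    from has_vector_derivative_mult[OF this E_deriv[OF y0(1)]]
    have "((\<lambda>y. T y * E y) has_vector_derivative (T y * (of_real (1 / y) * (- (1 + u) * E y)) + sqf_sum u (floor_exp y) * E y)) (at y)" .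
    also have "T y * (of_real (1 / y) * (- (1 + u) * E y)) + sqf_sum u (floor_exp y) * E y = E y * D y / of_real y"
      using y0 T[OF y0(2)] by (simp add: D_def field_simps)
    finally show "((\<lambda>y. T y * E y) has_vector_derivative E y * D y / of_real y) (at y)" .
  next
    show "continuous_on {a..b} (\<lambda>y. T y * E y)"
      unfolding T_def E_def using ab ln3 by (intro continuous_intros) auto
  qed (use ab in auto)
  have gi: "((\<lambda>y. K * y powr (-7/4)) has_integral (K * (-4/3 * b powr (-3/4)) - K * (-4/3 * a powr (-3/4)))) {a..b}"
  proof (rule fundamental_theorem_of_calculus)
    fix y assume y: "y \<in> {a..b}"
    then have y0: "y > 0" using ab ln3 by auto
    have "((\<lambda>y. K * (-4/3 * y powr (-3/4))) has_real_derivative (K * (-4/3 * (-3/4 * y powr (-3/4 - 1))))) (at y)"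
      using y0 by (auto intro!: derivative_eq_intros)
    then have "((\<lambda>y. K * (-4/3 * y powr (-3/4))) has_real_derivative (K * y powr (-7/4))) (at y)" by simp
    then show "((\<lambda>y. K * (-4/3 * y powr (-3/4))) has_vector_derivative (K * y powr (-7/4))) (at y within {a..b})"
      by (simp add: has_real_derivative_iff_has_vector_derivative has_vector_derivative_at_within)
  qed (use ab in auto)
  have bound: "norm (E y * D y / of_real y) \<le> K * y powr (-7/4)" if y: "y \<in> {a..b}" for y
  proof -
    have y0: "y \<ge> 1" "y \<ge> ln 3" using y ab ln3 by auto
    have "norm (E y * D y / of_real y) = norm (E y) * norm (D y) / y"
      using y0 by (simp add: norm_mult norm_divide)
    also have "\<dots> \<le> y powr (-7/8) * (K * y powr (1/8)) / y"
      using norm_exp_weight_le[OF u y0(1)] K(2)[OF y0(2)] y0 unfolding E_def D_def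
      by (intro divide_right_mono mult_mono) auto
    also have "\<dots> = K * (y powr (-7/8) * y powr (1/8) * y powr (-1))"
    proof -
      have "y powr (-1) = 1 / y" using y0 by (simp add: powr_minus_divide)
      then show ?thesis by (simp only: times_divide_eq_right mult_1_right mult.assoc mult.left_commute)
    qed
    also have "y powr (-7/8) * y powr (1/8) * y powr (-1) = y powr (-7/4)"
      unfolding powr_add[symmetric] by simp
    finally show ?thesis .
  qed
  have "norm (integral {a..b} (\<lambda>y. E y * D y / of_real y)) \<le> integral {a..b} (\<lambda>y. K * y powr (-7/4))"
    using bound hi gi by (intro integral_norm_bound_integral) (auto simp: integrable_on_def)
  also have "integral {a..b} (\<lambda>y. K * y powr (-7/4)) = K * (-4/3 * b powr (-3/4)) - K * (-4/3 * a powr (-3/4))"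
    using gi by (rule integral_unique)
  also have "\<dots> \<le> 2 * K * a powr (-3/4)"
  proof -
    have "K * b powr (-3/4) \<ge> 0" "K * a powr (-3/4) \<ge> 0" using K by auto
    then show ?thesis by simp
  qed
  also have "integral {a..b} (\<lambda>y. E y * D y / of_real y) = T b * E b - T a * E a"
    using hi by (rule integral_unique)
  finally show ?thesis using T[of b] T[of a] ab by (simp add: sqf_normalized_def E_def)
qed

text \<open>The increments tend to 0, so the normalised integrals converge, to \<open>G0 u\<close>
  say. The sums follow from the equation itself, as \<open>sqf_sum\<close> is
  \<open>((1 + u) * sqf_integral + D) / y\<close>; this is where the factor in
  \<open>G u = (1 + u) * G0 u\<close> comes from.\<close>

lemma sqf_sum_asymp:
  obtains G :: "complex \<Rightarrow> complex" and K :: real where "K > 0" "\<And>u y. norm u \<le> 1/8 \<Longrightarrow> y \<ge> ln 3 \<Longrightarrow>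
     norm (sqf_sum u (floor_exp y) * exp (- u * of_real (ln y)) - G u) \<le> K * y powr (-3/4)"
proof -
  obtain K where K: "K > 0" "\<And>u y. norm u \<le> 1/8 \<Longrightarrow> y \<ge> ln 3 \<Longrightarrow>
     norm (of_real y * sqf_sum u (floor_exp y) - (1 + u) * sqf_integral u y) \<le> K * y powr (1/8)"
    by (rule sqf_sum_ode_bound) blast
  have ln3: "ln 3 > (1::real)" by (rule ln_3_gt_1)
  have inc: "norm (sqf_normalized u b - sqf_normalized u a) \<le> 2 * K * a powr (-3/4)"
    if "norm u \<le> 1/8" "ln 3 \<le> a" "a \<le> b" for u a b
    using sqf_normalized_increment[OF K(1) K(2)[OF that(1)] that] by blast
  have lim0: "((\<lambda>a::real. 2 * K * a powr (-3/4)) \<longlongrightarrow> 0) at_top" by real_asymp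
  define G0 where "G0 = (\<lambda>u. lim (\<lambda>n. sqf_normalized u (real n)))"
  have conv: "(\<lambda>n. sqf_normalized u (real n)) \<longlonglongrightarrow> G0 u" if u: "norm u \<le> 1/8" for u
  proof -
    have "Cauchy (\<lambda>n. sqf_normalized u (real n))"
    proof (rule CauchyI')
      fix e :: real assume "e > 0"
      with lim0 have "eventually (\<lambda>a. dist (2 * K * a powr (-3/4)) 0 < e) at_top" by (rule tendstoD)
      then obtain A where A0: "\<And>a. a \<ge> A \<Longrightarrow> dist (2 * K * a powr (-3/4)) 0 < e"
        unfolding eventually_at_top_linorder by blast
      have A: "2 * K * a powr (-3/4) < e" if "a \<ge> A" for a using A0[OF that] by (simp add: dist_real_def)
      define M where "M = nat \<lceil>max A 2\<rceil>"
      have M: "real M \<ge> A" "real M \<ge> 2" by (auto simp: M_def) linarith+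
      have ln32: "ln 3 \<le> (2::real)" using ln_le_minus_one[of 3] by simp
      show "\<exists>M. \<forall>m\<ge>M. \<forall>n>m. dist (sqf_normalized u (real m)) (sqf_normalized u (real n)) < e"
      proof (intro exI[of _ M] allI impI)
        fix m n assume mn: "M \<le> m" "m < n"
        have "norm (sqf_normalized u (real n) - sqf_normalized u (real m)) \<le> 2 * K * real m powr (-3/4)"
          using mn M ln32 by (intro inc u) linarith+
        also have "\<dots> < e" using mn M by (intro A) linarith
        finally show "dist (sqf_normalized u (real m)) (sqf_normalized u (real n)) < e"
          by (simp add: dist_norm norm_minus_commute)
      qed
    qed
    then show ?thesis unfolding G0_def using Cauchy_convergent convergent_LIMSEQ_iff by blast
  qed
  have V: "norm (sqf_normalized u y - G0 u) \<le> 2 * K * y powr (-3/4)" if u: "norm u \<le> 1/8" and y: "y \<ge> ln 3" for u y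
  proof (rule tendsto_upperbound)
    show "(\<lambda>n. norm (sqf_normalized u y - sqf_normalized u (real n))) \<longlonglongrightarrow> norm (sqf_normalized u y - G0 u)"
      by (intro tendsto_intros conv u)
    show "eventually (\<lambda>n. norm (sqf_normalized u y - sqf_normalized u (real n)) \<le> 2 * K * y powr (-3/4)) sequentially"
      using eventually_ge_at_top[of "nat \<lceil>y\<rceil>"]
    proof eventually_elim
      case (elim n)
      then have "y \<le> real n" by linarith
      from inc[OF u y this] show ?case by (simp add: norm_minus_commute)
    qed
  qed simp
  show ?thesis
  proof (rule that[of "4 * K" "\<lambda>u. (1 + u) * G0 u"])
    fix u :: complex and y :: real assume u: "norm u \<le> 1/8" and y: "y \<ge> ln 3"
    define D where "D = of_real y * sqf_sum u (floor_exp y) - (1 + u) * sqf_integral u y"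
    define E where "E = exp (- (1 + u) * of_real (ln y))"
    have y0: "y \<ge> 1" using y ln3 by linarith
    have eq: "exp (- u * of_real (ln y)) = of_real y * E"
    proof -
      have "of_real y = exp (complex_of_real (ln y))" using y0 by (simp add: exp_of_real)
      then show ?thesis unfolding E_def by (simp add: exp_add[symmetric] algebra_simps)
    qed
    have "sqf_sum u (floor_exp y) * exp (- u * of_real (ln y)) - (1 + u) * G0 u = (1 + u) * (sqf_normalized u y - G0 u) + D * E"
      unfolding eq D_def sqf_normalized_def E_def[symmetric] by (simp add: algebra_simps)
    also have "norm \<dots> \<le> norm (1 + u) * norm (sqf_normalized u y - G0 u) + norm D * norm E"
      by (intro order.trans[OF norm_triangle_ineq]) (simp add: norm_mult)
    also have "\<dots> \<le> 9/8 * (2 * K * y powr (-3/4)) + (K * y powr (1/8)) * y powr (-7/8)"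
    proof (intro add_mono mult_mono)
      show "norm (1 + u) \<le> 9/8" using norm_triangle_ineq[of 1 u] u by simp
    qed (use K V[OF u y] K(2)[OF u y] norm_exp_weight_le[OF u y0] in \<open>auto simp: D_def E_def\<close>)
    also have "(K * y powr (1/8)) * y powr (-7/8) = K * y powr (-3/4)"
      unfolding mult.assoc powr_add[symmetric] by simp
    also have "9/8 * (2 * K * y powr (-3/4)) + K * y powr (-3/4) \<le> 4 * K * y powr (-3/4)"
    proof -
      have "K * y powr (-3/4) \<ge> 0" using K by simp
      then show ?thesis by simp
    qed
    finally show "norm (sqf_sum u (floor_exp y) * exp (- u * of_real (ln y)) - (1 + u) * G0 u) \<le> 4 * K * y powr (-3/4)" .
  qed (use K in auto)
qed

lemma sqf_sum_zero: "N \<ge> 1 \<Longrightarrow> sqf_sum (0::complex) N = 1"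
proof -
  assume N: "N \<ge> 1"
  have "sqf_weight (0::complex) d = (if d = 1 then 1 else 0)" for d
    by (auto simp: sqf_weight_def prime_omega_def power_0_left prime_factorization_empty_iff)
  then have "sqf_sum (0::complex) N = (\<Sum>d=1..N. if d = 1 then 1 else 0)"
    unfolding sqf_sum_def by (intro sum.cong) auto
  also have "\<dots> = 1" using N by (subst sum.delta) auto
  finally show ?thesis .
qed

text \<open>Among the powers of u only u^1 has a nonzero derivative at 0, and a squarefree number
  with a single prime factor is a prime. Differentiating the sums at u = 0 therefore produces the
  sum of 1/p.\<close>

lemma sqf_weight_deriv_zero:
  "((\<lambda>u::complex. sqf_weight u d) has_field_derivative (if prime d then 1 else 0)) (at 0)"
proof (cases "squarefree d")
  case True
  have pd: "prime d \<longleftrightarrow> prime_omega d = 1"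
  proof
    assume "prime d" then show "prime_omega d = 1" by (simp add: prime_omega_def prime_prime_factors)
  next
    assume "prime_omega d = 1"
    then obtain p where p: "prime_factors d = {p}" by (auto simp: prime_omega_def card_1_singleton_iff)
    then have "prime p" by (metis in_prime_factors_imp_prime singletonI)
    moreover have "d = p" using prod_prime_factors_squarefree[OF True] p by simp
    ultimately show "prime d" by simp
  qed
  have "((\<lambda>u::complex. u ^ prime_omega d) has_field_derivative (of_nat (prime_omega d) * 0 ^ (prime_omega d - 1))) (at 0)"
    by (auto intro!: derivative_eq_intros)
  moreover have "of_nat (prime_omega d) * 0 ^ (prime_omega d - 1) = (if prime d then 1 else (0::complex))"
    unfolding pd by (auto simp: power_0_left)
  ultimately show ?thesis using True by (simp add: sqf_weight_def)
next
  case False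
  then have "\<not> prime d" using squarefree_prime by blast
  then show ?thesis using False by (simp add: sqf_weight_def)
qed

lemma sqf_weight_holomorphic: "(\<lambda>u. sqf_weight u d) holomorphic_on S"
  by (cases "squarefree d") (auto simp: sqf_weight_def intro!: holomorphic_intros)

text \<open>The convergence is uniform on the closed disc, so holomorphy and the derivative at 0
  pass to the limit. For the approximants this derivative is the sum of 1/p minus ln ln, whose
  convergence, Mertens' second theorem, is thus a by-product; \<open>mertens_const_unique\<close>
  then names the limit.\<close>

lemma sqf_density:
  obtains G :: "complex \<Rightarrow> complex" and K :: real where "K > 0" "G holomorphic_on ball 0 (1/8)" "G 0 = 1" "deriv G 0 = of_real mertens_const"
    "\<And>u y. norm u \<le> 1/8 \<Longrightarrow> y \<ge> ln 3 \<Longrightarrow>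
     norm (sqf_sum u (floor_exp y) * exp (- u * of_real (ln y)) - G u) \<le> K * y powr (-3/4)"
proof -
  obtain G :: "complex \<Rightarrow> complex" and K :: real where K: "K > 0" and GK: "\<And>u y. norm u \<le> 1/8 \<Longrightarrow> y \<ge> ln 3 \<Longrightarrow>
     norm (sqf_sum u (floor_exp y) * exp (- u * of_real (ln y)) - G u) \<le> K * y powr (-3/4)"
    by (rule sqf_sum_asymp) blast
  define F where "F = (\<lambda>y (u::complex). sqf_sum u (floor_exp y) * exp (- u * of_real (ln y)))"
  have lim0: "((\<lambda>a::real. K * a powr (-3/4)) \<longlongrightarrow> 0) at_top" by real_asymp
  have ul: "uniform_limit (cball 0 (1/8)) F G at_top"
  proof (rule uniform_limitI)
    fix e :: real assume "e > 0"
    from tendstoD[OF lim0 this] eventually_ge_at_top[of "ln 3"]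
    show "eventually (\<lambda>y. \<forall>u\<in>cball 0 (1/8). dist (F y u) (G u) < e) at_top"
    proof eventually_elim
      case (elim y)
      show ?case
      proof
        fix u :: complex assume "u \<in> cball 0 (1/8)"
        then have "dist (F y u) (G u) \<le> K * y powr (-3/4)" using GK[of u y] elim by (simp add: F_def dist_norm)
        also have "\<dots> < e" using elim by (simp add: dist_real_def)
        finally show "dist (F y u) (G u) < e" .
      qed
    qed
  qed
  have Fd: "(F y has_field_derivative ((\<Sum>d=1..floor_exp y. (if prime d then 1 else 0) / of_nat d) * exp (- 0 * of_real (ln y)) + (- of_real (ln y) * exp (- 0 * of_real (ln y))) * sqf_sum 0 (floor_exp y))) (at 0)" for y
    unfolding F_def sqf_sum_def
    by (intro DERIV_mult DERIV_sum DERIV_cdivide sqf_weight_deriv_zero) (auto intro!: derivative_eq_intros)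
  have Fh: "F y holomorphic_on S" for y S
    unfolding F_def sqf_sum_def by (intro holomorphic_intros sqf_weight_holomorphic) auto
  have Gh: "G holomorphic_on ball 0 (1/8)"
    by (rule holomorphic_uniform_limit[OF _ ul])
      (auto intro!: always_eventually Fh holomorphic_on_imp_continuous_on)
  have N1: "floor_exp y \<ge> 1" if "y \<ge> ln 3" for y
    using le_floor_exp_iff[of 1 y] that ln_3_gt_1 by simp
  have "((\<lambda>y. F y 0) \<longlongrightarrow> G 0) at_top"
    using tendsto_uniform_limitI[OF ul] by simp
  moreover have "eventually (\<lambda>y. F y 0 = 1) at_top"
    using eventually_ge_at_top[of "ln 3"] by eventually_elim (simp add: F_def sqf_sum_zero[OF N1])
  ultimately have "((\<lambda>y::real. 1) \<longlongrightarrow> G 0) at_top" by (rule Lim_transform_eventually)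
  then have G0: "G 0 = 1" by (simp add: tendsto_const_iff)
  have "((\<lambda>y. deriv (F y) 0) \<longlongrightarrow> deriv G 0) at_top"
    by (rule deriv_complex_uniform_limit[OF uniform_limit_on_subset[OF ul ball_subset_cball]])
      (auto intro!: always_eventually Fh)
  moreover have "eventually (\<lambda>y. deriv (F y) 0 = of_real ((\<Sum>p | prime p \<and> real p \<le> exp y. 1 / real p) - ln y)) at_top"
    using eventually_ge_at_top[of "ln 3"]
  proof eventually_elim
    case (elim y)
    have "deriv (F y) 0 = (\<Sum>d=1..floor_exp y. (if prime d then 1 else 0) / of_nat d) - of_real (ln y)"
      using DERIV_imp_deriv[OF Fd[of y]] sqf_sum_zero[OF N1[OF elim]] by simp
    also have "(\<Sum>d=1..floor_exp y. (if prime d then 1 else 0) / complex_of_nat d) = (\<Sum>p | prime p \<and> real p \<le> exp y. 1 / of_nat p)"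
      by (intro sum.mono_neutral_cong_right) (auto simp: le_floor_exp_iff Suc_le_eq prime_gt_0_nat)
    finally show ?case by simp
  qed
  ultimately have lim: "((\<lambda>y. complex_of_real ((\<Sum>p | prime p \<and> real p \<le> exp y. 1 / real p) - ln y)) \<longlongrightarrow> deriv G 0) at_top"
    by (rule Lim_transform_eventually)
  have "((\<lambda>y. (\<Sum>p | prime p \<and> real p \<le> exp y. 1 / real p) - ln y) \<longlongrightarrow> Re (deriv G 0)) at_top"
    using tendsto_Re[OF lim] by simp
  from filterlim_compose[OF this ln_at_top]
  have "((\<lambda>t. (\<Sum>p | prime p \<and> real p \<le> exp (ln t). 1 / real p) - ln (ln t)) \<longlongrightarrow> Re (deriv G 0)) at_top" .
  moreover have "eventually (\<lambda>t::real. (\<Sum>p | prime p \<and> real p \<le> exp (ln t). 1 / real p) - ln (ln t) = (\<Sum>p | prime p \<and> real p \<le> t. 1 / real p) - ln (ln t)) at_top"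
    using eventually_gt_at_top[of 0] by eventually_elim simp
  ultimately have "((\<lambda>t. (\<Sum>p | prime p \<and> real p \<le> t. 1 / real p) - ln (ln t)) \<longlongrightarrow> Re (deriv G 0)) at_top"
    by (rule Lim_transform_eventually)
  then have "Re (deriv G 0) = mertens_const" by (rule mertens_const_unique)
  moreover have "Im (deriv G 0) = 0"
    using tendsto_Im[OF lim] by (simp add: tendsto_const_iff)
  ultimately have "deriv G 0 = of_real mertens_const" by (simp add: complex_eq_iff)
  with K GK Gh G0 that show ?thesis by blast
qed

section \<open>The moment generating function\<close>

lemma sqf_weight_divisor_sum:
  assumes "n > 0"
  shows "(\<Sum>d | d dvd n. sqf_weight u d) = (1 + u) ^ prime_omega n"
proof -
  let ?P = "prime_factors n"
  have "(1 + u) ^ prime_omega n = (\<Prod>p\<in>?P. u + 1)"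
    by (simp add: prime_omega_def add.commute)
  also have "\<dots> = (\<Sum>X\<in>Pow ?P. u ^ card X)"
    by (subst prod_add) auto
  also have "\<dots> = (\<Sum>d | d dvd n \<and> squarefree d. u ^ prime_omega d)"
  proof (rule sum.reindex_bij_witness[where i = prime_factors and j = "\<lambda>X. \<Prod>X"])
    fix X assume X: "X \<in> Pow ?P"
    then have fin: "finite X" and pr: "\<And>p. p \<in> X \<Longrightarrow> prime p \<and> p dvd n"
      by (auto intro: finite_subset)
    have sq: "squarefree (\<Prod>p\<in>X. p)"
      using pr by (intro squarefree_prod_coprime) (auto intro: primes_coprime squarefree_prime)
    have pf: "prime_factors (\<Prod>X) = X"
    proof -
      have nz: "\<Prod>X \<noteq> 0" using fin pr not_prime_0 by (metis prod_zero_iff)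
      have "q \<in> X" if q: "prime q" "q dvd \<Prod>X" for q
      proof -
        obtain p where "p \<in> X" "q dvd p" using prime_dvd_prod_iff[OF fin q(1), of "\<lambda>x. x"] q(2) by auto
        then show ?thesis using pr[of p] q primes_dvd_imp_eq by blast
      qed
      moreover have "q dvd \<Prod>X" if "q \<in> X" for q using dvd_prodI[OF fin that, of "\<lambda>x. x"] by simp
      ultimately show ?thesis using nz pr by (auto simp: prime_factors_dvd)
    qed
    show "prime_factors (\<Prod>X) = X" by (rule pf)
    show "\<Prod>X \<in> {d. d dvd n \<and> squarefree d}" using sq pr prod_primes_dvd[OF fin, of n] by auto
    show "u ^ prime_omega (\<Prod>X) = u ^ card X" by (simp add: prime_omega_def pf)
  next
    fix d assume d: "d \<in> {d. d dvd n \<and> squarefree d}"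
    show "\<Prod>(prime_factors d) = d" using d prod_prime_factors_squarefree[of d] by simp
    show "prime_factors d \<in> Pow ?P" using d assms by (auto simp: prime_factors_dvd intro: dvd_trans)
  qed
  also have "\<dots> = (\<Sum>d | d dvd n. sqf_weight u d)"
    using assms by (intro sum.mono_neutral_cong_left) (auto simp: sqf_weight_def)
  finally show ?thesis ..
qed

lemma power_omega_sum:
  "(\<Sum>n=1..N. (1 + u) ^ prime_omega n) = (\<Sum>d=1..N. sqf_weight u d * of_nat (N div d))"
  by (subst sum_divisors_swap[symmetric], intro sum.cong refl) (auto simp: sqf_weight_divisor_sum)

text \<open>Replacing \<open>N div d\<close> by N/d costs at most 1 for each d. The resulting sum of
  weights, divided by N, is smaller than the logarithmic sum by a factor of order ln N.\<close>

lemma power_omega_mean_approx: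
  fixes u :: complex
  assumes "norm u \<le> 1" "N \<ge> 2"
  shows "norm ((\<Sum>n=1..N. (1 + u) ^ prime_omega n) / of_nat N - sqf_sum u N) \<le> (4 * ln 2 + 1) / ln (real N) * sqf_sum (norm u) N"
proof -
  have N: "real N > 0" "ln (real N) > 0" using assms(2) by auto
  have "(\<Sum>n=1..N. (1 + u) ^ prime_omega n) / of_nat N - sqf_sum u N
      = (\<Sum>d=1..N. sqf_weight u d * of_real (real (N div d) - real N / real d)) / of_nat N"
    unfolding power_omega_sum sqf_sum_def using N
    by (simp add: sum_divide_distrib right_diff_distrib diff_divide_distrib sum_subtractf)
  also have "norm \<dots> \<le> (\<Sum>d=1..N. sqf_weight (norm u) d) / real N"
    unfolding norm_divide norm_of_nat
  proof (intro divide_right_mono order.trans[OF norm_sum] sum_mono)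
    fix d assume d: "d \<in> {1..N}"
    have "\<bar>real (N div d) - real N / real d\<bar> \<le> 1"
    proof -
      have "real (N div d) \<le> real N / real d" by (rule of_nat_div_le_of_nat)
      moreover have "real N / real d - real (N div d) \<le> 1"
        using real_div_less_Suc_div[of d N] d by simp
      ultimately show ?thesis by simp
    qed
    then have "norm (sqf_weight u d) * \<bar>real (N div d) - real N / real d\<bar> \<le> norm (sqf_weight u d) * 1"
      by (intro mult_left_mono) auto
    then show "norm (sqf_weight u d * complex_of_real (real (N div d) - real N / real d)) \<le> sqf_weight (norm u) d"
      by (simp only: norm_mult norm_of_real mult_1_right norm_sqf_weight)
  qed simp
  also have "\<dots> \<le> (4 * ln 2 + 1) / ln (real N) * sqf_sum (norm u) N"
    using sum_sqf_weight_le[OF norm_ge_zero assms(1), of N] N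
    by (simp add: sqf_sum_def field_simps)
  finally show ?thesis .
qed

text \<open>Two errors meet: the rounding, of order y^(1/8 - 1), and the distance from the limit, of
  order y^(-3/4) y^(1/8). Both are within y^(-1/2), that is exp (-L/2).\<close>

lemma power_omega_mean:
  obtains G :: "complex \<Rightarrow> complex" and K :: real
  where "K > 0" "G holomorphic_on ball 0 (1/8)" "G 0 = 1" "deriv G 0 = of_real mertens_const"
    "\<And>u x. norm u \<le> 1/8 \<Longrightarrow> x \<ge> 3 \<Longrightarrow>
     norm ((\<Sum>n=1..nat \<lfloor>x\<rfloor>. (1 + u) ^ prime_omega n) / of_nat (nat \<lfloor>x\<rfloor>) - G u * exp (u * of_real (ln (ln x)))) \<le> K * exp (- ln (ln x) / 2)"
proof -
  obtain G :: "complex \<Rightarrow> complex" and K :: real where K: "K > 0" and G: "G holomorphic_on ball 0 (1/8)" "G 0 = 1" "deriv G 0 = of_real mertens_const"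
    and GK: "\<And>u y. norm u \<le> 1/8 \<Longrightarrow> y \<ge> ln 3 \<Longrightarrow>
     norm (sqf_sum u (floor_exp y) * exp (- u * of_real (ln y)) - G u) \<le> K * y powr (-3/4)"
    by (rule sqf_density) blast
  obtain K2 where K2: "K2 > 0" "\<And>u y. 0 \<le> u \<Longrightarrow> u \<le> 1/8 \<Longrightarrow> y \<ge> ln 3 \<Longrightarrow> sqf_sum u (floor_exp y) \<le> K2 * y powr (1/8)"
    by (rule sqf_sum_real_bound) blast
  define B where "B = 4 * ln 2 + (1::real)"
  have B: "B > 0" by (simp add: B_def add_nonneg_pos)
  show ?thesis
  proof (rule that[of "K + 2 * B * K2", OF _ G])
    show "K + 2 * B * K2 > 0" using K K2 B by (intro add_pos_pos mult_pos_pos) auto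
    fix u :: complex and x :: real
    assume u: "norm u \<le> 1/8" and x: "x \<ge> 3"
    define y where "y = ln x"
    define L where "L = ln y"
    define N where "N = nat \<lfloor>x\<rfloor>"
    have Ne: "floor_exp y = N" using x by (simp add: floor_exp_def y_def N_def)
    have y: "y \<ge> ln 3" "y > 1" using x ln_3_gt_1 by (auto simp: y_def intro: less_le_trans)
    have L: "L > 0" using y by (simp add: L_def)
    have eL: "y powr a = exp (a * L)" for a using y by (simp add: powr_def L_def)
    have N: "real N \<ge> 3" "x < real N + 1"
    proof -
      have "3 \<le> \<lfloor>x\<rfloor>" using x by (simp add: le_floor_iff)
      then show "real N \<ge> 3" "x < real N + 1" by (auto simp: N_def)
    qed
    \<comment> \<open>As x < N + 1, which is at most N^2, rounding x down at most halves its
      logarithm.\<close>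
    have lnN: "ln (real N) \<ge> y / 2"
    proof -
      have "real N + 1 \<le> real N * real N" using N mult_mono[of 3 "real N" "real N" "real N"] by linarith
      then have "ln x \<le> ln (real N * real N)" using N x by (subst ln_le_cancel_iff) auto
      then show ?thesis using N by (simp add: y_def ln_mult)
    qed
    have ReuL: "Re u * L \<le> L / 8"
    proof -
      have "Re u \<le> 1/8" using abs_Re_le_cmod[of u] u by linarith
      then have "Re u * L \<le> 1/8 * L" using L by (intro mult_right_mono) auto
      then show ?thesis by simp
    qed
    have "norm ((\<Sum>n=1..N. (1 + u) ^ prime_omega n) / of_nat N - sqf_sum u N) \<le> B / ln (real N) * sqf_sum (norm u) N"
      unfolding B_def using u N by (intro power_omega_mean_approx) auto
    also have "\<dots> \<le> B / (y / 2) * (K2 * y powr (1/8))"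
      using K2(2)[of "norm u" y] u y lnN B K2 unfolding Ne
      by (intro mult_mono divide_left_mono mult_pos_pos sqf_sum_real_nonneg) auto
    also have "\<dots> = 2 * B * K2 * (y powr (-1) * y powr (1/8))"
      using y by (simp add: powr_minus_divide)
    also have "y powr (-1) * y powr (1/8) = exp (- L) * exp (L / 8)"
      unfolding eL by simp
    also have "\<dots> \<le> exp (- L / 2)"
      unfolding exp_add[symmetric] using L by simp
    finally have 1: "norm ((\<Sum>n=1..N. (1 + u) ^ prime_omega n) / of_nat N - sqf_sum u N) \<le> 2 * B * K2 * exp (- L / 2)"
      using B K2 by simp
    have "sqf_sum u N - G u * exp (u * of_real L) = (sqf_sum u N * exp (- u * of_real L) - G u) * exp (u * of_real L)"
      by (simp add: algebra_simps exp_minus)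
    also have "norm \<dots> \<le> (K * y powr (-3/4)) * exp (L / 8)"
      unfolding norm_mult using GK[OF u y(1)] ReuL K unfolding Ne L_def[symmetric]
      by (intro mult_mono) (auto simp: norm_exp_eq_Re)
    also have "\<dots> = K * (exp (-3/4 * L) * exp (L / 8))" unfolding eL by simp
    also have "\<dots> \<le> K * exp (- L / 2)"
      unfolding exp_add[symmetric] using K L by (intro mult_left_mono) auto
    finally have 2: "norm (sqf_sum u N - G u * exp (u * of_real L)) \<le> K * exp (- L / 2)" .
    have "norm ((\<Sum>n=1..N. (1 + u) ^ prime_omega n) / of_nat N - G u * exp (u * of_real L)) \<le> 2 * B * K2 * exp (- L / 2) + K * exp (- L / 2)"
      using norm_triangle_mono[OF 1 2] by simp
    then show "norm ((\<Sum>n=1..nat \<lfloor>x\<rfloor>. (1 + u) ^ prime_omega n) / of_nat (nat \<lfloor>x\<rfloor>) - G u * exp (u * of_real (ln (ln x)))) \<le> (K + 2 * B * K2) * exp (- ln (ln x) / 2)"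
      by (simp add: N_def L_def y_def algebra_simps)
  qed
qed

definition omega_mgf :: "real \<Rightarrow> complex \<Rightarrow> complex" where
  "omega_mgf x w = (\<Sum>n=1..nat \<lfloor>x\<rfloor>. exp (of_real (real (prime_omega n) - ln (ln x)) * w)) / of_nat (nat \<lfloor>x\<rfloor>)"

lemma norm_exp_minus_one_le: "norm (exp w - 1) \<le> 2 * norm w" if "norm w \<le> 1/16" for w :: complex
proof -
  have "norm (exp w - 1) \<le> exp \<bar>Re w\<bar> * norm w"
    using Taylor_exp[of w 0] by simp
  also have "\<dots> \<le> 2 * norm w"
    using exp_bound_half[of "\<bar>Re w\<bar>"] abs_Re_le_cmod[of w] that by (intro mult_right_mono) auto
  finally show ?thesis .
qed

text \<open>Substitute u = exp w - 1 and centre by exp (-L w). The radius 1/16 ensures that |u| is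
  at most 2 |w|, hence at most 1/8; centring costs at most exp (L/16), and exp (L/16 - L/2) is below
  exp (-L/4).\<close>

lemma omega_mgf_asymp:
  obtains H :: "complex \<Rightarrow> complex" and K :: real
  where "K > 0" "H holomorphic_on ball 0 (1/16)" "H 0 = 1" "deriv H 0 = of_real mertens_const"
    "\<And>w x. norm w \<le> 1/16 \<Longrightarrow> x \<ge> 3 \<Longrightarrow>
     norm (omega_mgf x w - H w * exp (of_real (ln (ln x)) * (exp w - 1 - w))) \<le> K * exp (- ln (ln x) / 4)"
proof -
  obtain G :: "complex \<Rightarrow> complex" and K :: real
  where K: "K > 0" and G: "G holomorphic_on ball 0 (1/8)" "G 0 = 1" "deriv G 0 = of_real mertens_const"
    and GK: "\<And>u x. norm u \<le> 1/8 \<Longrightarrow> x \<ge> 3 \<Longrightarrow>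
     norm ((\<Sum>n=1..nat \<lfloor>x\<rfloor>. (1 + u) ^ prime_omega n) / of_nat (nat \<lfloor>x\<rfloor>) - G u * exp (u * of_real (ln (ln x)))) \<le> K * exp (- ln (ln x) / 2)"
    by (rule power_omega_mean) blast
  show ?thesis
  proof (rule that[of K "\<lambda>w. G (exp w - 1)"])
    have "(\<lambda>w. exp w - 1) ` ball 0 (1/16) \<subseteq> ball (0::complex) (1/8)"
    proof safe
      fix w :: complex assume "w \<in> ball 0 (1/16)"
      then have "norm (exp w - 1) \<le> 2 * norm w" "norm w < 1/16" using norm_exp_minus_one_le[of w] by auto
      then have "norm (exp w - 1) < 1/8" by linarith
      then show "exp w - 1 \<in> ball 0 (1/8)" by simp
    qed
    then have "(G \<circ> (\<lambda>w. exp w - 1)) holomorphic_on ball 0 (1/16)"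
      using G(1) by (intro holomorphic_on_compose_gen[of _ _ _ "ball 0 (1/8)"]) (auto intro!: holomorphic_intros)
    then show "(\<lambda>w. G (exp w - 1)) holomorphic_on ball 0 (1/16)" by (simp add: o_def)
    have "(G has_field_derivative deriv G 0) (at 0)"
      using G(1) by (intro holomorphic_derivI) auto
    then have d1: "(G has_field_derivative of_real mertens_const) (at (exp 0 - 1))" by (simp add: G)
    have d2: "((\<lambda>w. exp w - 1) has_field_derivative (1::complex)) (at 0)"
      by (auto intro!: derivative_eq_intros)
    have "((\<lambda>w. G (exp w - 1)) has_field_derivative (of_real mertens_const * 1)) (at 0)"
      by (rule DERIV_chain2[OF d1 d2])
    then show "deriv (\<lambda>w. G (exp w - 1)) 0 = of_real mertens_const" by (simp add: DERIV_imp_deriv)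
    fix w :: complex and x :: real
    assume w: "norm w \<le> 1/16" and x: "x \<ge> 3"
    define L where "L = ln (ln x)"
    have lx: "ln x > 1" using x ln_3_gt_1 by (auto intro: less_le_trans)
    have L: "L > 0" using lx by (simp add: L_def)
    define u where "u = exp w - 1"
    have u: "norm u \<le> 1/8" using norm_exp_minus_one_le[OF w] w by (simp add: u_def)
    have e: "exp (of_real (real n - L) * w) = exp (- of_real L * w) * (1 + u) ^ n" for n
      by (simp add: u_def exp_of_nat_mult[symmetric] exp_add[symmetric] algebra_simps)
    have "omega_mgf x w = exp (- of_real L * w) * ((\<Sum>n=1..nat \<lfloor>x\<rfloor>. (1 + u) ^ prime_omega n) / of_nat (nat \<lfloor>x\<rfloor>))"
      unfolding omega_mgf_def L_def[symmetric] e by (simp add: sum_distrib_left)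
    moreover have "G u * exp (of_real L * (exp w - 1 - w)) = exp (- of_real L * w) * (G u * exp (u * of_real L))"
      by (simp add: u_def exp_add[symmetric] algebra_simps)
    ultimately have "omega_mgf x w - G u * exp (of_real L * (exp w - 1 - w)) =
      exp (- of_real L * w) * ((\<Sum>n=1..nat \<lfloor>x\<rfloor>. (1 + u) ^ prime_omega n) / of_nat (nat \<lfloor>x\<rfloor>) - G u * exp (u * of_real L))"
      by (simp add: right_diff_distrib)
    also have "norm \<dots> \<le> exp (L / 16) * (K * exp (- L / 2))"
      unfolding norm_mult
    proof (intro mult_mono)
      have "- (L * Re w) \<le> L * (1/16)"
        using abs_Re_le_cmod[of w] w L mult_left_mono[of "- Re w" "1/16" L] by simp
      then show "norm (exp (- of_real L * w)) \<le> exp (L / 16)" by (simp add: norm_exp_eq_Re)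
    qed (use GK[OF u x] K in \<open>auto simp: L_def\<close>)
    also have "\<dots> = K * exp (L / 16 + - L / 2)" unfolding exp_add by simp
    also have "\<dots> \<le> K * exp (- L / 4)" using K L by (intro mult_left_mono) auto
    finally show "norm (omega_mgf x w - G (exp w - 1) * exp (of_real (ln (ln x)) * (exp w - 1 - w))) \<le> K * exp (- ln (ln x) / 4)"
      by (simp add: u_def L_def)
  qed (use K G in auto)
qed

section \<open>Cauchy's formula on the saddle point circle\<close>

text \<open>The period is cut into two half circles centred at the angles 0 and \<pi>, which pairs
  every point z with -z.\<close>

lemma integral_cis_shift:
  fixes g :: "real \<Rightarrow> complex"
  assumes cont: "continuous_on UNIV g" and per: "\<And>t. g (t + 2 * pi) = g t"
  shows "integral {0..2*pi} g = integral {-pi/2..pi/2} (\<lambda>t. g t + g (t + pi))"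
proof -
  have int: "g integrable_on {a..b}" for a b
    by (intro integrable_continuous_real continuous_on_subset[OF cont]) auto
  have "integral {0..2*pi} g = integral {0..3*pi/2} g + integral {3*pi/2..2*pi} g"
    by (rule Henstock_Kurzweil_Integration.integral_combine[symmetric]) (use int in auto)
  also have "integral {3*pi/2..2*pi} g = integral {-pi/2..0} (g \<circ> (+) (2*pi))"
    using integral_shift_Icc_real[of "-pi/2" 0 g "2*pi"] by simp
  also have "g \<circ> (+) (2*pi) = g" by (auto simp: fun_eq_iff add.commute per)
  also have "integral {0..3*pi/2} g + integral {-pi/2..0} g = integral {-pi/2..3*pi/2} g"
    by (subst add.commute, rule Henstock_Kurzweil_Integration.integral_combine) (use int in auto)
  also have "\<dots> = integral {-pi/2..pi/2} g + integral {pi/2..3*pi/2} g"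
    by (rule Henstock_Kurzweil_Integration.integral_combine[symmetric]) (use int in auto)
  also have "integral {pi/2..3*pi/2} g = integral {-pi/2..pi/2} (g \<circ> (+) pi)"
    using integral_shift_Icc_real[of "-pi/2" "pi/2" g pi] by (simp add: field_simps)
  also have "integral {-pi/2..pi/2} g + integral {-pi/2..pi/2} (g \<circ> (+) pi) = integral {-pi/2..pi/2} (\<lambda>t. g t + g (t + pi))"
  proof -
    have "(g \<circ> (+) pi) integrable_on {-pi/2..pi/2}"
      by (intro integrable_continuous_real continuous_on_compose continuous_on_subset[OF cont] continuous_intros) auto
    then show ?thesis using int by (subst Henstock_Kurzweil_Integration.integral_add) (auto simp: o_def add.commute)
  qed
  finally show ?thesis .
qed

lemma cauchy_coefficient:
  fixes f :: "complex \<Rightarrow> complex"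
  assumes F: "f has_fps_expansion F" and hol: "f holomorphic_on ball 0 R" and \<rho>: "0 < \<rho>" "\<rho> < R"
  shows "fps_nth F k * of_real \<rho> ^ k =
    integral {-pi/2..pi/2} (\<lambda>t. (f (of_real \<rho> * cis t) + (-1) ^ k * f (- (of_real \<rho> * cis t))) * cis (- (real k * t))) / (2 * pi)"
proof -
  define g where "g = (\<lambda>t. f (of_real \<rho> * cis t) * cis (- (real k * t)))"
  have cb: "cball 0 \<rho> \<subseteq> ball (0::complex) R" using \<rho> by auto
  have "((\<lambda>u. f u / (u - 0) ^ Suc k) has_contour_integral complex_of_real (2 * pi) * \<i> / fact k * (deriv ^^ k) f 0) (circlepath 0 \<rho>)"
    using hol cb \<rho> by (intro Cauchy_has_contour_integral_higher_derivative_circlepath)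
      (auto intro!: holomorphic_on_imp_continuous_on intro: holomorphic_on_subset)
  then have "((\<lambda>t. f (of_real \<rho> * cis t) / (of_real \<rho> * cis t) ^ Suc k * of_real \<rho> * \<i> * cis t) has_integral (complex_of_real (2 * pi) * \<i> / fact k * (deriv ^^ k) f 0)) {0..2*pi}"
    unfolding circlepath_def by (subst (asm) has_contour_integral_part_circlepath_iff) auto
  also have "(\<lambda>t. f (of_real \<rho> * cis t) / (of_real \<rho> * cis t) ^ Suc k * of_real \<rho> * \<i> * cis t) = (\<lambda>t. (\<i> / of_real \<rho> ^ k) * g t)"
  proof
    fix t
    have "cis (real k * t) * cis (- (real k * t)) = 1" by (simp add: cis_mult)
    then have "cis (- (real k * t)) = 1 / cis t ^ k" unfolding Complex.DeMoivre by (simp add: field_simps)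
    then show "f (of_real \<rho> * cis t) / (of_real \<rho> * cis t) ^ Suc k * of_real \<rho> * \<i> * cis t = (\<i> / of_real \<rho> ^ k) * g t"
      using \<rho> by (simp add: g_def power_mult_distrib field_simps)
  qed
  also have "complex_of_real (2 * pi) * \<i> / fact k * (deriv ^^ k) f 0 = complex_of_real (2 * pi) * \<i> * fps_nth F k"
    using fps_nth_fps_expansion[OF F, of k] by simp
  finally have "((\<lambda>t. (\<i> / of_real \<rho> ^ k) * g t) has_integral (complex_of_real (2 * pi) * \<i> * fps_nth F k)) {0..2*pi}" .
  from has_integral_mult_right[OF this, of "of_real \<rho> ^ k / \<i>"]
  have "(g has_integral (complex_of_real (2 * pi) * (fps_nth F k * of_real \<rho> ^ k))) {0..2*pi}"
    using \<rho> by (simp add: mult_ac)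
  then have "integral {0..2*pi} g = complex_of_real (2 * pi) * (fps_nth F k * of_real \<rho> ^ k)"
    by (rule integral_unique)
  moreover have "integral {0..2*pi} g = integral {-pi/2..pi/2} (\<lambda>t. g t + g (t + pi))"
  proof (rule integral_cis_shift)
    have "continuous_on (cball 0 \<rho>) f" by (rule continuous_on_subset[OF holomorphic_on_imp_continuous_on[OF hol] cb])
    then have "continuous_on UNIV (\<lambda>t. f (of_real \<rho> * cis t))"
    proof (rule continuous_on_compose2)
      show "continuous_on UNIV (\<lambda>t. of_real \<rho> * cis t)" by (intro continuous_intros)
      show "(\<lambda>t. of_real \<rho> * cis t) ` UNIV \<subseteq> cball 0 \<rho>" using \<rho> by (auto simp: norm_mult)
    qed
    then show "continuous_on UNIV g" unfolding g_def by (intro continuous_intros)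
    have "cis (- (real k * (t + 2 * pi))) = cis (- (real k * t))" for t
    proof -
      have "cis (- (real k * (t + 2 * pi))) = cis (- (real k * t)) * inverse (cis (2 * pi) ^ k)"
        unfolding Complex.DeMoivre cis_inverse cis_mult by (simp add: algebra_simps)
      then show ?thesis by simp
    qed
    moreover have "cis (t + 2 * pi) = cis t" for t unfolding cis_mult[symmetric] by simp
    ultimately show "g (t + 2 * pi) = g t" for t by (simp add: g_def)
  qed
  moreover have "g t + g (t + pi) = (f (of_real \<rho> * cis t) + (-1) ^ k * f (- (of_real \<rho> * cis t))) * cis (- (real k * t))" for t
  proof -
    have "cis (- (real k * (t + pi))) = cis (- (real k * t)) * inverse (cis pi ^ k)"
      unfolding Complex.DeMoivre cis_inverse cis_mult by (simp add: algebra_simps)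
    also have "inverse (cis pi ^ k) = (-1) ^ k" by (simp add: power_inverse[symmetric])
    finally have "cis (- (real k * (t + pi))) = cis (- (real k * t)) * (-1) ^ k" .
    moreover have "cis (t + pi) = - cis t" unfolding cis_mult[symmetric] by simp
    ultimately show ?thesis by (simp add: g_def ring_distribs)
  qed
  ultimately show ?thesis by (simp add: field_simps)
qed

text \<open>The functional reading off the \<open>k\<close>-th coefficient of \<open>exp (s\<^sup>2 / 2) f(s / sqrt k)\<close> on the
  saddle point circle \<open>norm s = sqrt k\<close>, with the contributions of the saddle points \<open>sqrt k\<close> and
  \<open>- sqrt k\<close> folded together.\<close>

definition gauss_coeff :: "nat \<Rightarrow> (complex \<Rightarrow> complex) \<Rightarrow> complex" where
  "gauss_coeff k f = integral {-pi/2..pi/2} (\<lambda>t. exp (of_real (real k / 2) * cis (2 * t)) *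
     ((f (cis t) + (-1) ^ k * f (- cis t)) * cis (- (real k * t)))) / (2 * pi)"

text \<open>The modulus of exp (s^2 / 2) at s = sqrt k * cis t is exp (k/2 * cos (2t)); everything
  else in \<open>gauss_coeff\<close> is left out.\<close>

definition gauss_mass :: "nat \<Rightarrow> real" where
  "gauss_mass k = integral {-pi/2..pi/2} (\<lambda>t. exp (real k / 2 * cos (2 * t))) / (2 * pi)"

lemma gauss_coeff_integrable:
  assumes "continuous_on (sphere 0 1) f"
  shows "(\<lambda>t. exp (of_real (real k / 2) * cis (2 * t)) * ((f (cis t) + (-1) ^ k * f (- cis t)) * cis (- (real k * t)))) integrable_on {a..b}"
proof -
  have "continuous_on UNIV (\<lambda>t. f (cis t))" "continuous_on UNIV (\<lambda>t. f (- cis t))"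
    by (rule continuous_on_compose2[OF assms]; auto intro!: continuous_intros)+
  then have "continuous_on {a..b} (\<lambda>t. f (cis t))" "continuous_on {a..b} (\<lambda>t. f (- cis t))"
    by (auto intro: continuous_on_subset)
  then show ?thesis by (intro integrable_continuous_real continuous_intros)
qed

lemma gauss_coeff_add:
  assumes "continuous_on (sphere 0 1) f" "continuous_on (sphere 0 1) g"
  shows "gauss_coeff k (\<lambda>z. f z + g z) = gauss_coeff k f + gauss_coeff k g"
  using Henstock_Kurzweil_Integration.integral_add[OF gauss_coeff_integrable[OF assms(1), of k "-pi/2" "pi/2"] gauss_coeff_integrable[OF assms(2), of k "-pi/2" "pi/2"]]
  by (simp add: gauss_coeff_def algebra_simps add_divide_distrib)

lemma gauss_coeff_cmult: "gauss_coeff k (\<lambda>z. c * f z) = c * gauss_coeff k f"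
  by (simp add: gauss_coeff_def flip: integral_mult_right) (simp add: algebra_simps)

text \<open>Only the combination of f(z) and f(-z) has to be bounded. Its cancellation depends on
  the parity of \<open>k\<close> and would be lost in a bound for \<open>f\<close> alone.\<close>

lemma gauss_coeff_bound:
  assumes "continuous_on (sphere 0 1) f"
    and "\<And>z. norm z = 1 \<Longrightarrow> norm (f z + (-1) ^ k * f (- z)) \<le> M"
  shows "norm (gauss_coeff k f) \<le> M * gauss_mass k"
proof -
  have "norm (integral {-pi/2..pi/2} (\<lambda>t. exp (of_real (real k / 2) * cis (2 * t)) * ((f (cis t) + (-1) ^ k * f (- cis t)) * cis (- (real k * t)))))
     \<le> integral {-pi/2..pi/2} (\<lambda>t. M * exp (real k / 2 * cos (2 * t)))"
  proof (rule integral_norm_bound_integral[OF gauss_coeff_integrable[OF assms(1)]])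
    show "(\<lambda>t. M * exp (real k / 2 * cos (2 * t))) integrable_on {-pi/2..pi/2}"
      by (intro integrable_continuous_real continuous_intros)
    fix t
    have "norm (exp (of_real (real k / 2) * cis (2 * t)) * ((f (cis t) + (-1) ^ k * f (- cis t)) * cis (- (real k * t))))
       = exp (real k / 2 * cos (2 * t)) * norm (f (cis t) + (-1) ^ k * f (- cis t))"
      by (simp add: norm_mult norm_exp_eq_Re)
    also have "\<dots> \<le> exp (real k / 2 * cos (2 * t)) * M" by (intro mult_left_mono assms) auto
    finally show "norm (exp (of_real (real k / 2) * cis (2 * t)) * ((f (cis t) + (-1) ^ k * f (- cis t)) * cis (- (real k * t)))) \<le> M * exp (real k / 2 * cos (2 * t))"
      by (simp add: mult.commute)
  qed
  then show ?thesis
    by (simp add: gauss_coeff_def gauss_mass_def norm_divide divide_right_mono)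
qed

text \<open>On the circle of radius sqrt k the exponential in \<open>gauss_coeff\<close> is exactly
  exp (s^2 / 2). For entire functions of s the functional is therefore a Taylor coefficient, so
  polynomial main terms can be evaluated exactly.\<close>

lemma gauss_coeff_expansion:
  fixes f :: "complex \<Rightarrow> complex"
  assumes "k > 0" and F: "f has_fps_expansion F" and hol: "f holomorphic_on UNIV"
  shows "gauss_coeff k (\<lambda>z. f (of_real (sqrt k) * z)) = fps_nth (fps_compose (fps_exp (1/2)) (fps_X ^ 2) * F) k * of_real (sqrt k) ^ k"
proof -
  have e: "(\<lambda>s. exp (1/2 * s ^ 2)) has_fps_expansion fps_compose (fps_exp (1/2)) (fps_X ^ 2 :: complex fps)"
  proof -
    have "((\<lambda>s. exp (1/2 * s)) \<circ> (\<lambda>s. s ^ 2)) has_fps_expansion fps_compose (fps_exp (1/2)) (fps_X ^ 2 :: complex fps)"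
      by (intro has_fps_expansion_compose has_fps_expansion_exp has_fps_expansion_fps_X_power) simp
    then show ?thesis by (simp add: o_def)
  qed
  have "(\<lambda>s. exp (1/2 * s ^ 2) * f s) holomorphic_on ball 0 (sqrt k + 1)"
    by (intro holomorphic_intros holomorphic_on_subset[OF hol]) auto
  from cauchy_coefficient[OF has_fps_expansion_mult[OF e F] this, of "sqrt k" k]
  have "fps_nth (fps_compose (fps_exp (1/2)) (fps_X ^ 2) * F) k * of_real (sqrt k) ^ k
     = integral {-pi/2..pi/2} (\<lambda>t. (exp (1/2 * (of_real (sqrt k) * cis t) ^ 2) * f (of_real (sqrt k) * cis t) +
        (-1) ^ k * (exp (1/2 * (- (of_real (sqrt k) * cis t)) ^ 2) * f (- (of_real (sqrt k) * cis t)))) * cis (- (real k * t))) / (2 * pi)"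
    using assms(1) by simp
  moreover have "1/2 * (of_real (sqrt k) * cis t) ^ 2 = of_real (real k / 2) * cis (2 * t)" for t
  proof -
    have "(complex_of_real (sqrt k))\<^sup>2 = of_real (real k)" unfolding of_real_power[symmetric] by simp
    then show ?thesis using Complex.DeMoivre[of t 2] by (simp add: power_mult_distrib)
  qed
  ultimately show ?thesis
    by (simp add: gauss_coeff_def algebra_simps)
qed

text \<open>exp (s^2 / 2) is the moment generating function of the standard Gaussian.\<close>

lemma gauss_moment_coeff:
  "fps_nth (fps_compose (fps_exp (1/2)) (fps_X ^ 2 :: complex fps)) k = of_real (gauss_moment k / fact k)"
  by (auto simp: fps_nth_compose_X_power gauss_moment_def power_one_over elim!: evenE)

lemma gauss_coeff_1: "k > 0 \<Longrightarrow> gauss_coeff k (\<lambda>_. 1) = of_real (gauss_moment k / fact k * sqrt k ^ k)"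
  using gauss_coeff_expansion[of k "\<lambda>_. 1" 1] by (simp add: gauss_moment_coeff)

lemma gauss_coeff_power:
  assumes "k > 0"
  shows "gauss_coeff k (\<lambda>z. (of_real (sqrt k) * z) ^ j) = of_real (if j \<le> k then gauss_moment (k - j) / fact (k - j) * sqrt k ^ k else 0)"
proof -
  have "(\<lambda>z::complex. z ^ j) holomorphic_on UNIV" by (intro holomorphic_intros)
  from gauss_coeff_expansion[OF assms has_fps_expansion_fps_X_power this] show ?thesis
    by (auto simp: gauss_moment_coeff fps_X_power_mult_right_nth)
qed

text \<open>What is left of the model for \<open>omega_mgf\<close> after splitting off exp (L w^2 /
  2), which is exp (s^2 / 2) for w = s / sqrt L.\<close>

definition tilt :: "(complex \<Rightarrow> complex) \<Rightarrow> real \<Rightarrow> complex \<Rightarrow> complex" where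
  "tilt H L w = H w * exp (of_real L * (exp w - 1 - w - w\<^sup>2 / 2))"

lemma omega_moment_eq_sum:
  assumes "x \<ge> 1"
  shows "omega_moment x k = (\<Sum>n=1..nat \<lfloor>x\<rfloor>. ((real (prime_omega n) - ln (ln x)) / sqrt (ln (ln x))) ^ k) / real (nat \<lfloor>x\<rfloor>)"
proof -
  have "{n::nat. 1 \<le> n \<and> real n \<le> x} = {1..nat \<lfloor>x\<rfloor>}"
    using assms by (auto simp: le_nat_iff le_floor_iff)
  then show ?thesis by (simp add: omega_moment_def nat_average_def)
qed

text \<open>The coefficient of w^k in \<open>omega_mgf\<close> is the k-th moment about
  \<open>L\<close>, divided by k!; on the circle of radius r = sqrt (k / L) the factor r^k supplies
  the standardisation. The model error is bounded on the circle without the Gaussian weight, and so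
  appears as an absolute \<open>K * exp (- L / 4)\<close>.\<close>

lemma omega_moment_saddle:
  obtains H :: "complex \<Rightarrow> complex" and K :: real
  where "K > 0" "H holomorphic_on ball 0 (1/16)" "H 0 = 1" "deriv H 0 = of_real mertens_const"
    "\<And>x k L. x \<ge> 3 \<Longrightarrow> k > 0 \<Longrightarrow> L = ln (ln x) \<Longrightarrow> sqrt (real k / L) < 1/16 \<Longrightarrow>
      norm (of_real (omega_moment x k * sqrt k ^ k / fact k) - gauss_coeff k (\<lambda>z. tilt H L (of_real (sqrt (real k / L)) * z))) \<le> K * exp (- L / 4)"
proof -
  obtain H :: "complex \<Rightarrow> complex" and K :: real
    where K: "K > 0" and H: "H holomorphic_on ball 0 (1/16)" "H 0 = 1" "deriv H 0 = of_real mertens_const"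
    and HK: "\<And>w x. norm w \<le> 1/16 \<Longrightarrow> x \<ge> 3 \<Longrightarrow>
     norm (omega_mgf x w - H w * exp (of_real (ln (ln x)) * (exp w - 1 - w))) \<le> K * exp (- ln (ln x) / 4)"
    by (rule omega_mgf_asymp) blast
  show ?thesis
  proof (rule that[OF K H])
    fix x L :: real and k :: nat
    assume x: "x \<ge> 3" and k: "k > 0" and L: "L = ln (ln x)" and r16: "sqrt (real k / L) < 1/16"
    define r where "r = sqrt (real k / L)"
    have lx: "ln x > 1" using x ln_3_gt_1 by (auto intro: less_le_trans)
    have L0: "L > 0" using lx by (simp add: L)
    have r: "0 < r" "r < 1/16" using r16 k L0 by (auto simp: r_def)
    define N where "N = nat \<lfloor>x\<rfloor>"
    have N: "real N > 0" using x by (simp add: N_def)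
    define c where "c = (\<lambda>n. real (prime_omega n) - L)"
    define F where "F = (\<Sum>n=1..N. fps_exp (complex_of_real (c n))) * fps_const (1 / of_nat N)"
    have mgf: "omega_mgf x = (\<lambda>w. (\<Sum>n=1..N. exp (of_real (c n) * w)) * (1 / of_nat N))"
      by (rule ext) (simp add: omega_mgf_def N_def c_def L)
    have "omega_mgf x has_fps_expansion F"
      unfolding mgf F_def by (intro fps_expansion_intros)
    moreover have "omega_mgf x holomorphic_on ball 0 1"
      unfolding mgf by (intro holomorphic_intros)
    ultimately have *: "fps_nth F k * of_real r ^ k = integral {-pi/2..pi/2} (\<lambda>t. (omega_mgf x (of_real r * cis t) + (-1) ^ k * omega_mgf x (- (of_real r * cis t))) * cis (- (real k * t))) / (2 * pi)"
      using r by (intro cauchy_coefficient[where R = 1]) auto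
    have "fps_nth F k * of_real r ^ k = of_real ((\<Sum>n=1..N. c n ^ k) / real N / fact k * r ^ k)"
      by (simp add: F_def fps_sum_nth sum_divide_distrib mult.commute)
    also have "(\<Sum>n=1..N. c n ^ k) / real N / fact k * r ^ k = omega_moment x k * sqrt k ^ k / fact k"
    proof -
      have "r ^ k = sqrt k ^ k / sqrt L ^ k" by (simp add: r_def real_sqrt_divide power_divide)
      moreover have "omega_moment x k = (\<Sum>n=1..N. c n ^ k) / sqrt L ^ k / real N"
        using x by (subst omega_moment_eq_sum) (auto simp: N_def c_def L power_divide sum_divide_distrib)
      ultimately show ?thesis by simp
    qed
    finally have lhs: "fps_nth F k * of_real r ^ k = of_real (omega_moment x k * sqrt k ^ k / fact k)" .
    define M where "M = (\<lambda>w. H w * exp (of_real L * (exp w - 1 - w)))"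
    define E where "E = (\<lambda>w. omega_mgf x w - M w)"
    have Ebound: "norm (E w) \<le> K * exp (- L / 4)" if "norm w \<le> 1/16" for w
      using HK[OF that x] by (simp add: E_def M_def L)
    have rc: "r * z \<in> ball 0 (1/16)" if "norm z = 1" for z :: complex using r that by (simp add: norm_mult)
    have Mh: "M holomorphic_on ball 0 (1/16)" unfolding M_def by (intro holomorphic_intros H)
    have Eh: "E holomorphic_on ball 0 (1/16)" unfolding E_def mgf by (intro holomorphic_intros Mh)
    have cont: "continuous_on {-pi/2..pi/2} (\<lambda>t. (f (of_real r * cis t) + (-1) ^ k * f (- (of_real r * cis t))) * cis (- (real k * t)))"
      if "f holomorphic_on ball 0 (1/16)" for f :: "complex \<Rightarrow> complex"
    proof -
      have c: "continuous_on (ball 0 (1/16)) f" using that by (rule holomorphic_on_imp_continuous_on)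
      have "continuous_on {-pi/2..pi/2} (\<lambda>t. f (of_real r * cis t))" "continuous_on {-pi/2..pi/2} (\<lambda>t. f (- (of_real r * cis t)))"
        by (rule continuous_on_compose2[OF c]; use r in \<open>auto intro!: continuous_intros simp: norm_mult\<close>)+
      then show ?thesis by (intro continuous_intros)
    qed
    have tm: "M w = exp (of_real L * w\<^sup>2 / 2) * tilt H L w" for w
      by (simp add: M_def tilt_def exp_add[symmetric] algebra_simps)
    have sq: "of_real L * (of_real r * cis t)\<^sup>2 / 2 = of_real (real k / 2) * cis (2 * t)" for t
    proof -
      have "L * r\<^sup>2 = real k" using L0 by (simp add: r_def)
      then have "of_real L * of_real r ^ 2 = complex_of_real (real k)" by (metis of_real_mult of_real_power)
      then show ?thesis using Complex.DeMoivre[of t 2] by (simp add: power_mult_distrib)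
    qed
    have "integral {-pi/2..pi/2} (\<lambda>t. (omega_mgf x (of_real r * cis t) + (-1) ^ k * omega_mgf x (- (of_real r * cis t))) * cis (- (real k * t)))
      = integral {-pi/2..pi/2} (\<lambda>t. (M (of_real r * cis t) + (-1) ^ k * M (- (of_real r * cis t))) * cis (- (real k * t)))
      + integral {-pi/2..pi/2} (\<lambda>t. (E (of_real r * cis t) + (-1) ^ k * E (- (of_real r * cis t))) * cis (- (real k * t)))"
      unfolding Henstock_Kurzweil_Integration.integral_add[OF integrable_continuous_real[OF cont[OF Mh]] integrable_continuous_real[OF cont[OF Eh]], symmetric]
      by (intro integral_cong) (simp add: E_def algebra_simps)
    also have "integral {-pi/2..pi/2} (\<lambda>t. (M (of_real r * cis t) + (-1) ^ k * M (- (of_real r * cis t))) * cis (- (real k * t)))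
      = gauss_coeff k (\<lambda>z. tilt H L (of_real r * z)) * (2 * pi)"
    proof -
      have "M (- (of_real r * cis t)) = exp (of_real (real k / 2) * cis (2 * t)) * tilt H L (- (of_real r * cis t))"
        and "M (of_real r * cis t) = exp (of_real (real k / 2) * cis (2 * t)) * tilt H L (of_real r * cis t)" for t
        unfolding tm using sq[of t] by simp_all
      then show ?thesis by (simp add: gauss_coeff_def algebra_simps)
    qed
    finally have "of_real (omega_moment x k * sqrt k ^ k / fact k) - gauss_coeff k (\<lambda>z. tilt H L (of_real r * z))
      = integral {-pi/2..pi/2} (\<lambda>t. (E (of_real r * cis t) + (-1) ^ k * E (- (of_real r * cis t))) * cis (- (real k * t))) / (2 * pi)"
      using * unfolding lhs by (simp add: add_divide_distrib)
    also have "norm \<dots> \<le> (2 * K * exp (- L / 4)) * (pi/2 - (-pi/2)) / (2 * pi)"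
    proof -
      have "norm (integral {-pi/2..pi/2} (\<lambda>t. (E (of_real r * cis t) + (-1) ^ k * E (- (of_real r * cis t))) * cis (- (real k * t)))) \<le> (2 * K * exp (- L / 4)) * (pi/2 - (-pi/2))"
      proof (rule integral_bound)
        show "continuous_on {-pi/2..pi/2} (\<lambda>t. (E (of_real r * cis t) + (-1) ^ k * E (- (of_real r * cis t))) * cis (- (real k * t)))"
          by (rule cont[OF Eh])
        fix t
        have "norm (E (of_real r * cis t) + (-1) ^ k * E (- (of_real r * cis t))) \<le> norm (E (of_real r * cis t)) + norm (E (- (of_real r * cis t)))"
          by (rule order.trans[OF norm_triangle_ineq]) (simp add: norm_mult norm_power)
        also have "\<dots> \<le> K * exp (- L / 4) + K * exp (- L / 4)"
          using r by (intro add_mono Ebound) (auto simp: norm_mult)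
        finally show "norm ((E (of_real r * cis t) + (-1) ^ k * E (- (of_real r * cis t))) * cis (- (real k * t))) \<le> 2 * K * exp (- L / 4)"
          by (simp add: norm_mult)
      qed simp
      then have "norm (integral {-pi/2..pi/2} (\<lambda>t. (E (of_real r * cis t) + (-1) ^ k * E (- (of_real r * cis t))) * cis (- (real k * t)))) / (2 * pi) \<le> (2 * K * exp (- L / 4)) * (pi/2 - (-pi/2)) / (2 * pi)"
        by (rule divide_right_mono) simp
      moreover have "\<bar>2 * pi\<bar> = 2 * pi" by simp
      ultimately show ?thesis by (simp only: norm_divide norm_mult norm_numeral norm_of_real)
    qed
    also have "\<dots> = K * exp (- L / 4)" by simp
    finally show "norm (of_real (omega_moment x k * sqrt k ^ k / fact k) - gauss_coeff k (\<lambda>z. tilt H L (of_real (sqrt (real k / L)) * z))) \<le> K * exp (- L / 4)"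
      by (simp add: r_def)
  qed
qed

section \<open>Laplace's method\<close>

lemma has_bochner_integral_gaussian: "has_bochner_integral lborel (\<lambda>x::real. exp (- x\<^sup>2)) (sqrt pi)"
  using has_bochner_integral_even_function[OF gaussian_moment_0] by simp

lemma integrable_gaussian_scaled:
  assumes "c > 0" shows "integrable lborel (\<lambda>x::real. exp (- (c * x)\<^sup>2))"
  using has_bochner_integral_gaussian lborel_integrable_real_affine_iff[of c "\<lambda>x. exp (- x\<^sup>2)" 0] assms
  by (simp add: has_bochner_integral_iff)

text \<open>A weak form of Jordan's inequality. Up to \<pi>/3 the derivative cos is at least 1/2;
  beyond, sin is at least sqrt 3 / 2, which exceeds \<pi>/4.\<close>

lemma sin_ge_half:
  assumes "0 \<le> x" "x \<le> pi / 2"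
  shows "x / 2 \<le> sin (x::real)"
proof (cases "x \<le> pi / 3")
  case True
  have "(\<lambda>x. sin x - x / 2) 0 \<le> (\<lambda>x. sin x - x / 2) x"
  proof (rule DERIV_nonneg_imp_nondecreasing[OF assms(1)])
    fix y assume y: "0 \<le> y" "y \<le> x"
    have "cos (pi / 3) \<le> cos y" using y True by (intro cos_monotone_0_pi_le) auto
    then have "cos y - 1/2 \<ge> 0" by (simp add: cos_60)
    moreover have "((\<lambda>x. sin x - x / 2) has_real_derivative (cos y - 1/2)) (at y)"
      by (auto intro!: derivative_eq_intros)
    ultimately show "\<exists>D. ((\<lambda>x. sin x - x / 2) has_real_derivative D) (at y) \<and> 0 \<le> D" by blast
  qed
  then show ?thesis by simp
next
  case False
  have "x / 2 \<le> 0.8" using assms pi_approx by simp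
  also have "0.8 \<le> sqrt 3 / (2::real)"
    using real_le_rsqrt[of "1.6" 3] by (simp add: power2_eq_square)
  also have "\<dots> = sin (pi / 3)" by (simp add: sin_60)
  also have "\<dots> \<le> sin x" using False assms by (intro sin_monotone_2pi_le) auto
  finally show ?thesis .
qed

text \<open>This provides a Gaussian majorant on the whole half circle, so that in Laplace's method
  centre and tails are treated together.\<close>

lemma cos_double_le:
  assumes "\<bar>x\<bar> \<le> pi / 2"
  shows "cos (2 * x) \<le> 1 - x\<^sup>2 / 2"
proof -
  have "(\<bar>x\<bar> / 2)\<^sup>2 \<le> (sin \<bar>x\<bar>)\<^sup>2" using sin_ge_half[of "\<bar>x\<bar>"] assms by (intro power_mono) auto
  moreover have "(sin \<bar>x\<bar>)\<^sup>2 = (sin x)\<^sup>2" by (cases "x \<ge> 0") auto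
  moreover have "cos (2 * x) = 1 - 2 * (sin x)\<^sup>2" by (rule cos_double_sin)
  ultimately show ?thesis by (simp add: power_divide)
qed

lemma gauss_mass_le:
  assumes "k > 0"
  shows "gauss_mass k \<le> exp (real k / 2) / sqrt (real k)"
proof -
  define c where "c = sqrt k / 2"
  have c: "c > 0" using assms by (simp add: c_def)
  have hb: "has_bochner_integral lborel (\<lambda>x. exp (- (c * x)\<^sup>2)) (sqrt pi / c)"
    using lborel_has_bochner_integral_real_affine_iff[of c "\<lambda>x. exp (- x\<^sup>2)" "sqrt pi" 0] has_bochner_integral_gaussian c
    by (simp add: field_simps)
  have hi: "((\<lambda>x. exp (- (c * x)\<^sup>2)) has_integral (sqrt pi / c)) UNIV"
    using has_integral_integral_lborel[of "\<lambda>x. exp (- (c * x)\<^sup>2)"] hb by (simp add: has_bochner_integral_iff)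
  have "integral {-pi/2..pi/2} (\<lambda>t. exp (real k / 2 * cos (2 * t))) \<le> integral {-pi/2..pi/2} (\<lambda>t. exp (real k / 2) * exp (- (c * t)\<^sup>2))"
  proof (rule integral_le)
    show "(\<lambda>t. exp (real k / 2 * cos (2 * t))) integrable_on {-pi/2..pi/2}"
      by (intro integrable_continuous_real continuous_intros)
    show "(\<lambda>t. exp (real k / 2) * exp (- (c * t)\<^sup>2)) integrable_on {-pi/2..pi/2}"
      by (intro integrable_continuous_real continuous_intros)
    fix t assume t: "t \<in> {-pi/2..pi/2}"
    have "real k / 2 * cos (2 * t) \<le> real k / 2 * (1 - t\<^sup>2 / 2)"
      using t by (intro mult_left_mono cos_double_le) (auto simp: abs_le_iff)
    also have "\<dots> = real k / 2 + - (c * t)\<^sup>2" by (simp add: c_def power_mult_distrib power_divide algebra_simps)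
    finally show "exp (real k / 2 * cos (2 * t)) \<le> exp (real k / 2) * exp (- (c * t)\<^sup>2)"
      unfolding exp_add[symmetric] by simp
  qed
  also have "\<dots> \<le> integral UNIV (\<lambda>t. exp (real k / 2) * exp (- (c * t)\<^sup>2))"
    using has_integral_mult_right[OF hi, of "exp (real k / 2)"]
    by (intro integral_subset_le) (auto intro!: integrable_continuous_real continuous_intros)
  also have "\<dots> = exp (real k / 2) * (sqrt pi / c)"
    using has_integral_mult_right[OF hi] by (rule integral_unique)
  finally have "gauss_mass k \<le> exp (real k / 2) * (sqrt pi / c) / (2 * pi)"
    unfolding gauss_mass_def by (rule divide_right_mono) simp
  also have "\<dots> = exp (real k / 2) / sqrt k * (1 / sqrt pi)"
  proof -
    have "sqrt pi / pi = 1 / sqrt pi" using real_sqrt_mult_self[of pi] by (simp add: field_simps del: real_sqrt_mult_self)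
    moreover have "exp (real k / 2) * (sqrt pi / c) / (2 * pi) = exp (real k / 2) / sqrt k * (sqrt pi / pi)" by (simp add: c_def)
    ultimately show ?thesis by simp
  qed
  also have "\<dots> \<le> exp (real k / 2) / sqrt k * 1"
    using pi_gt3 real_sqrt_ge_one[of pi] by (intro mult_left_mono) auto
  finally show ?thesis by simp
qed

text \<open>With h = t / sqrt \<kappa> the linear term of \<kappa>/2 (exp (2ih) - 1) is i \<kappa> h
  and cancels exactly: this is the saddle point property of the radius sqrt k. The quadratic term is
  -\<kappa> h^2 = -t^2, and the cubic remainder is of order 1 / sqrt \<kappa>.\<close>

lemma saddle_phase_limit:
  assumes "filterlim \<kappa> at_top F"
  shows "((\<lambda>x. of_real (\<kappa> x / 2) * (cis (2 * (t / sqrt (\<kappa> x))) - 1) - \<i> * of_real (\<kappa> x * (t / sqrt (\<kappa> x)))) \<longlongrightarrow> - (of_real t)\<^sup>2) F"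
proof -
  have bound: "eventually (\<lambda>x. norm ((of_real (\<kappa> x / 2) * (cis (2 * (t / sqrt (\<kappa> x))) - 1) - \<i> * of_real (\<kappa> x * (t / sqrt (\<kappa> x)))) - - (complex_of_real t)\<^sup>2) \<le> 2 * \<bar>t\<bar> ^ 3 / sqrt (\<kappa> x)) F"
    using filterlim_at_top_dense[THEN iffD1, OF assms, rule_format, of 0]
  proof eventually_elim
    case (elim x)
    define h where "h = t / sqrt (\<kappa> x)"
    have h2: "\<kappa> x * h\<^sup>2 = t\<^sup>2" using elim by (simp add: h_def power_divide)
    define z where "z = \<i> * of_real (2 * h)"
    have "norm (exp z - (\<Sum>j\<le>2. z ^ j / fact j)) \<le> exp \<bar>Re z\<bar> * norm z ^ Suc 2 / fact 2"
      by (rule Taylor_exp)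
    also have "(\<Sum>j\<le>2. z ^ j / fact j) = 1 + z + z\<^sup>2 / 2" by (simp add: numeral_2_eq_2 atMost_Suc add_ac)
    also have "exp \<bar>Re z\<bar> * norm z ^ Suc 2 / fact 2 = 4 * \<bar>h\<bar> ^ 3"
      by (simp add: z_def norm_mult power_mult_distrib eval_nat_numeral)
    finally have T: "norm (exp z - (1 + z + z\<^sup>2 / 2)) \<le> 4 * \<bar>h\<bar> ^ 3" .
    have "(of_real (\<kappa> x / 2) * (cis (2 * h) - 1) - \<i> * of_real (\<kappa> x * h)) - - (complex_of_real t)\<^sup>2 = of_real (\<kappa> x / 2) * (exp z - (1 + z + z\<^sup>2 / 2))"
    proof -
      have "(complex_of_real t)\<^sup>2 = of_real (\<kappa> x) * (of_real h)\<^sup>2" using h2 by (metis of_real_mult of_real_power)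
      then show ?thesis by (simp add: z_def cis_conv_exp power_mult_distrib algebra_simps)
    qed
    also have "norm \<dots> \<le> \<kappa> x / 2 * (4 * \<bar>h\<bar> ^ 3)"
      unfolding norm_mult using T elim by (intro mult_mono) auto
    also have "\<dots> = 2 * (\<kappa> x * h\<^sup>2) * \<bar>h\<bar>" by (simp add: power3_eq_cube power2_eq_square abs_mult_self_eq mult.assoc)
    also have "\<dots> = 2 * \<bar>t\<bar> ^ 3 / sqrt (\<kappa> x)"
      unfolding h2 using elim by (simp add: h_def abs_divide power3_eq_cube power2_eq_square)
    finally show ?case unfolding h_def .
  qed
  have "((\<lambda>x. 2 * \<bar>t\<bar> ^ 3 / sqrt (\<kappa> x)) \<longlongrightarrow> 0) F"
    by (rule real_tendsto_divide_at_top[OF tendsto_const filterlim_compose[OF sqrt_at_top assms]])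
  from Lim_null_comparison[OF bound this] show ?thesis by (rule Lim_null[THEN iffD2])
qed

lemma laplace_saddle:
  fixes \<kappa> :: "real \<Rightarrow> nat" and \<Phi> :: "real \<Rightarrow> real \<Rightarrow> complex"
  assumes \<kappa>: "filterlim (\<lambda>x. real (\<kappa> x)) at_top at_top"
    and cont: "eventually (\<lambda>x. continuous_on {-pi/2..pi/2} (\<Phi> x)) at_top"
    and bound: "eventually (\<lambda>x. \<forall>t\<in>{-pi/2..pi/2}. norm (\<Phi> x t) \<le> B) at_top"
    and lim: "\<And>t. ((\<lambda>x. \<Phi> x (t / sqrt (real (\<kappa> x)))) \<longlongrightarrow> l) at_top"
  shows "((\<lambda>x. of_real (sqrt (real (\<kappa> x)) * exp (- real (\<kappa> x) / 2)) *
     integral {-pi/2..pi/2} (\<lambda>t. exp (of_real (real (\<kappa> x) / 2) * cis (2 * t)) * (\<Phi> x t * cis (- (real (\<kappa> x) * t))))) \<longlongrightarrow> l * of_real (sqrt pi)) at_top"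
proof -
  let ?w = "\<lambda>x. sqrt (real (\<kappa> x)) * exp (- real (\<kappa> x) / 2)"
  \<comment> \<open>The hypotheses hold only eventually, whereas dominated convergence asks for
    measurability at every x. Where they fail, the rescaled integrand \<open>s\<close> is set to
    0.\<close>
  define good where "good = (\<lambda>x. real (\<kappa> x) > 0 \<and> continuous_on {-pi/2..pi/2} (\<Phi> x) \<and> (\<forall>t\<in>{-pi/2..pi/2}. norm (\<Phi> x t) \<le> B))"
  have ev: "eventually good at_top"
    unfolding good_def using cont bound filterlim_at_top_dense[THEN iffD1, OF \<kappa>, rule_format, of 0]
    by eventually_elim simp
  have B0: "B \<ge> 0" if "good x" for x
  proof -
    have "norm (\<Phi> x 0) \<le> B" using that by (simp add: good_def)
    then show ?thesis using norm_ge_zero[of "\<Phi> x 0"] by linarith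
  qed
  define g where "g = (\<lambda>x t. exp (of_real (real (\<kappa> x) / 2) * (cis (2 * t) - 1)) * (\<Phi> x t * cis (- (real (\<kappa> x) * t))))"
  define f where "f = (\<lambda>x t. if t \<in> {-pi/2..pi/2} then g x t else 0)"
  define s where "s = (\<lambda>x t. if good x then f x (t / sqrt (real (\<kappa> x))) else 0)"
  have gc: "continuous_on {-pi/2..pi/2} (g x)" if "good x" for x
    unfolding g_def using that by (intro continuous_intros) (auto simp: good_def)
  have fm: "f x \<in> borel_measurable borel" if "good x" for x
    unfolding f_def using gc[OF that] by (intro borel_measurable_continuous_on_if) auto
  have sm: "s x \<in> borel_measurable lborel" for x
  proof (cases "good x")
    case True
    have "(\<lambda>t. f x (t / sqrt (real (\<kappa> x)))) \<in> borel_measurable lborel"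
      by (rule measurable_compose[OF _ fm[OF True]]) simp
    then show ?thesis using True by (simp add: s_def)
  qed (simp add: s_def)
  have fi: "integral\<^sup>L lborel (f x) = integral {-pi/2..pi/2} (g x)" if "good x" for x
  proof -
    have "set_integrable lborel {-pi/2..pi/2} (g x)"
      unfolding set_integrable_def using gc[OF that] by (intro borel_integrable_compact) auto
    from set_borel_integral_eq_integral(2)[OF this]
    show ?thesis by (simp add: set_lebesgue_integral_def f_def indicator_scaleR_eq_if)
  qed
  have si: "integral\<^sup>L lborel (s x) = of_real (?w x) *
     integral {-pi/2..pi/2} (\<lambda>t. exp (of_real (real (\<kappa> x) / 2) * cis (2 * t)) * (\<Phi> x t * cis (- (real (\<kappa> x) * t))))" if "good x" for x
  proof -
    have k: "sqrt (real (\<kappa> x)) > 0" using that by (simp add: good_def)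
    have "integral\<^sup>L lborel (f x) = (1 / sqrt (real (\<kappa> x))) *\<^sub>R integral\<^sup>L lborel (s x)"
      using lborel_integral_real_affine[of "1 / sqrt (real (\<kappa> x))" "f x" 0] k that by (simp add: s_def)
    then have "integral\<^sup>L lborel (s x) = of_real (sqrt (real (\<kappa> x))) * integral\<^sup>L lborel (f x)"
      using k by (simp add: scaleR_conv_of_real)
    also have "\<dots> = of_real (sqrt (real (\<kappa> x))) * integral {-pi/2..pi/2} (g x)" using fi[OF that] by simp
    also have "g x = (\<lambda>t. of_real (exp (- real (\<kappa> x) / 2)) * (exp (of_real (real (\<kappa> x) / 2) * cis (2 * t)) * (\<Phi> x t * cis (- (real (\<kappa> x) * t)))))"
    proof
      fix t
      have e: "of_real (exp (- real (\<kappa> x) / 2)) = exp (- complex_of_real (real (\<kappa> x) / 2))"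
        using exp_of_real[of "- real (\<kappa> x) / 2", where 'a = complex] by simp
      have "exp (of_real (real (\<kappa> x) / 2) * (cis (2 * t) - 1)) = of_real (exp (- real (\<kappa> x) / 2)) * exp (of_real (real (\<kappa> x) / 2) * cis (2 * t))"
        unfolding e exp_add[symmetric] by (simp add: algebra_simps)
      then show "g x t = of_real (exp (- real (\<kappa> x) / 2)) * (exp (of_real (real (\<kappa> x) / 2) * cis (2 * t)) * (\<Phi> x t * cis (- (real (\<kappa> x) * t))))"
        unfolding g_def by (simp only: mult.assoc)
    qed
    finally show ?thesis by (simp only: integral_mult_right of_real_mult mult.assoc)
  qed
  have "((\<lambda>x. integral\<^sup>L lborel (s x)) \<longlongrightarrow> integral\<^sup>L lborel (\<lambda>t. of_real (exp (- t\<^sup>2)) * l)) at_top"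
  proof (rule integral_dominated_convergence_at_top[where w = "\<lambda>t. B * exp (- (t / 2)\<^sup>2)"])
    show "integrable lborel (\<lambda>t. B * exp (- (t / 2)\<^sup>2))"
      using integrable_gaussian_scaled[of "1/2"] by (intro integrable_mult_right) simp
    show "\<forall>\<^sub>F x in at_top. AE t in lborel. norm (s x t) \<le> B * exp (- (t / 2)\<^sup>2)"
    proof (intro always_eventually allI AE_I2)
      fix x t
      show "norm (s x t) \<le> B * exp (- (t / 2)\<^sup>2)"
      proof (cases "good x")
        case True
        define h where "h = t / sqrt (real (\<kappa> x))"
        have k: "real (\<kappa> x) > 0" using True by (simp add: good_def)
        have B: "B \<ge> 0" by (rule B0[OF True])
        have h2: "real (\<kappa> x) * h\<^sup>2 = t\<^sup>2" using k by (simp add: h_def power_divide)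
        have "norm (f x h) \<le> B * exp (- (t / 2)\<^sup>2)"
        proof (cases "h \<in> {-pi/2..pi/2}")
          case hin: True
          have "norm (f x h) = exp (real (\<kappa> x) / 2 * (cos (2 * h) - 1)) * norm (\<Phi> x h)"
            using hin by (simp add: f_def g_def norm_mult norm_exp_eq_Re)
          also have "\<dots> \<le> exp (real (\<kappa> x) / 2 * (- h\<^sup>2 / 2)) * B"
          proof (intro mult_mono)
            have "real (\<kappa> x) / 2 * (cos (2 * h) - 1) \<le> real (\<kappa> x) / 2 * (- h\<^sup>2 / 2)"
            proof (rule mult_left_mono)
              have "- (pi / 2) \<le> h" "h \<le> pi / 2" using hin by simp_all
              then have "\<bar>h\<bar> \<le> pi / 2" by linarith
              from cos_double_le[OF this] show "cos (2 * h) - 1 \<le> - h\<^sup>2 / 2" by simp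
            qed simp
            then show "exp (real (\<kappa> x) / 2 * (cos (2 * h) - 1)) \<le> exp (real (\<kappa> x) / 2 * (- h\<^sup>2 / 2))" by simp
            show "norm (\<Phi> x h) \<le> B" using True hin by (auto simp: good_def)
          qed auto
          also have "real (\<kappa> x) / 2 * (- h\<^sup>2 / 2) = - (t / 2)\<^sup>2"
            using h2 by (simp add: power_divide)
          finally show ?thesis by (simp add: mult.commute)
        next
          case False
          then show ?thesis using B by (auto simp: f_def)
        qed
        then show ?thesis using True by (simp add: s_def h_def)
      next
        case False
        \<comment> \<open>At an x that is not good, the sign of \<open>B\<close> is inferred from
          the existence of a good one.\<close>
        have "eventually (\<lambda>x. B \<ge> 0) (at_top :: real filter)"
          using ev by eventually_elim (rule B0)
        then have "B \<ge> 0" by simp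
        then show ?thesis using False by (simp add: s_def)
      qed
    qed
    show "AE t in lborel. ((\<lambda>x. s x t) \<longlongrightarrow> of_real (exp (- t\<^sup>2)) * l) at_top"
    proof (rule AE_I2)
      fix t :: real
      have "((\<lambda>x. exp (of_real (real (\<kappa> x) / 2) * (cis (2 * (t / sqrt (real (\<kappa> x)))) - 1) - \<i> * of_real (real (\<kappa> x) * (t / sqrt (real (\<kappa> x))))) * \<Phi> x (t / sqrt (real (\<kappa> x)))) \<longlongrightarrow> exp (- (of_real t)\<^sup>2) * l) at_top"
        by (intro tendsto_mult lim tendsto_exp saddle_phase_limit \<kappa>)
      moreover have "eventually (\<lambda>x. exp (of_real (real (\<kappa> x) / 2) * (cis (2 * (t / sqrt (real (\<kappa> x)))) - 1) - \<i> * of_real (real (\<kappa> x) * (t / sqrt (real (\<kappa> x))))) * \<Phi> x (t / sqrt (real (\<kappa> x))) = s x t) at_top"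
      proof -
        have "eventually (\<lambda>x. sqrt (real (\<kappa> x)) > \<bar>t\<bar>) at_top"
          using filterlim_at_top_dense[THEN iffD1, OF filterlim_compose[OF sqrt_at_top \<kappa>], rule_format, of "\<bar>t\<bar>"] .
        with ev show ?thesis
        proof eventually_elim
          case (elim x)
          define h where "h = t / sqrt (real (\<kappa> x))"
          have "sqrt (real (\<kappa> x)) > 0" using elim abs_ge_zero[of t] by linarith
          then have "\<bar>h\<bar> \<le> 1" using elim by (simp add: h_def abs_divide)
          then have "- pi / 2 \<le> h" "h \<le> pi / 2" using pi_gt3 by linarith+
          then have hin: "h \<in> {-pi/2..pi/2}" by simp
          have "s x t = g x h" using elim hin by (simp add: s_def f_def h_def)
          also have "\<dots> = exp (of_real (real (\<kappa> x) / 2) * (cis (2 * h) - 1) - \<i> * of_real (real (\<kappa> x) * h)) * \<Phi> x h"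
          proof -
            have c: "cis (- (real (\<kappa> x) * h)) = exp (- (\<i> * of_real (real (\<kappa> x) * h)))" by (simp add: cis_conv_exp)
            have "exp (a - b) = exp a * exp (- b)" for a b :: complex by (simp add: exp_diff exp_minus divide_inverse)
            then show ?thesis unfolding g_def c by (simp only: mult.assoc mult.commute[of "\<Phi> x h"])
          qed
          finally show ?case unfolding h_def ..
        qed
      qed
      ultimately have "((\<lambda>x. s x t) \<longlongrightarrow> exp (- (of_real t)\<^sup>2) * l) at_top"
        by (rule Lim_transform_eventually)
      then show "((\<lambda>x. s x t) \<longlongrightarrow> of_real (exp (- t\<^sup>2)) * l) at_top"
        by (simp add: exp_of_real[symmetric])
    qed
  qed (use sm in auto)
  also have "integral\<^sup>L lborel (\<lambda>t. complex_of_real (exp (- t\<^sup>2)) * l) = of_real (sqrt pi) * l"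
  proof -
    have "has_bochner_integral lborel (\<lambda>t. complex_of_real (exp (- t\<^sup>2))) (of_real (sqrt pi))"
      by (rule has_bochner_integral_of_real[OF has_bochner_integral_gaussian])
    then have "has_bochner_integral lborel (\<lambda>t. complex_of_real (exp (- t\<^sup>2)) * l) (of_real (sqrt pi) * l)"
      by (intro has_bochner_integral_mult_left)
    then show ?thesis by (simp only: has_bochner_integral_iff)
  qed
  finally have "((\<lambda>x. integral\<^sup>L lborel (s x)) \<longlongrightarrow> l * of_real (sqrt pi)) at_top" by (simp add: mult.commute)
  moreover have "eventually (\<lambda>x. integral\<^sup>L lborel (s x) = of_real (?w x) *
     integral {-pi/2..pi/2} (\<lambda>t. exp (of_real (real (\<kappa> x) / 2) * cis (2 * t)) * (\<Phi> x t * cis (- (real (\<kappa> x) * t))))) at_top"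
    using ev by eventually_elim (rule si)
  ultimately show ?thesis by (rule Lim_transform_eventually)
qed

text \<open>Because of the sign (-1)^k the paired values need not converge. They are compared with a
  moving target \<open>l x\<close>, subtracted inside the integral so that Laplace's method is
  applied to a null limit. The constant 1 / (2 sqrt \<pi>) is sqrt \<pi> / (2\<pi>).\<close>

lemma gauss_coeff_asymp:
  fixes \<kappa> :: "real \<Rightarrow> nat" and f :: "real \<Rightarrow> complex \<Rightarrow> complex"
  assumes \<kappa>: "filterlim (\<lambda>x. real (\<kappa> x)) at_top at_top"
    and cont: "eventually (\<lambda>x. continuous_on (sphere 0 1) (f x)) at_top"
    and bound: "eventually (\<lambda>x. \<forall>z\<in>sphere 0 1. norm (f x z) \<le> B) at_top"
    and lbound: "\<And>x. norm (l x) \<le> D"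
    and lim: "\<And>t. ((\<lambda>x. f x (cis (t / sqrt (real (\<kappa> x)))) + (-1) ^ \<kappa> x * f x (- cis (t / sqrt (real (\<kappa> x)))) - l x) \<longlongrightarrow> 0) at_top"
  shows "((\<lambda>x. of_real (sqrt (real (\<kappa> x)) * exp (- real (\<kappa> x) / 2)) * gauss_coeff (\<kappa> x) (f x) - l x * of_real (1 / (2 * sqrt pi))) \<longlongrightarrow> 0) at_top"
proof -
  let ?w = "\<lambda>x. sqrt (real (\<kappa> x)) * exp (- real (\<kappa> x) / 2)"
  define \<Phi> where "\<Phi> = (\<lambda>x t. f x (cis t) + (-1) ^ \<kappa> x * f x (- cis t) - l x)"
  define S where "S = (\<lambda>x g. of_real (?w x) *
     integral {-pi/2..pi/2} (\<lambda>t. exp (of_real (real (\<kappa> x) / 2) * cis (2 * t)) * (g t * cis (- (real (\<kappa> x) * t)))))"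
  have S\<Phi>: "((\<lambda>x. of_real (?w x) *
     integral {-pi/2..pi/2} (\<lambda>t. exp (of_real (real (\<kappa> x) / 2) * cis (2 * t)) * (\<Phi> x t * cis (- (real (\<kappa> x) * t))))) \<longlongrightarrow> 0 * of_real (sqrt pi)) at_top"
  proof (rule laplace_saddle[OF \<kappa>])
    show "eventually (\<lambda>x. continuous_on {-pi/2..pi/2} (\<Phi> x)) at_top"
      using cont
    proof eventually_elim
      case (elim x)
      have "continuous_on UNIV (\<lambda>t. f x (cis t))" "continuous_on UNIV (\<lambda>t. f x (- cis t))"
        by (rule continuous_on_compose2[OF elim]; auto intro!: continuous_intros)+
      then have "continuous_on {-pi/2..pi/2} (\<lambda>t. f x (cis t))" "continuous_on {-pi/2..pi/2} (\<lambda>t. f x (- cis t))"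
        by (auto intro: continuous_on_subset)
      then show ?case unfolding \<Phi>_def by (intro continuous_intros)
    qed
    show "eventually (\<lambda>x. \<forall>t\<in>{-pi/2..pi/2}. norm (\<Phi> x t) \<le> 2 * B + D) at_top"
      using bound
    proof eventually_elim
      case (elim x)
      show ?case
      proof
        fix t
        have "norm (\<Phi> x t) \<le> norm (f x (cis t) + (-1) ^ \<kappa> x * f x (- cis t)) + norm (l x)"
          unfolding \<Phi>_def by (rule norm_triangle_ineq4)
        also have "norm (f x (cis t) + (-1) ^ \<kappa> x * f x (- cis t)) \<le> norm (f x (cis t)) + norm (f x (- cis t))"
          by (rule order.trans[OF norm_triangle_ineq]) (simp add: norm_mult norm_power)
        also have "norm (f x (cis t)) + norm (f x (- cis t)) + norm (l x) \<le> B + B + D"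
          using elim lbound by (intro add_mono) auto
        finally show "norm (\<Phi> x t) \<le> 2 * B + D" by simp
      qed
    qed
    show "((\<lambda>x. \<Phi> x (t / sqrt (real (\<kappa> x)))) \<longlongrightarrow> 0) at_top" for t
      unfolding \<Phi>_def by (rule lim)
  qed
  have S1: "((\<lambda>x. S x (\<lambda>_. 1)) \<longlongrightarrow> 1 * of_real (sqrt pi)) at_top"
    unfolding S_def by (rule laplace_saddle[OF \<kappa>, of "\<lambda>_ _. 1" 1]) auto
  have split: "eventually (\<lambda>x. of_real (?w x) * gauss_coeff (\<kappa> x) (f x)
     - l x * of_real (1 / (2 * sqrt pi)) = (S x (\<Phi> x) + l x * (S x (\<lambda>_. 1) - of_real (sqrt pi))) / of_real (2 * pi)) at_top"
    using cont
  proof eventually_elim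
    case (elim x)
    define A where "A = (\<lambda>t. exp (of_real (real (\<kappa> x) / 2) * cis (2 * t)))"
    define E where "E = (\<lambda>t. cis (- (real (\<kappa> x) * t)))"
    have i1: "(\<lambda>t. A t * ((f x (cis t) + (-1) ^ \<kappa> x * f x (- cis t)) * E t)) integrable_on {-pi/2..pi/2}"
      unfolding A_def E_def by (rule gauss_coeff_integrable[OF elim])
    have i2: "(\<lambda>t. l x * (A t * (1 * E t))) integrable_on {-pi/2..pi/2}"
      unfolding A_def E_def by (intro integrable_continuous_real continuous_intros)
    have "integral {-pi/2..pi/2} (\<lambda>t. A t * (\<Phi> x t * E t)) = integral {-pi/2..pi/2} (\<lambda>t. A t * ((f x (cis t) + (-1) ^ \<kappa> x * f x (- cis t)) * E t) - l x * (A t * (1 * E t)))"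
      by (intro integral_cong) (simp add: \<Phi>_def algebra_simps)
    also have "\<dots> = integral {-pi/2..pi/2} (\<lambda>t. A t * ((f x (cis t) + (-1) ^ \<kappa> x * f x (- cis t)) * E t)) - l x * integral {-pi/2..pi/2} (\<lambda>t. A t * (1 * E t))"
      unfolding Henstock_Kurzweil_Integration.integral_diff[OF i1 i2] by simp
    finally have eq: "integral {-pi/2..pi/2} (\<lambda>t. A t * (\<Phi> x t * E t)) = integral {-pi/2..pi/2} (\<lambda>t. A t * ((f x (cis t) + (-1) ^ \<kappa> x * f x (- cis t)) * E t)) - l x * integral {-pi/2..pi/2} (\<lambda>t. A t * (1 * E t))" .
    have SE: "S x g = of_real (?w x) * integral {-pi/2..pi/2} (\<lambda>t. A t * (g t * E t))" for g
      by (simp only: S_def A_def E_def)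
    have "of_real (?w x) * integral {-pi/2..pi/2} (\<lambda>t. A t * ((f x (cis t) + (-1) ^ \<kappa> x * f x (- cis t)) * E t))
       = S x (\<Phi> x) + l x * S x (\<lambda>_. 1)"
      unfolding SE eq by (simp only: right_diff_distrib mult.left_commute[of "l x"]) simp
    then have "of_real (?w x) * gauss_coeff (\<kappa> x) (f x) = (S x (\<Phi> x) + l x * S x (\<lambda>_. 1)) / of_real (2 * pi)"
      unfolding gauss_coeff_def A_def E_def by simp
    moreover have "l x * of_real (1 / (2 * sqrt pi)) = l x * of_real (sqrt pi) / of_real (2 * pi)"
    proof -
      have "sqrt pi / (2 * pi) = 1 / (2 * sqrt pi)" using real_sqrt_mult_self[of pi] by (simp add: field_simps del: real_sqrt_mult_self)
      then have "complex_of_real (sqrt pi) / of_real (2 * pi) = of_real (1 / (2 * sqrt pi))" by (metis of_real_divide)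
      then show ?thesis by (metis times_divide_eq_right)
    qed
    ultimately show ?case by (simp only: right_diff_distrib add_divide_distrib diff_divide_distrib) simp
  qed
  have "((\<lambda>x. l x * (S x (\<lambda>_. 1) - of_real (sqrt pi))) \<longlongrightarrow> 0) at_top"
  proof (rule Lim_null_comparison)
    show "eventually (\<lambda>x. norm (l x * (S x (\<lambda>_. 1) - of_real (sqrt pi))) \<le> D * norm (S x (\<lambda>_. 1) - of_real (sqrt pi))) at_top"
      using lbound by (intro always_eventually allI) (simp add: norm_mult mult_right_mono)
    show "((\<lambda>x. D * norm (S x (\<lambda>_. 1) - of_real (sqrt pi))) \<longlongrightarrow> 0) at_top"
      using tendsto_mult[OF tendsto_const[of D] tendsto_norm[OF tendsto_diff[OF S1 tendsto_const[of "of_real (sqrt pi)"]]]] by simp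
  qed
  moreover have "((\<lambda>x. S x (\<Phi> x)) \<longlongrightarrow> 0) at_top" using S\<Phi> by (simp add: S_def)
  ultimately have "((\<lambda>x. (S x (\<Phi> x) + l x * (S x (\<lambda>_. 1) - of_real (sqrt pi))) / of_real (2 * pi)) \<longlongrightarrow> (0 + 0) / of_real (2 * pi)) at_top"
    by (intro tendsto_intros) auto
  then have "((\<lambda>x. (S x (\<Phi> x) + l x * (S x (\<lambda>_. 1) - of_real (sqrt pi))) / of_real (2 * pi)) \<longlongrightarrow> 0) at_top" by simp
  moreover have "eventually (\<lambda>x. (S x (\<Phi> x) + l x * (S x (\<lambda>_. 1) - of_real (sqrt pi))) / of_real (2 * pi) =
     of_real (?w x) * gauss_coeff (\<kappa> x) (f x) - l x * of_real (1 / (2 * sqrt pi))) at_top"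
    using split by eventually_elim simp
  ultimately show ?thesis by (rule Lim_transform_eventually)
qed

section \<open>Gaussian moments and Stirling's formula\<close>

text \<open>Stirling's formula comes from the same saddle point computation: for f = 1 and k = 2m
  the functional is known exactly and equals m^m / m!.\<close>

lemma stirling_fact:
  "(\<lambda>m. real m ^ m * sqrt (2 * real m) * exp (- real m) / fact m) \<longlonglongrightarrow> 1 / sqrt pi"
proof -
  define \<kappa> where "\<kappa> = (\<lambda>x::real. 2 * nat \<lfloor>x\<rfloor>)"
  have \<kappa>: "filterlim (\<lambda>x. real (\<kappa> x)) at_top at_top" unfolding \<kappa>_def
    by (rule filterlim_at_top_mono[of "\<lambda>x. 2 * x - 2"]) (real_asymp, auto intro!: always_eventually, linarith)
  have "((\<lambda>x. of_real (sqrt (real (\<kappa> x)) * exp (- real (\<kappa> x) / 2)) * gauss_coeff (\<kappa> x) (\<lambda>_. 1) - 2 * of_real (1 / (2 * sqrt pi))) \<longlongrightarrow> 0) at_top"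
    by (rule gauss_coeff_asymp[OF \<kappa>, of _ 1 _ 2]) (auto simp: \<kappa>_def)
  then have "((\<lambda>x. of_real (sqrt (real (\<kappa> x)) * exp (- real (\<kappa> x) / 2)) * gauss_coeff (\<kappa> x) (\<lambda>_. 1)) \<longlongrightarrow> 2 * of_real (1 / (2 * sqrt pi))) at_top"
    by (rule Lim_null[THEN iffD2])
  from filterlim_compose[OF this filterlim_real_sequentially]
  have "(\<lambda>m. of_real (sqrt (real (2 * m)) * exp (- real (2 * m) / 2)) * gauss_coeff (2 * m) (\<lambda>_. 1)) \<longlonglongrightarrow> complex_of_real (1 / sqrt pi)"
    by (simp add: \<kappa>_def)
  moreover have "eventually (\<lambda>m. of_real (sqrt (real (2 * m)) * exp (- real (2 * m) / 2)) * gauss_coeff (2 * m) (\<lambda>_. 1) = complex_of_real (real m ^ m * sqrt (2 * real m) * exp (- real m) / fact m)) sequentially"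
    using eventually_gt_at_top[of 0]
  proof eventually_elim
    case (elim m)
    have "sqrt (2 * real m) ^ (2 * m) = (2 * real m) ^ m" by (simp add: power_mult)
    then have "gauss_moment (2 * m) / fact (2 * m) * sqrt (real (2 * m)) ^ (2 * m) = real m ^ m / fact m"
      by (simp add: gauss_moment_def power_mult_distrib)
    then have "gauss_coeff (2 * m) (\<lambda>_. 1) = of_real (real m ^ m / fact m)"
      using gauss_coeff_1[of "2 * m"] elim by simp
    then show ?case by simp
  qed
  ultimately have "(\<lambda>m. complex_of_real (real m ^ m * sqrt (2 * real m) * exp (- real m) / fact m)) \<longlonglongrightarrow> complex_of_real (1 / sqrt pi)"
    by (rule Lim_transform_eventually)
  then show ?thesis by (simp only: tendsto_of_real_iff)
qed

lemma Gamma_half_integer: "Gamma (real m + 3 / 2) = sqrt pi * fact (2 * m + 1) / (2 ^ (2 * m + 1) * fact m)"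
proof -
  have n1: "complex_of_nat (Suc m) \<notin> \<int>\<^sub>\<le>\<^sub>0" and n2: "complex_of_nat (Suc m) + 1/2 \<notin> \<int>\<^sub>\<le>\<^sub>0"
    by (auto elim!: nonpos_Ints_cases' simp: complex_eq_iff)
  have "Gamma (complex_of_nat (Suc m)) * Gamma (complex_of_nat (Suc m) + 1/2) =
      exp ((1 - 2 * of_nat (Suc m)) * of_real (ln 2)) * of_real (sqrt pi) * Gamma (2 * of_nat (Suc m))"
    by (rule Gamma_legendre_duplication[OF n1 n2])
  also have "Gamma (complex_of_nat (Suc m)) = fact m" using Gamma_fact[of m, where 'a = complex] by simp
  also have "Gamma (2 * complex_of_nat (Suc m)) = fact (2 * m + 1)"
    using Gamma_fact[of "2 * m + 1", where 'a = complex] by (simp add: algebra_simps)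
  also have "complex_of_nat (Suc m) + 1/2 = of_real (real m + 3/2)" by (simp add: field_simps)
  also have "Gamma (complex_of_real (real m + 3/2)) = of_real (Gamma (real m + 3/2))"
    by (rule Gamma_complex_of_real)
  also have "exp ((1 - 2 * complex_of_nat (Suc m)) * of_real (ln 2)) = of_real (1 / 2 ^ (2 * m + 1))"
  proof -
    have "exp ((1 - 2 * complex_of_nat (Suc m)) * of_real (ln 2)) = of_real (exp (- (real (2 * m + 1) * ln 2)))"
      by (simp add: exp_of_real[symmetric] algebra_simps)
    also have "exp (- (real (2 * m + 1) * ln 2)) = 1 / 2 ^ (2 * m + 1)"
      unfolding exp_minus exp_of_nat_mult by (simp add: inverse_eq_divide)
    finally show ?thesis .
  qed
  finally have "complex_of_real (fact m * Gamma (real m + 3/2)) = of_real (1 / 2 ^ (2 * m + 1) * sqrt pi * fact (2 * m + 1))"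
    by simp
  then have "fact m * Gamma (real m + 3/2) = 1 / 2 ^ (2 * m + 1) * sqrt pi * fact (2 * m + 1)"
    by (simp only: of_real_eq_iff)
  then show ?thesis by (simp add: field_simps)
qed

lemma gamma_moment_even: "even k \<Longrightarrow> gamma_moment k = gauss_moment k"
proof (elim evenE)
  fix m assume k: "k = 2 * m"
  have "Gamma (real m + 1) = fact m" using Gamma_fact[of m, where 'a = real] by (simp add: add.commute)
  then show "gamma_moment k = gauss_moment k"
    by (simp add: gamma_moment_def gauss_moment_def k powr_realpow)
qed

lemma gamma_moment_odd: "gamma_moment (2 * m + 1) = 2 powr (real m + 1/2) * fact m / sqrt pi"
proof -
  have e: "real (2 * m + 1) / 2 + 1 = real m + 3/2" "real (2 * m + 1) / 2 = real m + 1/2" by (simp_all add: field_simps)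
  define X where "X = (2::real) powr (real m + 1/2)"
  have X: "X > 0" "(2::real) ^ (2 * m + 1) = X * X"
    using powr_realpow[of 2 "2 * m + 1"] by (simp_all add: X_def powr_add[symmetric] add.commute)
  have "gamma_moment (2 * m + 1) = fact (2 * m + 1) / (X * (sqrt pi * fact (2 * m + 1) / (X * X * fact m)))"
    unfolding gamma_moment_def e(1) unfolding e(2) Gamma_half_integer X(2) X_def ..
  also have "\<dots> = X * fact m / sqrt pi" using X(1) by simp
  finally show ?thesis by (simp add: X_def)
qed

text \<open>The interpolation by the Gamma function makes the limit the same for both parities. For
  even k this is Stirling's formula; for odd k the formula is applied to m! and to (2m + 1)!, and
  \<open>R\<close> is the explicit quotient that remains.\<close>

lemma gamma_moment_asymp:
  "(\<lambda>k. gamma_moment k * sqrt k ^ k / fact k * (sqrt k * exp (- real k / 2))) \<longlonglongrightarrow> 1 / sqrt pi"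
proof -
  define c where "c = (\<lambda>k. gamma_moment k * sqrt k ^ k / fact k * (sqrt k * exp (- real k / 2)))"
  define s where "s = (\<lambda>m. real m ^ m * sqrt (2 * real m) * exp (- real m) / fact m)"
  have s: "s \<longlonglongrightarrow> 1 / sqrt pi" unfolding s_def by (rule stirling_fact)
  have even: "c (2 * m) = s m" for m
  proof -
    have "sqrt (2 * real m) ^ (2 * m) = (2 * real m) ^ m" by (simp add: power_mult)
    then show ?thesis by (simp add: c_def s_def gamma_moment_even gauss_moment_def power_mult_distrib)
  qed
  define R where "R = (\<lambda>m::nat. 2 powr (real m + 1/2) / sqrt pi * (real m ^ m * sqrt (2 * real m) * exp (- real m)) *
     (real (2 * m + 1) powr (real m + 1/2) * (sqrt (real (2 * m + 1)) * exp (- real (2 * m + 1) / 2))) /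
     (real (2 * m + 1) powr real (2 * m + 1) * sqrt (2 * real (2 * m + 1)) * exp (- real (2 * m + 1))))"
  have odd: "eventually (\<lambda>m. c (2 * m + 1) = s (2 * m + 1) / s m * R m) sequentially"
    using eventually_gt_at_top[of 0]
  proof eventually_elim
    case (elim m)
    define k where "k = 2 * m + 1"
    have k: "real k > 0" by (simp add: k_def)
    have "sqrt k ^ k = real k powr (real m + 1/2)"
      using k by (simp add: powr_half_sqrt[symmetric] powr_realpow[symmetric] powr_powr) (simp add: k_def field_simps)
    moreover have "real k ^ k = real k powr real k" using k by (simp add: powr_realpow)
    moreover have "s m \<noteq> 0" using elim by (simp add: s_def)
    ultimately have "c k = s k / s m * R m"
      using elim k unfolding c_def s_def R_def k_def[symmetric] unfolding k_def gamma_moment_odd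
      by (simp add: divide_simps)
    then show ?case by (simp add: k_def)
  qed
  have "R \<longlonglongrightarrow> 1 / sqrt pi"
  proof -
    define R' where "R' = (\<lambda>m::real. 2 powr (m + 1/2) / sqrt pi * (m powr m * sqrt (2 * m) * exp (- m)) *
     ((2 * m + 1) powr (m + 1/2) * (sqrt (2 * m + 1) * exp (- (2 * m + 1) / 2))) /
     ((2 * m + 1) powr (2 * m + 1) * sqrt (2 * (2 * m + 1)) * exp (- (2 * m + 1))))"
    have "(R' \<longlongrightarrow> inverse (root 2 pi) * (2 powr (1/2) * exp (1/2)) * (exp (1/2) * 2 powr (1/2)) * inverse (exp 1) / 2) at_top"
      unfolding R'_def by real_asymp
    also have "inverse (root 2 pi) * (2 powr (1/2) * exp (1/2)) * (exp (1/2) * 2 powr (1/2)) * inverse (exp 1) / 2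
        = 1 / sqrt pi * (2 powr (1/2) * 2 powr (1/2)) * (exp (1/2) * exp (1/2)) * inverse (exp 1) / 2"
      by (simp add: sqrt_def inverse_eq_divide)
    also have "\<dots> = 1 / sqrt pi" unfolding powr_add[symmetric] exp_add[symmetric] by simp
    finally have "(R' \<longlongrightarrow> 1 / sqrt pi) at_top" .
    from filterlim_compose[OF this filterlim_real_sequentially]
    have "(\<lambda>m. R' (real m)) \<longlonglongrightarrow> 1 / sqrt pi" .
    moreover have "eventually (\<lambda>m. R' (real m) = R m) sequentially"
      using eventually_gt_at_top[of 0]
      by eventually_elim (simp add: R_def R'_def powr_realpow add.commute)
    ultimately show ?thesis by (rule Lim_transform_eventually)
  qed
  then have "(\<lambda>m. s (2 * m + 1) / s m * R m) \<longlonglongrightarrow> (1 / sqrt pi) / (1 / sqrt pi) * (1 / sqrt pi)"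
    by (intro tendsto_intros s filterlim_compose[OF s]) (auto intro!: filterlim_subseq simp: strict_mono_def)
  then have co: "(\<lambda>m. c (2 * m + 1)) \<longlonglongrightarrow> 1 / sqrt pi"
    using odd by (simp add: tendsto_cong)
  have ce: "(\<lambda>m. c (2 * m)) \<longlonglongrightarrow> 1 / sqrt pi" using s by (simp add: even)
  show ?thesis unfolding c_def[symmetric]
  proof (rule LIMSEQ_I)
    fix e :: real assume e: "e > 0"
    obtain A where A: "\<And>m. m \<ge> A \<Longrightarrow> norm (c (2 * m) - 1 / sqrt pi) < e" using LIMSEQ_D[OF ce e] by blast
    obtain B where B: "\<And>m. m \<ge> B \<Longrightarrow> norm (c (2 * m + 1) - 1 / sqrt pi) < e" using LIMSEQ_D[OF co e] by blast
    show "\<exists>N. \<forall>k\<ge>N. norm (c k - 1 / sqrt pi) < e"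
    proof (intro exI[of _ "2 * (A + B) + 1"] allI impI)
      fix k assume k: "2 * (A + B) + 1 \<le> k"
      show "norm (c k - 1 / sqrt pi) < e"
      proof (cases "even k")
        case True
        then obtain m where "k = 2 * m" by (elim evenE)
        then show ?thesis using A[of m] k by simp
      next
        case False
        then obtain m where "k = 2 * m + 1" by (elim oddE)
        then show ?thesis using B[of m] k by simp
      qed
    qed
  qed
qed

section \<open>Expansion at the saddle points\<close>

text \<open>The exponent of \<open>tilt\<close> without its factor \<open>L\<close>. The type is
  generic because complex values on the circle are compared with real values at r and -r.\<close>

definition exp_tail :: "'a::{real_normed_field, banach} \<Rightarrow> 'a" where
  "exp_tail w = exp w - 1 - w - w\<^sup>2 / 2"

lemma exp_tail_sums: "(\<lambda>n. w ^ (n + 3) / fact (n + 3)) sums exp_tail (w :: 'a::{real_normed_field, banach})"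
proof -
  have "(\<lambda>n. w ^ n / fact n) sums exp w"
    using exp_converges[of w] by (simp add: scaleR_conv_of_real divide_inverse mult.commute)
  from sums_split_initial_segment[OF this, of 3] show ?thesis
    by (simp add: exp_tail_def eval_nat_numeral algebra_simps)
qed

text \<open>The Taylor coefficients are nonnegative, so on a circle about 0 the modulus is largest
  at the positive real point. Normalising by the value there bounds the integrand on the whole
  circle.\<close>

lemma norm_exp_tail_le: "norm (exp_tail w) \<le> exp_tail (norm w)" for w :: complex
proof -
  have s: "summable (\<lambda>n. norm w ^ (n + 3) / fact (n + 3))"
    using exp_tail_sums[of "norm w"] by (rule sums_summable)
  have "norm (exp_tail w) = norm (\<Sum>n. w ^ (n + 3) / fact (n + 3))"
    using sums_unique[OF exp_tail_sums[of w]] by simp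
  also have "\<dots> \<le> (\<Sum>n. norm w ^ (n + 3) / fact (n + 3))"
    using summable_norm[of "\<lambda>n. w ^ (n + 3) / fact (n + 3)"] s by (simp add: norm_divide norm_power)
  also have "\<dots> = exp_tail (norm w)" using sums_unique[OF exp_tail_sums[of "norm w"]] by simp
  finally show ?thesis .
qed

lemma exp_tail_ge_cube: "r \<ge> 0 \<Longrightarrow> exp_tail r \<ge> r ^ 3 / 6" for r :: real
  using sum_le_suminf[OF sums_summable[OF exp_tail_sums[of r]], of "{0}"] sums_unique[OF exp_tail_sums[of r]]
  by (simp add: fact_numeral)

lemma exp_tail_nonneg: "r \<ge> 0 \<Longrightarrow> exp_tail r \<ge> 0" for r :: real
  using exp_tail_ge_cube[of r] zero_le_power[of r 3] by linarith

lemma exp_tail_taylor3: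
  assumes "norm w \<le> 1/2" shows "norm (exp_tail w - w ^ 3 / 6) \<le> norm (w :: complex) ^ 4"
proof -
  have "norm (exp w - (\<Sum>k\<le>3. w ^ k / fact k)) \<le> exp \<bar>Re w\<bar> * norm w ^ Suc 3 / fact 3"
    by (rule Taylor_exp)
  also have "(\<Sum>k\<le>3. w ^ k / fact k) = 1 + w + w\<^sup>2 / 2 + w ^ 3 / 6"
    by (simp add: eval_nat_numeral)
  also have "exp \<bar>Re w\<bar> * norm w ^ Suc 3 / fact 3 \<le> 2 * norm w ^ 4 / 6"
  proof -
    have "exp \<bar>Re w\<bar> \<le> 2" using exp_bound_half[of "\<bar>Re w\<bar>"] abs_Re_le_cmod[of w] assms by simp
    moreover have "Suc 3 = 4" "fact 3 = (6 :: real)" by (simp_all add: fact_numeral)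
    ultimately show ?thesis by (simp only:) (intro divide_right_mono mult_right_mono, auto)
  qed
  also have "\<dots> \<le> norm w ^ 4" using zero_le_power[OF norm_ge_zero, of w 4] by linarith
  finally show ?thesis by (simp add: exp_tail_def algebra_simps)
qed

lemma exp_tail_taylor4:
  assumes "norm w \<le> 1/2" shows "norm (exp_tail w - w ^ 3 / 6 - w ^ 4 / 24) \<le> norm (w :: complex) ^ 5"
proof -
  have "norm (exp w - (\<Sum>k\<le>4. w ^ k / fact k)) \<le> exp \<bar>Re w\<bar> * norm w ^ Suc 4 / fact 4"
    by (rule Taylor_exp)
  also have "(\<Sum>k\<le>4. w ^ k / fact k) = 1 + w + w\<^sup>2 / 2 + w ^ 3 / 6 + w ^ 4 / 24"
    by (simp add: eval_nat_numeral)
  also have "exp \<bar>Re w\<bar> * norm w ^ Suc 4 / fact 4 \<le> 2 * norm w ^ 5 / 24"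
  proof -
    have "exp \<bar>Re w\<bar> \<le> 2" using exp_bound_half[of "\<bar>Re w\<bar>"] abs_Re_le_cmod[of w] assms by simp
    moreover have "Suc 4 = 5" "fact 4 = (24 :: real)" by (simp_all add: fact_numeral)
    ultimately show ?thesis by (simp only:) (intro divide_right_mono mult_right_mono, auto)
  qed
  also have "\<dots> \<le> norm w ^ 5" using zero_le_power[OF norm_ge_zero, of w 5] by linarith
  finally show ?thesis by (simp add: exp_tail_def algebra_simps)
qed

text \<open>The cubic terms cancel.\<close>

lemma exp_tail_even:
  assumes "norm w \<le> 1/2" shows "norm (exp_tail w + exp_tail (- w)) \<le> 2 * norm (w :: complex) ^ 4"
proof -
  have "norm ((exp_tail w - w ^ 3 / 6) + (exp_tail (- w) - (- w) ^ 3 / 6)) \<le> norm w ^ 4 + norm (- w) ^ 4"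
    using assms by (intro norm_triangle_mono exp_tail_taylor3) auto
  then show ?thesis by simp
qed

text \<open>The quartic terms cancel, which raises the error to the fifth order.\<close>

lemma exp_tail_odd:
  assumes "norm w \<le> 1/2" shows "norm (exp_tail w - exp_tail (- w) - w ^ 3 / 3) \<le> 2 * norm (w :: complex) ^ 5"
proof -
  have "norm ((exp_tail w - w ^ 3 / 6 - w ^ 4 / 24) - (exp_tail (- w) - (- w) ^ 3 / 6 - (- w) ^ 4 / 24)) \<le> norm w ^ 5 + norm (- w) ^ 5"
    using assms by (intro order.trans[OF norm_triangle_ineq4] add_mono exp_tail_taylor4) simp_all
  then show ?thesis by simp
qed

text \<open>On the disc the derivative exp w - 1 - w is at most 2 r^2, and the chord between the two
  points has length r |z - z'|.\<close>

lemma exp_tail_circle: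
  assumes r: "0 \<le> r" "r \<le> 1/2" and z: "norm z = 1" "norm z' = 1"
  shows "norm (exp_tail (of_real r * z) - exp_tail (of_real r * z')) \<le> 2 * r ^ 3 * norm (z - z' :: complex)"
proof -
  have "norm (exp_tail (of_real r * z) - exp_tail (of_real r * z')) \<le> (2 * r\<^sup>2) * norm (of_real r * z - of_real r * z')"
  proof (rule field_differentiable_bound[of "cball 0 r" exp_tail "\<lambda>w. exp w - 1 - w"])
    fix w :: complex assume w: "w \<in> cball 0 r"
    show "(exp_tail has_field_derivative exp w - 1 - w) (at w within cball 0 r)"
      unfolding exp_tail_def[abs_def] by (auto intro!: derivative_eq_intros)
    have "norm (exp w - (\<Sum>k\<le>1. w ^ k / fact k)) \<le> exp \<bar>Re w\<bar> * norm w ^ Suc 1 / fact 1"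
      by (rule Taylor_exp)
    also have "(\<Sum>k\<le>1. w ^ k / fact k) = 1 + w" by simp
    also have "exp \<bar>Re w\<bar> * norm w ^ Suc 1 / fact 1 \<le> 2 * r\<^sup>2"
      using exp_bound_half[of "\<bar>Re w\<bar>"] abs_Re_le_cmod[of w] w r
      by (auto simp: power2_eq_square intro!: mult_mono)
    finally show "norm (exp w - 1 - w) \<le> 2 * r\<^sup>2" by (simp add: algebra_simps)
  qed (use r z in \<open>auto simp: norm_mult\<close>)
  also have "of_real r * z - of_real r * z' = of_real r * (z - z')" by (simp add: algebra_simps)
  finally show ?thesis using r by (simp add: norm_mult power2_eq_square power3_eq_cube mult_ac)
qed

lemma exp_tail_of_real: "exp_tail (of_real x) = (of_real (exp_tail x) :: complex)"
  by (simp add: exp_tail_def exp_of_real)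

lemma exp_tail_real_bounds:
  fixes r :: real
  assumes "0 \<le> r" "r \<le> 1/6"
  shows "\<bar>exp_tail r - r ^ 3 / 6\<bar> \<le> r ^ 4" "exp_tail (- r) \<le> 0" "\<bar>exp_tail r - exp_tail (- r) - r ^ 3 / 3\<bar> \<le> 2 * r ^ 5"
proof -
  show "\<bar>exp_tail r - r ^ 3 / 6\<bar> \<le> r ^ 4"
  proof -
    have "norm (exp_tail (complex_of_real r) - of_real r ^ 3 / 6) \<le> norm (complex_of_real r) ^ 4"
      using assms by (intro exp_tail_taylor3) simp
    also have "exp_tail (complex_of_real r) - of_real r ^ 3 / 6 = of_real (exp_tail r - r ^ 3 / 6)"
      unfolding exp_tail_of_real by simp
    finally show ?thesis unfolding norm_of_real using assms by simp
  qed
  have "norm (exp_tail (complex_of_real (- r)) - of_real (- r) ^ 3 / 6) \<le> norm (complex_of_real (- r)) ^ 4"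
    using assms by (intro exp_tail_taylor3) simp
  also have "exp_tail (complex_of_real (- r)) - of_real (- r) ^ 3 / 6 = of_real (exp_tail (- r) + r ^ 3 / 6)"
    unfolding exp_tail_of_real by simp
  finally have "exp_tail (- r) \<le> r ^ 4 - r ^ 3 / 6" unfolding norm_of_real using assms by (simp add: abs_le_iff)
  \<comment> \<open>The hypothesis that r is at most 1/6 is made for this: the quartic error stays
    below the cubic term.\<close>
  also have "\<dots> = r ^ 3 * (r - 1/6)" by (simp add: eval_nat_numeral algebra_simps)
  also have "\<dots> \<le> 0" using assms by (intro mult_nonneg_nonpos) auto
  finally show "exp_tail (- r) \<le> 0" .
  have "norm (exp_tail (complex_of_real r) - exp_tail (- complex_of_real r) - of_real r ^ 3 / 3) \<le> 2 * norm (complex_of_real r) ^ 5"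
    using assms by (intro exp_tail_odd) simp
  also have "exp_tail (complex_of_real r) - exp_tail (- complex_of_real r) - of_real r ^ 3 / 3 = of_real (exp_tail r - exp_tail (- r) - r ^ 3 / 3)"
    unfolding of_real_minus[symmetric] exp_tail_of_real by simp
  finally show "\<bar>exp_tail r - exp_tail (- r) - r ^ 3 / 3\<bar> \<le> 2 * r ^ 5" unfolding norm_of_real using assms by simp
qed

lemma tilt_eq: "tilt H L w = H w * exp (of_real L * exp_tail w)"
  by (simp add: tilt_def exp_tail_def)

section \<open>Even and odd parts of the tilting factor\<close>

lemma holomorphic_taylor2:
  assumes H: "H holomorphic_on ball 0 R" and R: "0 < \<rho>" "\<rho> < R"
  obtains C c where "\<And>w. norm w \<le> \<rho> \<Longrightarrow> norm (H w - (H 0 + deriv H 0 * w + c * w\<^sup>2)) \<le> C * norm w ^ 3"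
proof -
  have hd: "(deriv ^^ n) H holomorphic_on ball 0 R" for n using H by (rule holomorphic_higher_deriv) simp
  have sub: "cball 0 \<rho> \<subseteq> ball (0::complex) R" using R by auto
  have "compact ((deriv ^^ 3) H ` cball 0 \<rho>)"
    by (intro compact_continuous_image continuous_on_subset[OF holomorphic_on_imp_continuous_on[OF hd] sub]) auto
  then have "bounded ((deriv ^^ 3) H ` cball 0 \<rho>)" by (rule compact_imp_bounded)
  then obtain B where B: "\<And>w. w \<in> cball 0 \<rho> \<Longrightarrow> norm ((deriv ^^ 3) H w) \<le> B"
    unfolding bounded_iff by blast
  show ?thesis
  proof (rule that[of "(deriv ^^ 2) H 0 / 2" "B / 2"])
    fix w :: complex assume w: "norm w \<le> \<rho>"
    have "norm ((deriv ^^ 0) H w - (\<Sum>i\<le>2. (deriv ^^ i) H 0 * (w - 0) ^ i / fact i)) \<le> B * norm (w - 0) ^ Suc 2 / fact 2"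
    proof (rule complex_Taylor[of "cball 0 \<rho>"])
      fix i :: nat and x :: complex assume "x \<in> cball 0 \<rho>" "i \<le> 2"
      then have "x \<in> ball 0 R" using sub by auto
      then have "((deriv ^^ i) H has_field_derivative deriv ((deriv ^^ i) H) x) (at x)"
        by (intro holomorphic_derivI[OF hd]) auto
      then show "((deriv ^^ i) H has_field_derivative (deriv ^^ Suc i) H x) (at x within cball 0 \<rho>)"
        by (simp add: has_field_derivative_at_within)
    next
      fix x :: complex assume "x \<in> cball 0 \<rho>"
      then show "norm ((deriv ^^ Suc 2) H x) \<le> B" using B by (simp add: numeral_3_eq_3)
    qed (use w R in auto)
    then show "norm (H w - (H 0 + deriv H 0 * w + (deriv ^^ 2) H 0 / 2 * w\<^sup>2)) \<le> B / 2 * norm w ^ 3"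
      by (simp add: numeral_2_eq_2 eval_nat_numeral algebra_simps)
  qed
qed

text \<open>The bookkeeping for \<open>h = H w\<close>, \<open>h' = H (- w)\<close>,
  \<open>q = L * exp_tail w\<close>, \<open>q' = L * exp_tail (- w)\<close> and \<open>B\<close> of
  size L |w|^3. In the sum the odd first-order terms cancel; in the difference the second-order
  terms cancel up to O(B^3). Landau symbols over an arbitrary filter keep the constants out of
  sight.\<close>

lemma parity_expansion:
  fixes h h' q q' w v B :: "'a \<Rightarrow> complex" and F :: "'a filter"
  assumes B1: "B \<in> O[F](\<lambda>_. 1)" and w: "w \<in> O[F](B)" and q: "q \<in> O[F](B)" "q' \<in> O[F](B)"
    and h: "(\<lambda>x. h x - (1 + a * w x + c * w x ^ 2)) \<in> O[F](\<lambda>x. B x ^ 3)"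
    and h': "(\<lambda>x. h' x - (1 - a * w x + c * w x ^ 2)) \<in> O[F](\<lambda>x. B x ^ 3)"
    and e: "(\<lambda>x. exp (q x) - (1 + q x + q x ^ 2 / 2)) \<in> O[F](\<lambda>x. B x ^ 3)"
    and e': "(\<lambda>x. exp (q' x) - (1 + q' x + q' x ^ 2 / 2)) \<in> O[F](\<lambda>x. B x ^ 3)"
    and even: "(\<lambda>x. q x + q' x) \<in> O[F](\<lambda>x. B x ^ 2)"
    and odd: "(\<lambda>x. q x - q' x - v x) \<in> O[F](\<lambda>x. B x ^ 3)"
  shows "(\<lambda>x. h x * exp (q x) + h' x * exp (q' x) - 2) \<in> O[F](\<lambda>x. B x ^ 2)"
    and "(\<lambda>x. h x * exp (q x) - h' x * exp (q' x) - (v x + 2 * a * w x)) \<in> O[F](\<lambda>x. B x ^ 3)"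
proof -
  define \<eta> where "\<eta> = (\<lambda>x. h x - (1 + a * w x + c * w x ^ 2))"
  define \<eta>' where "\<eta>' = (\<lambda>x. h' x - (1 - a * w x + c * w x ^ 2))"
  define \<xi> where "\<xi> = (\<lambda>x. exp (q x) - (1 + q x + q x ^ 2 / 2))"
  define \<xi>' where "\<xi>' = (\<lambda>x. exp (q' x) - (1 + q' x + q' x ^ 2 / 2))"
  have B32: "f \<in> O[F](\<lambda>x. B x ^ 2)" if "f \<in> O[F](\<lambda>x. B x ^ 3)" for f
  proof -
    have "(\<lambda>x. B x ^ 2 * B x) \<in> O[F](\<lambda>x. B x ^ 2 * 1)" by (intro landau_o.big.mult landau_o.big_refl B1)
    then have "(\<lambda>x. B x ^ 3) \<in> O[F](\<lambda>x. B x ^ 2)" by (simp add: power3_eq_cube power2_eq_square)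
    with that show ?thesis by (rule landau_o.big_trans)
  qed
  have m12: "(\<lambda>x. f x * g x) \<in> O[F](\<lambda>x. B x ^ 3)" if "f \<in> O[F](B)" "g \<in> O[F](\<lambda>x. B x ^ 2)" for f g
    using landau_o.big.mult[OF that] by (simp add: power3_eq_cube power2_eq_square mult.assoc)
  have m11: "(\<lambda>x. f x * g x) \<in> O[F](\<lambda>x. B x ^ 2)" if "f \<in> O[F](B)" "g \<in> O[F](B)" for f g
    using landau_o.big.mult[OF that] by (simp add: power2_eq_square)
  have m03: "(\<lambda>x. f x * g x) \<in> O[F](\<lambda>x. B x ^ 3)" if "f \<in> O[F](\<lambda>_. 1)" "g \<in> O[F](\<lambda>x. B x ^ 3)" for f g
    using landau_o.big.mult[OF that] by simp
  have m01: "(\<lambda>x. f x * g x) \<in> O[F](B)" if "f \<in> O[F](\<lambda>_. 1)" "g \<in> O[F](B)" for f g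
    using landau_o.big.mult[OF that] by simp
  have b1: "f \<in> O[F](\<lambda>_. 1)" if "f \<in> O[F](B)" for f using that B1 by (rule landau_o.big_trans)
  have b2: "f \<in> O[F](\<lambda>_. 1)" if "f \<in> O[F](\<lambda>x. B x ^ 2)" for f
  proof -
    have "(\<lambda>x. B x * B x) \<in> O[F](\<lambda>x. 1 * 1)" by (intro landau_o.big.mult B1)
    with that show ?thesis by (intro landau_o.big_trans[OF that]) (simp add: power2_eq_square)
  qed
  have b3: "f \<in> O[F](\<lambda>_. 1)" if "f \<in> O[F](\<lambda>x. B x ^ 3)" for f using B32[OF that] by (rule b2)
  have cc: "(\<lambda>_. d) \<in> O[F](\<lambda>_. 1)" for d :: complex by simp
  have w2: "(\<lambda>x. w x ^ 2) \<in> O[F](\<lambda>x. B x ^ 2)" using m11[OF w w] by (simp add: power2_eq_square)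
  have aw: "(\<lambda>x. d * w x) \<in> O[F](B)" for d by (rule m01[OF cc w])
  have cw2: "(\<lambda>x. d * w x ^ 2) \<in> O[F](\<lambda>x. B x ^ 2)" for d
    using landau_o.big.mult[OF cc w2] by simp
  have rem: "(\<lambda>x. (d * w x + c * w x ^ 2) * (p x ^ 2 / 2) + c * w x ^ 2 * p x + (1 + p x + p x ^ 2 / 2) * \<eta> x
      + (1 + d * w x + c * w x ^ 2 + \<eta> x) * \<xi> x) \<in> O[F](\<lambda>x. B x ^ 3)"
    if p: "p \<in> O[F](B)" and \<eta>: "\<eta> \<in> O[F](\<lambda>x. B x ^ 3)" and \<xi>: "\<xi> \<in> O[F](\<lambda>x. B x ^ 3)" for p \<eta> \<xi> d
  proof -
    have p2: "(\<lambda>x. p x ^ 2 / 2) \<in> O[F](\<lambda>x. B x ^ 2)"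
      using landau_o.big.mult[OF cc[of "1/2"] m11[OF p p]] by (simp add: power2_eq_square)
    have "(\<lambda>x. c * w x ^ 2) \<in> O[F](B)"
      using m01[OF b1[OF aw[of c]] w] by (simp add: power2_eq_square mult.assoc)
    then have "(\<lambda>x. d * w x + c * w x ^ 2) \<in> O[F](B)" by (intro sum_in_bigo aw)
    then have 1: "(\<lambda>x. (d * w x + c * w x ^ 2) * (p x ^ 2 / 2)) \<in> O[F](\<lambda>x. B x ^ 3)" by (intro m12 p2)
    have 2: "(\<lambda>x. c * w x ^ 2 * p x) \<in> O[F](\<lambda>x. B x ^ 3)"
      using m12[OF p cw2[of c]] by (simp add: mult.commute)
    have 3: "(\<lambda>x. (1 + p x + p x ^ 2 / 2) * \<eta> x) \<in> O[F](\<lambda>x. B x ^ 3)"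
      by (intro m03 \<eta> sum_in_bigo cc b1[OF p] b2[OF p2])
    have 4: "(\<lambda>x. (1 + d * w x + c * w x ^ 2 + \<eta> x) * \<xi> x) \<in> O[F](\<lambda>x. B x ^ 3)"
      by (intro m03 \<xi> sum_in_bigo cc b1[OF aw] b2[OF cw2] b3[OF \<eta>])
    show ?thesis by (intro sum_in_bigo 1 2 3 4)
  qed
  define R where "R = (\<lambda>x. (a * w x + c * w x ^ 2) * (q x ^ 2 / 2) + c * w x ^ 2 * q x + (1 + q x + q x ^ 2 / 2) * \<eta> x
      + (1 + a * w x + c * w x ^ 2 + \<eta> x) * \<xi> x)"
  define R' where "R' = (\<lambda>x. ((- a) * w x + c * w x ^ 2) * (q' x ^ 2 / 2) + c * w x ^ 2 * q' x + (1 + q' x + q' x ^ 2 / 2) * \<eta>' x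
      + (1 + (- a) * w x + c * w x ^ 2 + \<eta>' x) * \<xi>' x)"
  have R: "R \<in> O[F](\<lambda>x. B x ^ 3)" "R' \<in> O[F](\<lambda>x. B x ^ 3)"
    unfolding R_def R'_def using rem[OF q(1), of \<eta> \<xi> a] rem[OF q(2), of \<eta>' \<xi>' "- a"] h h' e e'
    by (simp_all add: \<eta>_def \<eta>'_def \<xi>_def \<xi>'_def)
  have x1: "h x * exp (q x) = 1 + (a * w x + q x) + (c * w x ^ 2 + a * w x * q x + q x ^ 2 / 2) + R x" for x
  proof -
    have hx: "h x = 1 + a * w x + c * w x ^ 2 + \<eta> x" and ex: "exp (q x) = 1 + q x + q x ^ 2 / 2 + \<xi> x"
      by (simp_all add: \<eta>_def \<xi>_def)
    show ?thesis unfolding hx ex R_def by (simp add: algebra_simps)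
  qed
  have x2: "h' x * exp (q' x) = 1 + (- a * w x + q' x) + (c * w x ^ 2 - a * w x * q' x + q' x ^ 2 / 2) + R' x" for x
  proof -
    have hx: "h' x = 1 - a * w x + c * w x ^ 2 + \<eta>' x" and ex: "exp (q' x) = 1 + q' x + q' x ^ 2 / 2 + \<xi>' x"
      by (simp_all add: \<eta>'_def \<xi>'_def)
    show ?thesis unfolding hx ex R'_def by (simp add: algebra_simps)
  qed
  have qm: "(\<lambda>x. q x - q' x) \<in> O[F](B)" by (intro sum_in_bigo q)
  have q2: "(\<lambda>x. q x ^ 2 / 2) \<in> O[F](\<lambda>x. B x ^ 2)" "(\<lambda>x. q' x ^ 2 / 2) \<in> O[F](\<lambda>x. B x ^ 2)"
    using landau_o.big.mult[OF cc[of "1/2"] m11[OF q(1) q(1)]] landau_o.big.mult[OF cc[of "1/2"] m11[OF q(2) q(2)]]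
    by (simp_all add: power2_eq_square)
  have "(\<lambda>x. (q x + q' x) + (2 * c) * w x ^ 2 + (a * w x) * (q x - q' x) + (q x ^ 2 / 2 + q' x ^ 2 / 2) + (R x + R' x)) \<in> O[F](\<lambda>x. B x ^ 2)"
    by (intro sum_in_bigo even cw2 m11 aw qm q2 B32[OF R(1)] B32[OF R(2)])
  also have "(\<lambda>x. (q x + q' x) + (2 * c) * w x ^ 2 + (a * w x) * (q x - q' x) + (q x ^ 2 / 2 + q' x ^ 2 / 2) + (R x + R' x))
      = (\<lambda>x. h x * exp (q x) + h' x * exp (q' x) - 2)"
    unfolding x1 x2 by (simp add: algebra_simps)
  finally show "(\<lambda>x. h x * exp (q x) + h' x * exp (q' x) - 2) \<in> O[F](\<lambda>x. B x ^ 2)" .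
  \<comment> \<open>q^2 / 2 - q'^2 / 2 factors as (q - q') / 2 times q + q', and the second factor
    is already O(B^2).\<close>
  have qp: "(\<lambda>x. (q x - q' x) / 2) \<in> O[F](B)" using m01[OF cc[of "1/2"] qm] by simp
  have "(\<lambda>x. (q x - q' x - v x) + (a * w x) * (q x + q' x) + ((q x - q' x) / 2) * (q x + q' x) + (R x - R' x)) \<in> O[F](\<lambda>x. B x ^ 3)"
    by (intro sum_in_bigo odd m12 aw qp even R)
  also have "(\<lambda>x. (q x - q' x - v x) + (a * w x) * (q x + q' x) + ((q x - q' x) / 2) * (q x + q' x) + (R x - R' x))
      = (\<lambda>x. h x * exp (q x) - h' x * exp (q' x) - (v x + 2 * a * w x))"
    unfolding x1 x2 by (simp add: algebra_simps power2_eq_square diff_divide_distrib add_divide_distrib)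
  finally show "(\<lambda>x. h x * exp (q x) - h' x * exp (q' x) - (v x + 2 * a * w x)) \<in> O[F](\<lambda>x. B x ^ 3)" .
qed

text \<open>Over a principal filter a Landau symbol is a uniform bound on the set; explicit
  constants enter \<open>parity_expansion\<close> this way and leave it by the converse.\<close>

lemma bigo_principalI: "(\<And>x. x \<in> S \<Longrightarrow> norm (f x) \<le> c * norm (g x)) \<Longrightarrow> f \<in> O[principal S](g)"
  by (intro bigoI[of _ c]) (simp add: eventually_principal)

lemma bigo_principalD: "f \<in> O[principal S](g) \<Longrightarrow> \<exists>c. \<forall>x\<in>S. norm (f x) \<le> c * norm (g x)"
  by (elim landau_o.bigE) (auto simp: eventually_principal)

text \<open>The constant has to be uniform in \<open>L\<close> and \<open>w\<close> jointly, hence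
  the filter lives on pairs. For nonzero w the condition \<open>norm w \<le> L * norm w ^ 3\<close>
  says that L |w|^2 is at least 1, which at |w| = r means k at least 1; it lets spare powers of |w|
  be absorbed into B. The bound \<open>b\<close> controls the exponential.\<close>

lemma tilt_parity:
  assumes H: "H holomorphic_on ball 0 (1/16)" "H 0 = 1"
  obtains C where "C > 0"
    "\<And>L w. L > 0 \<Longrightarrow> norm w \<le> 1/32 \<Longrightarrow> norm w \<le> L * norm w ^ 3 \<Longrightarrow> L * norm w ^ 3 \<le> b \<Longrightarrow>
       norm (tilt H L w + tilt H L (- w) - 2) \<le> C * (L * norm w ^ 3) ^ 2"
    "\<And>L w. L > 0 \<Longrightarrow> norm w \<le> 1/32 \<Longrightarrow> norm w \<le> L * norm w ^ 3 \<Longrightarrow> L * norm w ^ 3 \<le> b \<Longrightarrow>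
       norm (tilt H L w - tilt H L (- w) - (of_real L * w ^ 3 / 3 + 2 * deriv H 0 * w)) \<le> C * (L * norm w ^ 3) ^ 3"
proof -
  obtain C0 c where C0: "\<And>w. norm w \<le> 1/32 \<Longrightarrow> norm (H w - (H 0 + deriv H 0 * w + c * w\<^sup>2)) \<le> C0 * norm w ^ 3"
    by (rule holomorphic_taylor2[OF H(1), of "1/32"]) (simp, simp, blast)
  define S where "S = {(L :: real, w :: complex). L > 0 \<and> norm w \<le> 1/32 \<and> norm w \<le> L * norm w ^ 3 \<and> L * norm w ^ 3 \<le> b}"
  define B where "B = (\<lambda>(L, w). complex_of_real (L * norm (w::complex) ^ 3))"
  define q where "q = (\<lambda>(L, w). complex_of_real L * exp_tail w)"
  define q' where "q' = (\<lambda>(L, w). complex_of_real L * exp_tail (- w))"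
  have nB: "norm (B (L, w)) = L * norm w ^ 3" if "L > 0" for L w using that by (simp add: B_def norm_mult norm_power)
  have bigo: "f \<in> O[principal S](\<lambda>x. B x ^ n)"
    if "\<And>L w. L > 0 \<Longrightarrow> norm w \<le> 1/32 \<Longrightarrow> norm w \<le> L * norm w ^ 3 \<Longrightarrow> L * norm w ^ 3 \<le> b \<Longrightarrow> norm (f (L, w)) \<le> K * (L * norm w ^ 3) ^ n"
    for f n K
    by (rule bigo_principalI[of _ _ K]) (use that nB in \<open>auto simp: S_def norm_power\<close>)
  have bigo1: "f \<in> O[principal S](B)"
    if "\<And>L w. L > 0 \<Longrightarrow> norm w \<le> 1/32 \<Longrightarrow> norm w \<le> L * norm w ^ 3 \<Longrightarrow> L * norm w ^ 3 \<le> b \<Longrightarrow> norm (f (L, w)) \<le> K * (L * norm w ^ 3)"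
    for f K using bigo[of f K 1] that by simp
  have r4: "L * norm w ^ 4 \<le> (L * norm w ^ 3) ^ 2" "L * norm w ^ 5 \<le> (L * norm w ^ 3) ^ 3" "norm w ^ 3 \<le> (L * norm w ^ 3) ^ 3"
    if "L > 0" "norm w \<le> L * norm w ^ 3" for L and w :: complex
  proof -
    define b where "b = L * norm w ^ 3"
    have b: "0 \<le> b" "norm w \<le> b" using that by (auto simp: b_def)
    have "L * norm w ^ 4 = b * norm w" by (simp add: b_def eval_nat_numeral)
    also have "\<dots> \<le> b * b" using b by (intro mult_left_mono) auto
    finally show "L * norm w ^ 4 \<le> (L * norm w ^ 3) ^ 2" by (simp add: b_def power2_eq_square)
    have "L * norm w ^ 5 = b * (norm w * norm w)" by (simp add: b_def eval_nat_numeral)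
    also have "\<dots> \<le> b * (b * b)" using b by (intro mult_left_mono mult_mono) auto
    finally show "L * norm w ^ 5 \<le> (L * norm w ^ 3) ^ 3" by (simp add: b_def power3_eq_cube mult_ac)
    show "norm w ^ 3 \<le> (L * norm w ^ 3) ^ 3" using b by (intro power_mono) (auto simp: b_def)
  qed
  have qb: "norm (of_real L * exp_tail w) \<le> 2 * (L * norm w ^ 3)" if "L > 0" "norm w \<le> 1/32" for L and w :: complex
  proof -
    have "norm (exp_tail w) \<le> norm (exp_tail w - w ^ 3 / 6) + norm (w ^ 3 / 6)"
      by (rule order.trans[OF _ norm_triangle_ineq]) simp
    also have "\<dots> \<le> norm w ^ 4 + norm w ^ 3"
      using that by (intro add_mono exp_tail_taylor3) (auto simp: norm_divide norm_power)
    also have "\<dots> \<le> 2 * norm w ^ 3"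
      using mult_right_le_one_le[of "norm w ^ 3" "norm w"] that by (simp add: eval_nat_numeral mult_ac)
    finally have "L * norm (exp_tail w) \<le> L * (2 * norm w ^ 3)" using that by (intro mult_left_mono) auto
    then show ?thesis using that by (simp add: norm_mult)
  qed
  have eb: "norm (exp z - (1 + z + z ^ 2 / 2)) \<le> 4 * exp (2 * b) * B ^ 3" if "norm z \<le> 2 * B" "B \<le> b" for z :: complex and B
  proof -
    have B0: "B \<ge> 0" using that norm_ge_zero[of z] by linarith
    have "norm (exp z - (\<Sum>k\<le>2. z ^ k / fact k)) \<le> exp \<bar>Re z\<bar> * norm z ^ Suc 2 / fact 2"
      by (rule Taylor_exp)
    also have "(\<Sum>k\<le>2. z ^ k / fact k) = 1 + z + z ^ 2 / 2" by (simp add: eval_nat_numeral)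
    also have "exp \<bar>Re z\<bar> * norm z ^ Suc 2 / fact 2 \<le> exp (2 * b) * (2 * B) ^ Suc 2 / fact 2"
    proof (intro divide_right_mono mult_mono power_mono)
      show "exp \<bar>Re z\<bar> \<le> exp (2 * b)" using that abs_Re_le_cmod[of z] by simp
    qed (use that B0 in auto)
    finally show ?thesis by (simp add: power_mult_distrib eval_nat_numeral mult_ac)
  qed
  note exp2 = parity_expansion[of B "principal S" "\<lambda>(L, w). w" q q' "\<lambda>(L, w). H w" "deriv H 0" c "\<lambda>(L, w). H (- w)" "\<lambda>(L, w). of_real L * w ^ 3 / 3"]
  have A: "B \<in> O[principal S](\<lambda>_. 1)"
    by (rule bigo_principalI[of _ _ b]) (auto simp: S_def nB)
  have P: "(\<lambda>(L, w). w) \<in> O[principal S](B)" by (rule bigo1[of _ 1]) auto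
  have Q: "q \<in> O[principal S](B)" "q' \<in> O[principal S](B)"
    using qb qb[of _ "- w" for w] by (auto intro!: bigo1[of _ 2] simp: q_def q'_def)
  have Hh: "(\<lambda>x. (case x of (L, w) \<Rightarrow> H w) - (1 + deriv H 0 * (case x of (L, w) \<Rightarrow> w) + c * (case x of (L, w) \<Rightarrow> w) ^ 2)) \<in> O[principal S](\<lambda>x. B x ^ 3)"
  proof (rule bigo[of _ "\<bar>C0\<bar>"])
    fix L and w :: complex assume *: "L > 0" "norm w \<le> 1/32" "norm w \<le> L * norm w ^ 3" "L * norm w ^ 3 \<le> b"
    have "norm (H w - (1 + deriv H 0 * w + c * w\<^sup>2)) \<le> C0 * norm w ^ 3" using C0[OF *(2)] H by simp
    also have "\<dots> \<le> \<bar>C0\<bar> * (L * norm w ^ 3) ^ 3" using r4(3)[OF *(1,3)] by (intro mult_mono) auto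
    finally show "norm ((case (L, w) of (L, w) \<Rightarrow> H w) - (1 + deriv H 0 * (case (L, w) of (L, w) \<Rightarrow> w) + c * (case (L, w) of (L, w) \<Rightarrow> w) ^ 2)) \<le> \<bar>C0\<bar> * (L * norm w ^ 3) ^ 3" by simp
  qed
  have Hh': "(\<lambda>x. (case x of (L, w) \<Rightarrow> H (- w)) - (1 - deriv H 0 * (case x of (L, w) \<Rightarrow> w) + c * (case x of (L, w) \<Rightarrow> w) ^ 2)) \<in> O[principal S](\<lambda>x. B x ^ 3)"
  proof (rule bigo[of _ "\<bar>C0\<bar>"])
    fix L and w :: complex assume *: "L > 0" "norm w \<le> 1/32" "norm w \<le> L * norm w ^ 3" "L * norm w ^ 3 \<le> b"
    have "norm (H (- w) - (1 - deriv H 0 * w + c * w\<^sup>2)) \<le> C0 * norm w ^ 3" using C0[of "- w"] *(2) H by simp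
    also have "\<dots> \<le> \<bar>C0\<bar> * (L * norm w ^ 3) ^ 3" using r4(3)[OF *(1,3)] by (intro mult_mono) auto
    finally show "norm ((case (L, w) of (L, w) \<Rightarrow> H (- w)) - (1 - deriv H 0 * (case (L, w) of (L, w) \<Rightarrow> w) + c * (case (L, w) of (L, w) \<Rightarrow> w) ^ 2)) \<le> \<bar>C0\<bar> * (L * norm w ^ 3) ^ 3" by simp
  qed
  have E: "(\<lambda>x. exp (q x) - (1 + q x + q x ^ 2 / 2)) \<in> O[principal S](\<lambda>x. B x ^ 3)"
    using eb qb by (intro bigo[of _ "4 * exp (2 * b)"]) (simp add: q_def)
  have E': "(\<lambda>x. exp (q' x) - (1 + q' x + q' x ^ 2 / 2)) \<in> O[principal S](\<lambda>x. B x ^ 3)"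
    using eb qb[of _ "- w" for w] by (intro bigo[of _ "4 * exp (2 * b)"]) (simp add: q'_def)
  have Ev: "(\<lambda>x. q x + q' x) \<in> O[principal S](\<lambda>x. B x ^ 2)"
  proof (rule bigo[of _ 2])
    fix L and w :: complex assume *: "L > 0" "norm w \<le> 1/32" "norm w \<le> L * norm w ^ 3" "L * norm w ^ 3 \<le> b"
    have "q (L, w) + q' (L, w) = of_real L * (exp_tail w + exp_tail (- w))" by (simp add: q_def q'_def algebra_simps)
    also have "norm \<dots> \<le> L * (2 * norm w ^ 4)"
      using *(1,2) exp_tail_even[of w] by (simp add: norm_mult)
    also have "\<dots> \<le> 2 * (L * norm w ^ 3) ^ 2" using r4(1)[OF *(1,3)] by simp
    finally show "norm (q (L, w) + q' (L, w)) \<le> 2 * (L * norm w ^ 3) ^ 2" .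
  qed
  have Od: "(\<lambda>x. q x - q' x - (case x of (L, w) \<Rightarrow> of_real L * w ^ 3 / 3)) \<in> O[principal S](\<lambda>x. B x ^ 3)"
  proof (rule bigo[of _ 2])
    fix L and w :: complex assume *: "L > 0" "norm w \<le> 1/32" "norm w \<le> L * norm w ^ 3" "L * norm w ^ 3 \<le> b"
    have "q (L, w) - q' (L, w) - (case (L, w) of (L, w) \<Rightarrow> of_real L * w ^ 3 / 3) = of_real L * (exp_tail w - exp_tail (- w) - w ^ 3 / 3)" by (simp add: q_def q'_def algebra_simps)
    also have "norm \<dots> \<le> L * (2 * norm w ^ 5)"
      using *(1,2) exp_tail_odd[of w] by (simp add: norm_mult)
    also have "\<dots> \<le> 2 * (L * norm w ^ 3) ^ 3" using r4(2)[OF *(1,3)] by simp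
    finally show "norm (q (L, w) - q' (L, w) - (case (L, w) of (L, w) \<Rightarrow> of_real L * w ^ 3 / 3)) \<le> 2 * (L * norm w ^ 3) ^ 3" .
  qed
  obtain C1 where C1: "\<And>x. x \<in> S \<Longrightarrow> norm ((case x of (L, w) \<Rightarrow> H w) * exp (q x) + (case x of (L, w) \<Rightarrow> H (- w)) * exp (q' x) - 2) \<le> C1 * norm (B x ^ 2)"
    using bigo_principalD[OF exp2(1)[OF A P Q Hh Hh' E E' Ev Od]] by blast
  obtain C2 where C2: "\<And>x. x \<in> S \<Longrightarrow> norm ((case x of (L, w) \<Rightarrow> H w) * exp (q x) - (case x of (L, w) \<Rightarrow> H (- w)) * exp (q' x) - ((case x of (L, w) \<Rightarrow> of_real L * w ^ 3 / 3) + 2 * deriv H 0 * (case x of (L, w) \<Rightarrow> w))) \<le> C2 * norm (B x ^ 3)"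
    using bigo_principalD[OF exp2(2)[OF A P Q Hh Hh' E E' Ev Od]] by blast
  show ?thesis
  proof (rule that[of "max 1 (max C1 C2)"])
    fix L :: real and w :: complex
    assume *: "L > 0" "norm w \<le> 1/32" "norm w \<le> L * norm w ^ 3" "L * norm w ^ 3 \<le> b"
    then have S: "(L, w) \<in> S" by (simp add: S_def)
    have "norm (tilt H L w + tilt H L (- w) - 2) \<le> C1 * (L * norm w ^ 3) ^ 2"
      using C1[OF S] *(1) by (simp add: tilt_eq q_def q'_def norm_power nB)
    also have "\<dots> \<le> max 1 (max C1 C2) * (L * norm w ^ 3) ^ 2" by (intro mult_right_mono) auto
    finally show "norm (tilt H L w + tilt H L (- w) - 2) \<le> max 1 (max C1 C2) * (L * norm w ^ 3) ^ 2" .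
    have "norm (tilt H L w - tilt H L (- w) - (of_real L * w ^ 3 / 3 + 2 * deriv H 0 * w)) \<le> C2 * (L * norm w ^ 3) ^ 3"
      using C2[OF S] *(1) by (simp add: tilt_eq q_def q'_def norm_power nB)
    also have "\<dots> \<le> max 1 (max C1 C2) * (L * norm w ^ 3) ^ 3" using *(1) by (intro mult_right_mono) auto
    finally show "norm (tilt H L w - tilt H L (- w) - (of_real L * w ^ 3 / 3 + 2 * deriv H 0 * w)) \<le> max 1 (max C1 C2) * (L * norm w ^ 3) ^ 3" .
  qed simp
qed

section \<open>Moments of large order\<close>

lemma norm_cis_minus_one_le: "norm (cis t - 1) \<le> \<bar>t\<bar>"
proof -
  have "norm (exp (\<i> * of_real t) - (\<Sum>k\<le>0. (\<i> * of_real t) ^ k / fact k)) \<le> exp \<bar>Re (\<i> * of_real t)\<bar> * norm (\<i> * of_real t) ^ Suc 0 / fact 0"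
    by (rule Taylor_exp)
  then show ?thesis by (simp add: cis_conv_exp norm_mult)
qed

lemma ln_ln_at_top: "filterlim (\<lambda>x::real. ln (ln x)) at_top at_top"
  by real_asymp

text \<open>Moving from s to s * cis (t / sqrt \<kappa>) changes L * exp_tail by at most 2 |t| L r^3
  / sqrt \<kappa> = 2 |t| \<kappa> / sqrt L. This is where \<kappa> = o(sqrt L) enters.\<close>

lemma tilt_saddle_limit:
  fixes \<kappa> :: "real \<Rightarrow> nat" and L :: "real \<Rightarrow> real"
  assumes H: "isCont H 0" "H 0 = 1"
    and L: "filterlim L at_top at_top" and \<kappa>: "filterlim (\<lambda>x. real (\<kappa> x)) at_top at_top"
    and small: "((\<lambda>x. real (\<kappa> x) / sqrt (L x)) \<longlongrightarrow> 0) at_top"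
    and r0: "((\<lambda>x. sqrt (real (\<kappa> x) / L x)) \<longlongrightarrow> 0) at_top"
    and s: "norm (s :: complex) = 1"
  shows "((\<lambda>x. H (of_real (sqrt (real (\<kappa> x) / L x)) * (s * cis (t / sqrt (real (\<kappa> x))))) *
      exp (of_real (L x) * (exp_tail (of_real (sqrt (real (\<kappa> x) / L x)) * (s * cis (t / sqrt (real (\<kappa> x))))) - exp_tail (of_real (sqrt (real (\<kappa> x) / L x)) * s)))) \<longlongrightarrow> 1) at_top"
proof -
  define r where "r = (\<lambda>x. sqrt (real (\<kappa> x) / L x))"
  define z where "z = (\<lambda>x. s * cis (t / sqrt (real (\<kappa> x))))"
  have nz: "norm (z x) = 1" for x using s by (simp add: z_def norm_mult)
  have r0': "(r \<longlongrightarrow> 0) at_top" using r0 by (simp add: r_def)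
  have "((\<lambda>x. of_real (r x) * z x) \<longlongrightarrow> 0) at_top"
  proof (rule Lim_null_comparison)
    show "eventually (\<lambda>x. norm (of_real (r x) * z x) \<le> \<bar>r x\<bar>) at_top" by (simp add: norm_mult nz)
    show "((\<lambda>x. \<bar>r x\<bar>) \<longlongrightarrow> 0) at_top" using tendsto_rabs_zero[OF r0'] .
  qed
  then have h: "((\<lambda>x. H (of_real (r x) * z x)) \<longlongrightarrow> 1) at_top"
    using isCont_tendsto_compose[OF H(1)] H(2) by simp
  have e: "((\<lambda>x. of_real (L x) * (exp_tail (of_real (r x) * z x) - exp_tail (of_real (r x) * s))) \<longlongrightarrow> 0) at_top"
  proof (rule Lim_null_comparison)
    have "eventually (\<lambda>x. r x < 1/2) at_top" using order_tendstoD(2)[OF r0', of "1/2"] by simp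
    moreover have "eventually (\<lambda>x. L x > 0) at_top" using filterlim_at_top_dense[THEN iffD1, OF L] by blast
    moreover have "eventually (\<lambda>x. real (\<kappa> x) > 0) at_top" using filterlim_at_top_dense[THEN iffD1, OF \<kappa>] by blast
    ultimately show "eventually (\<lambda>x. norm (of_real (L x) * (exp_tail (of_real (r x) * z x) - exp_tail (of_real (r x) * s))) \<le> 2 * \<bar>t\<bar> * (real (\<kappa> x) / sqrt (L x))) at_top"
    proof eventually_elim
      case (elim x)
      have rn: "r x \<ge> 0" using elim by (simp add: r_def)
      have "norm (z x - s) = norm (cis (t / sqrt (real (\<kappa> x))) - 1)"
        using s norm_mult[of s "cis (t / sqrt (real (\<kappa> x))) - 1"] by (simp add: z_def right_diff_distrib)
      also have "\<dots> \<le> \<bar>t\<bar> / sqrt (real (\<kappa> x))" using norm_cis_minus_one_le[of "t / sqrt (real (\<kappa> x))"] by simp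
      finally have zs: "norm (z x - s) \<le> \<bar>t\<bar> / sqrt (real (\<kappa> x))" .
      have "norm (of_real (L x) * (exp_tail (of_real (r x) * z x) - exp_tail (of_real (r x) * s))) = L x * norm (exp_tail (of_real (r x) * z x) - exp_tail (of_real (r x) * s))"
        using elim by (simp add: norm_mult)
      also have "\<dots> \<le> L x * (2 * r x ^ 3 * norm (z x - s))"
        using elim rn nz s by (intro mult_left_mono exp_tail_circle) auto
      also have "\<dots> \<le> L x * (2 * r x ^ 3 * (\<bar>t\<bar> / sqrt (real (\<kappa> x))))"
        using elim rn zs by (intro mult_left_mono) auto
      also have "\<dots> = 2 * \<bar>t\<bar> * (L x * r x ^ 3 / sqrt (real (\<kappa> x)))" by simp
      also have "L x * r x ^ 3 / sqrt (real (\<kappa> x)) = real (\<kappa> x) / sqrt (L x)"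
      proof -
        have "L x * r x ^ 2 = real (\<kappa> x)" using elim by (simp add: r_def)
        then have "L x * r x ^ 3 = real (\<kappa> x) * r x" by (simp add: power3_eq_cube power2_eq_square mult.assoc[symmetric])
        also have "\<dots> = real (\<kappa> x) * (sqrt (real (\<kappa> x)) / sqrt (L x))" by (simp add: r_def real_sqrt_divide)
        finally show ?thesis using elim by simp
      qed
      finally show ?case .
    qed
    show "((\<lambda>x. 2 * \<bar>t\<bar> * (real (\<kappa> x) / sqrt (L x))) \<longlongrightarrow> 0) at_top"
      using tendsto_mult[OF tendsto_const[of "2 * \<bar>t\<bar>"] small] by simp
  qed
  from tendsto_mult[OF h tendsto_exp[OF e]] show ?thesis by (simp add: r_def z_def)
qed

text \<open>After division by the size exp (L * exp_tail r) at the saddle point r, the two saddle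
  points contribute 1 and (-1)^\<kappa> exp (L (exp_tail (-r) - exp_tail r)). A convenient bounded
  \<open>l\<close> stands for their sum. The factor 1/2 is the quotient of 1 / (2 sqrt \<pi>) by the
  limit 1 / sqrt \<pi> belonging to \<open>gamma_moment\<close>.\<close>

lemma omega_moment_ratio:
  fixes \<kappa> :: "real \<Rightarrow> nat" and l :: "real \<Rightarrow> real"
  defines "L \<equiv> \<lambda>x. ln (ln x)"
  defines "r \<equiv> \<lambda>x. sqrt (real (\<kappa> x) / L x)"
  assumes \<kappa>: "filterlim (\<lambda>x. real (\<kappa> x)) at_top at_top"
    and small: "((\<lambda>x. real (\<kappa> x) / sqrt (L x)) \<longlongrightarrow> 0) at_top"
    and l: "\<And>x. \<bar>l x\<bar> \<le> 2"
    and lim: "((\<lambda>x. 1 + (-1) ^ \<kappa> x * exp (L x * (exp_tail (- r x) - exp_tail (r x))) - l x) \<longlongrightarrow> 0) at_top"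
  shows "((\<lambda>x. omega_moment x (\<kappa> x) / gamma_moment (\<kappa> x) * exp (- (L x * exp_tail (r x))) - l x / 2) \<longlongrightarrow> 0) at_top"
proof -
  let ?w = "\<lambda>x. sqrt (real (\<kappa> x)) * exp (- real (\<kappa> x) / 2)"
  obtain H :: "complex \<Rightarrow> complex" and K :: real
    where K: "K > 0" and H: "H holomorphic_on ball 0 (1/16)" "H 0 = 1" "deriv H 0 = of_real mertens_const"
    and saddle: "\<And>x k L. x \<ge> 3 \<Longrightarrow> k > 0 \<Longrightarrow> L = ln (ln x) \<Longrightarrow> sqrt (real k / L) < 1/16 \<Longrightarrow>
      norm (of_real (omega_moment x k * sqrt k ^ k / fact k) - gauss_coeff k (\<lambda>z. tilt H L (of_real (sqrt (real k / L)) * z))) \<le> K * exp (- L / 4)"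
    by (rule omega_moment_saddle) blast
  have Lt: "filterlim L at_top at_top" unfolding L_def by (rule ln_ln_at_top)
  have evL: "eventually (\<lambda>x. L x \<ge> 1) at_top" using Lt by (simp add: filterlim_at_top)
  have ev\<kappa>: "eventually (\<lambda>x. real (\<kappa> x) > 0) at_top" using filterlim_at_top_dense[THEN iffD1, OF \<kappa>] by blast
  have r0: "(r \<longlongrightarrow> 0) at_top"
  proof -
    have "((\<lambda>x. sqrt (real (\<kappa> x) / sqrt (L x))) \<longlongrightarrow> sqrt 0) at_top" by (intro tendsto_real_sqrt small)
    then have "((\<lambda>x. sqrt (real (\<kappa> x) / sqrt (L x))) \<longlongrightarrow> 0) at_top" by simp
    then show ?thesis
    proof (rule Lim_null_comparison[rotated])
      show "eventually (\<lambda>x. norm (r x) \<le> sqrt (real (\<kappa> x) / sqrt (L x))) at_top"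
        using evL
      proof eventually_elim
        case (elim x)
        have "sqrt (L x) \<le> L x" using elim real_sqrt_le_mono[of 1 "L x"] real_sqrt_mult_self[of "L x"]
          mult_left_mono[of 1 "sqrt (L x)" "sqrt (L x)"] by simp
        then have "real (\<kappa> x) / L x \<le> real (\<kappa> x) / sqrt (L x)" using elim by (intro divide_left_mono) auto
        then show ?case using elim by (simp add: r_def)
      qed
    qed
  qed
  have evr: "eventually (\<lambda>x. r x < 1/32) at_top" using order_tendstoD(2)[OF r0, of "1/32"] by simp
  define f where "f = (\<lambda>x z. of_real (exp (- (L x * exp_tail (r x)))) * tilt H (L x) (of_real (r x) * z))"
  have "compact (H ` cball 0 (1/32))"
    by (intro compact_continuous_image continuous_on_subset[OF holomorphic_on_imp_continuous_on[OF H(1)]]) auto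
  then have "bounded (H ` cball 0 (1/32))" by (rule compact_imp_bounded)
  then obtain BH where BH: "\<And>w. norm w \<le> 1/32 \<Longrightarrow> norm (H w) \<le> BH" unfolding bounded_iff by fastforce
  have e0: "exp (of_real a) * exp b = exp (b - of_real (- a))" for a and b :: complex
    by (simp add: exp_add[symmetric] add.commute)
  have fe: "f x z = H (of_real (r x) * z) * exp (of_real (L x) * exp_tail (of_real (r x) * z) - of_real (L x * exp_tail (r x)))" for x z
    using e0[of "- (L x * exp_tail (r x))"] by (simp add: f_def tilt_eq exp_of_real[symmetric])
  have g: "((\<lambda>x. of_real (?w x) * gauss_coeff (\<kappa> x) (f x) - of_real (l x) * of_real (1 / (2 * sqrt pi))) \<longlongrightarrow> 0) at_top"
  proof (rule gauss_coeff_asymp[OF \<kappa>])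
    show "eventually (\<lambda>x. continuous_on (sphere 0 1) (f x)) at_top"
      using evr evL
    proof eventually_elim
      case (elim x)
      have rn: "0 \<le> r x" using elim by (simp add: r_def)
      have "continuous_on (sphere 0 1) (\<lambda>z. H (of_real (r x) * z))"
        by (rule continuous_on_compose2[OF holomorphic_on_imp_continuous_on[OF H(1)]])
          (use elim rn in \<open>auto intro!: continuous_intros simp: norm_mult\<close>)
      then show ?case unfolding f_def tilt_def by (intro continuous_intros) auto
    qed
    show "eventually (\<lambda>x. \<forall>z\<in>sphere 0 1. norm (f x z) \<le> BH) at_top"
      using evr evL
    proof eventually_elim
      case (elim x)
      have rn: "0 \<le> r x" using elim by (simp add: r_def)
      show ?case
      proof
        fix z :: complex assume z: "z \<in> sphere 0 1"
        have nw: "norm (of_real (r x) * z) = r x" using z rn by (simp add: norm_mult)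
        have hb: "norm (H (of_real (r x) * z)) \<le> BH" using BH[of "of_real (r x) * z"] nw elim by simp
        have "Re (of_real (L x) * exp_tail (of_real (r x) * z)) = L x * Re (exp_tail (of_real (r x) * z))" by simp
        also have "\<dots> \<le> L x * exp_tail (r x)"
          using complex_Re_le_cmod[of "exp_tail (of_real (r x) * z)"] norm_exp_tail_le[of "of_real (r x) * z"] nw elim
          by (intro mult_left_mono) auto
        finally have "exp (Re (of_real (L x) * exp_tail (of_real (r x) * z)) - L x * exp_tail (r x)) \<le> 1" by simp
        then have "norm (H (of_real (r x) * z)) * exp (Re (of_real (L x) * exp_tail (of_real (r x) * z)) - L x * exp_tail (r x)) \<le> BH * 1"
          using hb by (intro mult_mono order.trans[OF norm_ge_zero hb]) auto
        then show "norm (f x z) \<le> BH" unfolding fe by (simp add: norm_mult norm_exp_eq_Re)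
      qed
    qed
    show "norm (complex_of_real (l x)) \<le> 2" for x using l by simp
    fix t :: real
    define u where "u = (\<lambda>s x. H (of_real (r x) * (s * cis (t / sqrt (real (\<kappa> x))))) *
      exp (of_real (L x) * (exp_tail (of_real (r x) * (s * cis (t / sqrt (real (\<kappa> x))))) - exp_tail (of_real (r x) * s))))"
    have Hc: "isCont H 0" using H(1) by (metis centre_in_ball continuous_on_eq_continuous_at divide_pos_pos holomorphic_on_imp_continuous_on open_ball zero_less_numeral zero_less_one)
    have u: "(u s \<longlongrightarrow> 1) at_top" if "norm s = 1" for s
      using tilt_saddle_limit[OF Hc H(2) Lt \<kappa> small r0[unfolded r_def] that, of t] unfolding u_def r_def .
    define E where "E = (\<lambda>x. exp (L x * (exp_tail (- r x) - exp_tail (r x))))"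
    have u1: "f x (cis (t / sqrt (real (\<kappa> x)))) = u 1 x" for x
      unfolding fe u_def by (simp add: exp_tail_of_real algebra_simps)
    have u2: "f x (- cis (t / sqrt (real (\<kappa> x)))) = of_real (E x) * u (-1) x" for x
    proof -
      have m: "of_real (r x) * (-1) = complex_of_real (- r x)" by simp
      have "complex_of_real (E x) = exp (of_real (L x) * (exp_tail (of_real (r x) * (-1)) - of_real (exp_tail (r x))))"
        unfolding m exp_tail_of_real E_def exp_of_real[symmetric] by simp
      then show ?thesis unfolding fe u_def by (simp add: exp_add[symmetric] algebra_simps)
    qed
    have Eb: "eventually (\<lambda>x. norm (complex_of_real ((-1) ^ \<kappa> x * E x)) \<le> 1) at_top"
      using evL evr
    proof eventually_elim
      case (elim x)
      have rn: "0 \<le> r x" using elim by (simp add: r_def)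
      have "exp_tail (- r x) \<le> 0" using exp_tail_real_bounds(2)[of "r x"] rn elim by simp
      then have "exp_tail (- r x) - exp_tail (r x) \<le> 0" using exp_tail_nonneg[OF rn] by linarith
      then have "L x * (exp_tail (- r x) - exp_tail (r x)) \<le> 0" using elim by (intro mult_nonneg_nonpos) auto
      then show ?case by (simp add: E_def norm_mult norm_power)
    qed
    \<comment> \<open>The coefficient of the second saddle point need not converge, but it is
      eventually bounded by 1, so the local limit 1 can be inserted for
      \<open>u (-1)\<close>.\<close>
    have "((\<lambda>x. of_real ((-1) ^ \<kappa> x * E x) * (u (-1) x - 1)) \<longlongrightarrow> 0) at_top"
    proof (rule Lim_null_comparison)
      show "eventually (\<lambda>x. norm (of_real ((-1) ^ \<kappa> x * E x) * (u (-1) x - 1)) \<le> norm (u (-1) x - 1)) at_top"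
        using Eb
      proof eventually_elim
        case (elim x)
        show ?case unfolding norm_mult[of "of_real ((-1) ^ \<kappa> x * E x)"] using elim mult_right_mono[OF elim norm_ge_zero[of "u (-1) x - 1"]] by simp
      qed
      show "((\<lambda>x. norm (u (-1) x - 1)) \<longlongrightarrow> 0) at_top"
        using u[of "-1"] tendsto_norm_zero[OF LIM_zero] by simp
    qed
    moreover have "((\<lambda>x. u 1 x - 1) \<longlongrightarrow> 0) at_top" using LIM_zero[OF u[of 1]] by simp
    moreover have "((\<lambda>x. complex_of_real (1 + (-1) ^ \<kappa> x * E x - l x)) \<longlongrightarrow> of_real 0) at_top"
      using lim unfolding E_def by (intro tendsto_of_real)
    ultimately have "((\<lambda>x. (u 1 x - 1) + of_real ((-1) ^ \<kappa> x * E x) * (u (-1) x - 1) + of_real (1 + (-1) ^ \<kappa> x * E x - l x)) \<longlongrightarrow> 0 + 0 + of_real 0) at_top"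
      by (intro tendsto_add)
    then show "((\<lambda>x. f x (cis (t / sqrt (real (\<kappa> x)))) + (-1) ^ \<kappa> x * f x (- cis (t / sqrt (real (\<kappa> x)))) - of_real (l x)) \<longlongrightarrow> 0) at_top"
      unfolding u1 u2 by (simp add: algebra_simps)
  qed
  define n where "n = (\<lambda>k. sqrt (real k) ^ k / fact k * (sqrt (real k) * exp (- real k / 2)))"
  define X where "X = (\<lambda>x. omega_moment x (\<kappa> x) * n (\<kappa> x) * exp (- (L x * exp_tail (r x))))"
  have err: "((\<lambda>x. of_real (X x) - of_real (?w x) * gauss_coeff (\<kappa> x) (f x)) \<longlongrightarrow> 0) at_top"
  proof (rule Lim_null_comparison)
    show "eventually (\<lambda>x. norm (of_real (X x) - of_real (?w x) * gauss_coeff (\<kappa> x) (f x)) \<le> K * exp (- L x / 4)) at_top"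
      using evL evr ev\<kappa> eventually_ge_at_top[of 3]
    proof eventually_elim
      case (elim x)
      have rn: "0 \<le> r x" using elim by (simp add: r_def)
      \<comment> \<open>Since sqrt k is at most exp (k/2), the scaling that normalises the main term
        has modulus at most 1 and does not enlarge the model error.\<close>
      define c where "c = ?w x * exp (- (L x * exp_tail (r x)))"
      have c: "0 \<le> c" "c \<le> 1"
      proof -
        have "real (\<kappa> x) \<le> exp (real (\<kappa> x))" using exp_ge_add_one_self[of "real (\<kappa> x)"] by linarith
        then have "sqrt (real (\<kappa> x)) \<le> sqrt (exp (real (\<kappa> x) / 2) ^ 2)" by (simp add: exp_double[symmetric])
        then have "sqrt (real (\<kappa> x)) \<le> exp (real (\<kappa> x) / 2)" by simp
        then have "?w x \<le> exp (real (\<kappa> x) / 2) * exp (- real (\<kappa> x) / 2)" by (intro mult_right_mono) auto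
        also have "\<dots> = 1" by (simp add: exp_add[symmetric])
        finally have "?w x \<le> 1" .
        moreover have "exp (- (L x * exp_tail (r x))) \<le> 1" using exp_tail_nonneg[OF rn] elim by simp
        ultimately have "c \<le> 1 * 1" unfolding c_def by (rule mult_mono) auto
        then show "c \<le> 1" by simp
      qed (simp add: c_def)
      have "norm (of_real (omega_moment x (\<kappa> x) * sqrt (\<kappa> x) ^ \<kappa> x / fact (\<kappa> x)) - gauss_coeff (\<kappa> x) (\<lambda>z. tilt H (L x) (of_real (r x) * z))) \<le> K * exp (- L x / 4)"
        using saddle[of x "\<kappa> x" "L x"] elim by (simp add: r_def L_def)
      then have "c * norm (of_real (omega_moment x (\<kappa> x) * sqrt (\<kappa> x) ^ \<kappa> x / fact (\<kappa> x)) - gauss_coeff (\<kappa> x) (\<lambda>z. tilt H (L x) (of_real (r x) * z))) \<le> 1 * (K * exp (- L x / 4))"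
        using c by (intro mult_mono) auto
      moreover have "of_real (X x) - of_real (?w x) * gauss_coeff (\<kappa> x) (f x)
         = of_real c * (of_real (omega_moment x (\<kappa> x) * sqrt (\<kappa> x) ^ \<kappa> x / fact (\<kappa> x)) - gauss_coeff (\<kappa> x) (\<lambda>z. tilt H (L x) (of_real (r x) * z)))"
        unfolding f_def gauss_coeff_cmult X_def n_def c_def by (simp add: algebra_simps)
      ultimately show ?case using c by (simp add: norm_mult)
    qed
    have "((\<lambda>y::real. K * exp (- y / 4)) \<longlongrightarrow> 0) at_top" by real_asymp
    from filterlim_compose[OF this Lt] show "((\<lambda>x. K * exp (- L x / 4)) \<longlongrightarrow> 0) at_top" .
  qed
  have "((\<lambda>x. of_real (X x - l x * (1 / (2 * sqrt pi)))) \<longlongrightarrow> (0 :: complex)) at_top"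
    using tendsto_add[OF err g] by (simp add: algebra_simps)
  from tendsto_Re[OF this] have Xl: "((\<lambda>x. X x - l x * (1 / (2 * sqrt pi))) \<longlongrightarrow> 0) at_top"
    by (simp only: Re_complex_of_real zero_complex.sel)
  have \<kappa>s: "filterlim \<kappa> sequentially at_top" using \<kappa> by (simp add: filterlim_sequentially_iff_filterlim_real)
  define gm where "gm = (\<lambda>x. gamma_moment (\<kappa> x) * n (\<kappa> x))"
  have "((\<lambda>x. gamma_moment (\<kappa> x) * sqrt (\<kappa> x) ^ (\<kappa> x) / fact (\<kappa> x) * (sqrt (\<kappa> x) * exp (- real (\<kappa> x) / 2))) \<longlongrightarrow> 1 / sqrt pi) at_top"
    by (rule filterlim_compose[OF gamma_moment_asymp \<kappa>s])
  then have gm: "(gm \<longlongrightarrow> 1 / sqrt pi) at_top" by (simp add: gm_def n_def mult.assoc)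
  have "((\<lambda>x. (X x - l x * (1 / (2 * sqrt pi))) / gm x) \<longlongrightarrow> 0 / (1 / sqrt pi)) at_top"
    by (intro tendsto_divide Xl gm) simp
  moreover have "((\<lambda>x. l x * (1 / (2 * sqrt pi) / gm x - 1 / 2)) \<longlongrightarrow> 0) at_top"
  proof (rule Lim_null_comparison)
    show "eventually (\<lambda>x. norm (l x * (1 / (2 * sqrt pi) / gm x - 1 / 2)) \<le> 2 * \<bar>1 / (2 * sqrt pi) / gm x - 1 / 2\<bar>) at_top"
      using l by (intro always_eventually allI) (simp add: abs_mult mult_right_mono)
    have "((\<lambda>x. 2 * \<bar>1 / (2 * sqrt pi) / gm x - 1 / 2\<bar>) \<longlongrightarrow> 2 * \<bar>1 / (2 * sqrt pi) / (1 / sqrt pi) - 1 / 2\<bar>) at_top"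
      by (intro tendsto_intros gm) simp
    then show "((\<lambda>x. 2 * \<bar>1 / (2 * sqrt pi) / gm x - 1 / 2\<bar>) \<longlongrightarrow> 0) at_top" by simp
  qed
  ultimately have "((\<lambda>x. (X x - l x * (1 / (2 * sqrt pi))) / gm x + l x * (1 / (2 * sqrt pi) / gm x - 1 / 2)) \<longlongrightarrow> 0 / (1 / sqrt pi) + 0) at_top"
    by (rule tendsto_add)
  also have "(\<lambda>x. (X x - l x * (1 / (2 * sqrt pi))) / gm x + l x * (1 / (2 * sqrt pi) / gm x - 1 / 2)) = (\<lambda>x. X x / gm x - l x / 2)"
    by (simp add: diff_divide_distrib right_diff_distrib)
  finally have "((\<lambda>x. X x / gm x - l x / 2) \<longlongrightarrow> 0) at_top" by simp
  moreover have "eventually (\<lambda>x. X x / gm x - l x / 2 = omega_moment x (\<kappa> x) / gamma_moment (\<kappa> x) * exp (- (L x * exp_tail (r x))) - l x / 2) at_top"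
    using ev\<kappa>
  proof eventually_elim
    case (elim x)
    then have "n (\<kappa> x) \<noteq> 0" by (simp add: n_def)
    then show ?case by (simp add: X_def gm_def)
  qed
  ultimately show ?thesis by (rule Lim_transform_eventually)
qed

text \<open>L r^3 is the parameter that separates the regimes; this expresses it through k and L as
  in the theorem.\<close>

lemma scale_cube:
  fixes L :: real
  assumes "L > 0"
  shows "L * sqrt (real k / L) ^ 3 = real k powr (3/2) / L powr (1/2)"
proof -
  have "real k powr (3/2) = sqrt (real k) ^ 3"
  proof (cases "k = 0")
    case False
    then have "sqrt (real k) ^ 3 = (real k powr (1/2)) powr real 3"
      by (subst powr_realpow) (simp_all add: powr_half_sqrt)
    then show ?thesis by (simp add: powr_powr)
  qed simp
  moreover have "L powr (1/2) = sqrt L" using assms by (simp add: powr_half_sqrt)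
  moreover have "L * sqrt (real k / L) ^ 3 = sqrt (real k) ^ 3 / sqrt L"
  proof -
    have "L = sqrt L * sqrt L" using assms by simp
    then have "L * sqrt (real k / L) ^ 3 = (sqrt L * sqrt L) * (sqrt (real k) ^ 3 / sqrt L ^ 3)"
      by (simp add: real_sqrt_divide power_divide)
    then show ?thesis using assms by (simp add: power3_eq_cube)
  qed
  ultimately show ?thesis by simp
qed

lemma scale_cube': "L > 0 \<Longrightarrow> L * sqrt (real k / L) ^ 3 = (real k / L powr (1/3)) powr (3/2)"
  by (simp add: scale_cube powr_divide powr_powr)

lemma omega_moment_large:
  fixes \<kappa> :: "real \<Rightarrow> nat"
  assumes big: "filterlim (\<lambda>x. real (\<kappa> x) / ln (ln x) powr (1/3)) at_top at_top"
    and small: "(\<lambda>x. real (\<kappa> x)) \<in> o[at_top](\<lambda>x. sqrt (ln (ln x)))"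
  defines "r \<equiv> \<lambda>x. sqrt (real (\<kappa> x) / ln (ln x))"
  defines "g \<equiv> \<lambda>x. 1/2 * ln x powr (exp (r x) - (1 + r x + (r x)\<^sup>2 / 2))"
  shows "(\<lambda>x. inverse (gamma_moment (\<kappa> x)) * omega_moment x (\<kappa> x)) \<sim>[at_top] g"
    and "filterlim g at_top at_top"
proof -
  define L where "L = (\<lambda>x::real. ln (ln x))"
  let ?R = "\<lambda>x. omega_moment x (\<kappa> x) / gamma_moment (\<kappa> x) * exp (- (L x * exp_tail (r x)))"
  have Lt: "filterlim L at_top at_top" unfolding L_def by (rule ln_ln_at_top)
  have evL: "eventually (\<lambda>x. L x \<ge> 1) at_top" using Lt by (simp add: filterlim_at_top)
  have evx: "eventually (\<lambda>x::real. ln x > 0) at_top" by real_asymp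
  have sm: "((\<lambda>x. real (\<kappa> x) / sqrt (L x)) \<longlongrightarrow> 0) at_top"
    unfolding L_def by (rule smalloD_tendsto[OF small])
  have \<kappa>: "filterlim (\<lambda>x. real (\<kappa> x)) at_top at_top"
  proof (rule filterlim_at_top_mono[OF big])
    show "eventually (\<lambda>x. real (\<kappa> x) / ln (ln x) powr (1/3) \<le> real (\<kappa> x)) at_top"
      using evL
    proof eventually_elim
      case (elim x)
      then have "L x powr (1/3) \<ge> 1" using ge_one_powr_ge_zero[of "L x" "1/3"] by simp
      then have "real (\<kappa> x) / L x powr (1/3) \<le> real (\<kappa> x) / 1" by (intro divide_left_mono) auto
      then show ?case by (simp add: L_def)
    qed
  qed
  have r0: "(r \<longlongrightarrow> 0) at_top"
  proof -
    have "((\<lambda>x. sqrt (real (\<kappa> x) / sqrt (L x))) \<longlongrightarrow> sqrt 0) at_top" by (intro tendsto_real_sqrt sm)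
    then have "((\<lambda>x. sqrt (real (\<kappa> x) / sqrt (L x))) \<longlongrightarrow> 0) at_top" by simp
    then show ?thesis
    proof (rule Lim_null_comparison[rotated])
      show "eventually (\<lambda>x. norm (r x) \<le> sqrt (real (\<kappa> x) / sqrt (L x))) at_top"
        using evL
      proof eventually_elim
        case (elim x)
        have "sqrt (L x) \<le> L x" using elim real_sqrt_le_mono[of 1 "L x"] real_sqrt_mult_self[of "L x"]
          mult_left_mono[of 1 "sqrt (L x)" "sqrt (L x)"] by simp
        then have "real (\<kappa> x) / L x \<le> real (\<kappa> x) / sqrt (L x)" using elim by (intro divide_left_mono) auto
        then show ?case using elim by (simp add: r_def L_def)
      qed
    qed
  qed
  have evr: "eventually (\<lambda>x. r x < 1/6) at_top" using order_tendstoD(2)[OF r0, of "1/6"] by simp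
  have cube: "filterlim (\<lambda>x. L x * r x ^ 3) at_top at_top"
  proof -
    have "filterlim (\<lambda>y::real. y powr (3/2)) at_top at_top" by real_asymp
    from filterlim_compose[OF this big]
    have "filterlim (\<lambda>x. (real (\<kappa> x) / L x powr (1/3)) powr (3/2)) at_top at_top" by (simp add: L_def)
    then show ?thesis
      by (rule filterlim_mono_eventually[OF _ order_refl order_refl])
        (use evL in \<open>eventually_elim, auto simp: scale_cube' r_def L_def\<close>)
  qed
  have r_nn: "eventually (\<lambda>x. r x \<ge> 0) at_top" using evL by eventually_elim (simp add: r_def L_def)
  have "((\<lambda>x. exp (- (L x * r x ^ 3 / 6))) \<longlongrightarrow> 0) at_top"
  proof -
    have "((\<lambda>y::real. exp (- (y / 6))) \<longlongrightarrow> 0) at_top" by real_asymp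
    from filterlim_compose[OF this cube] show ?thesis .
  qed
  then have "((\<lambda>x. 1 + (-1) ^ \<kappa> x * exp (L x * (exp_tail (- r x) - exp_tail (r x))) - 1) \<longlongrightarrow> 0) at_top"
  proof (rule Lim_null_comparison[rotated])
    show "eventually (\<lambda>x. norm (1 + (-1) ^ \<kappa> x * exp (L x * (exp_tail (- r x) - exp_tail (r x))) - 1) \<le> exp (- (L x * r x ^ 3 / 6))) at_top"
      using evL evr r_nn
    proof eventually_elim
      case (elim x)
      \<comment> \<open>The sign of exp_tail (-r) together with the first Taylor term at r already
        separates the two saddle points enough.\<close>
      have "exp_tail (- r x) - exp_tail (r x) \<le> 0 - r x ^ 3 / 6"
        using elim exp_tail_real_bounds(2)[of "r x"] exp_tail_ge_cube[of "r x"] by (intro diff_mono) auto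
      then have "L x * (exp_tail (- r x) - exp_tail (r x)) \<le> L x * (0 - r x ^ 3 / 6)" using elim by (intro mult_left_mono) auto
      then show ?case by (simp add: abs_mult power_abs)
    qed
  qed
  then have "((\<lambda>x. ?R x - 1 / 2) \<longlongrightarrow> 0) at_top"
    using omega_moment_ratio[of \<kappa> "\<lambda>_. 1"] \<kappa> sm unfolding L_def r_def by simp
  then have "((\<lambda>x. ?R x) \<longlongrightarrow> 1 / 2) at_top"
    by (rule Lim_null[THEN iffD2])
  from tendsto_mult[OF tendsto_const[of 2] this]
  have lim: "((\<lambda>x. 2 * (?R x)) \<longlongrightarrow> 1) at_top" by simp
  have g: "eventually (\<lambda>x. g x = 1/2 * exp (L x * exp_tail (r x))) at_top"
    using evx by eventually_elim (simp add: g_def powr_def L_def exp_tail_def algebra_simps)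
  show "(\<lambda>x. inverse (gamma_moment (\<kappa> x)) * omega_moment x (\<kappa> x)) \<sim>[at_top] g"
  proof (rule asymp_equivI', rule Lim_transform_eventually[OF lim])
    show "eventually (\<lambda>x. 2 * (?R x) =
       inverse (gamma_moment (\<kappa> x)) * omega_moment x (\<kappa> x) / g x) at_top"
      using g
    proof eventually_elim
      case (elim x)
      show ?case unfolding elim by (simp add: exp_minus field_simps)
    qed
  qed
  have "filterlim (\<lambda>x. 1/2 * exp (L x * r x ^ 3 / 6)) at_top at_top"
  proof -
    have "filterlim (\<lambda>y::real. 1/2 * exp (y / 6)) at_top at_top" by real_asymp
    from filterlim_compose[OF this cube] show ?thesis .
  qed
  then show "filterlim g at_top at_top"
  proof (rule filterlim_at_top_mono)
    show "eventually (\<lambda>x. 1/2 * exp (L x * r x ^ 3 / 6) \<le> g x) at_top"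
      using g evL r_nn
    proof eventually_elim
      case (elim x)
      have "L x * (r x ^ 3 / 6) \<le> L x * exp_tail (r x)" using elim by (intro mult_left_mono exp_tail_ge_cube) auto
      then show ?case using elim by simp
    qed
  qed
qed

lemma exp_nonpos_lipschitz:
  assumes "a \<le> 0" "b \<le> (0::real)"
  shows "\<bar>exp a - exp b\<bar> \<le> \<bar>a - b\<bar>"
proof -
  have *: "exp a - exp b \<le> a - b" "0 \<le> exp a - exp b" if "b \<le> a" "a \<le> 0" for a b :: real
  proof -
    have "1 - exp (b - a) \<le> a - b" using exp_ge_add_one_self[of "b - a"] by linarith
    then have "exp a * (1 - exp (b - a)) \<le> 1 * (a - b)"
      using that by (intro mult_mono) auto
    then show "exp a - exp b \<le> a - b" by (simp add: right_diff_distrib exp_diff)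
    show "0 \<le> exp a - exp b" using that by simp
  qed
  show ?thesis using *[of b a] *[of a b] assms by (cases "b \<le> a") auto
qed

text \<open>L r^3 is bounded above and below here, so both saddle points persist. Replacing the
  tails by their cubic terms changes the exponents by at most O(L r^4) = O(r), which tends to
  0.\<close>

lemma omega_moment_critical:
  fixes \<kappa> :: "real \<Rightarrow> nat"
  assumes \<Theta>: "(\<lambda>x. real (\<kappa> x)) \<in> \<Theta>[at_top](\<lambda>x. ln (ln x) powr (1/3))"
  defines "g \<equiv> \<lambda>x. 1/2 * exp (real (\<kappa> x) powr (3/2) / (6 * ln (ln x) powr (1/2)))
                   * (1 + (-1) ^ \<kappa> x * exp (- (real (\<kappa> x) powr (3/2) / (3 * ln (ln x) powr (1/2)))))"
  shows "(\<lambda>x. inverse (gamma_moment (\<kappa> x)) * omega_moment x (\<kappa> x)) \<sim>[at_top] g"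
    and "g \<in> \<Theta>[at_top](\<lambda>_. 1)"
proof -
  define L where "L = (\<lambda>x::real. ln (ln x))"
  define r where "r = (\<lambda>x. sqrt (real (\<kappa> x) / L x))"
  let ?R = "\<lambda>x. omega_moment x (\<kappa> x) / gamma_moment (\<kappa> x) * exp (- (L x * exp_tail (r x)))"
  have Lt: "filterlim L at_top at_top" unfolding L_def by (rule ln_ln_at_top)
  have evL: "eventually (\<lambda>x. L x \<ge> 1) at_top" using Lt by (simp add: filterlim_at_top)
  obtain c1 c2 where c1: "c1 > 0" "eventually (\<lambda>x. norm (real (\<kappa> x)) \<ge> c1 * norm (ln (ln x) powr (1/3))) at_top"
    and c2: "c2 > 0" "eventually (\<lambda>x. norm (real (\<kappa> x)) \<le> c2 * norm (ln (ln x) powr (1/3))) at_top"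
    using bigthetaD1[OF \<Theta>] bigthetaD2[OF \<Theta>] by (elim landau_o.bigE landau_omega.bigE) blast
  define u where "u = (\<lambda>x. real (\<kappa> x) / L x powr (1/3))"
  have u: "eventually (\<lambda>x. c1 \<le> u x \<and> u x \<le> c2) at_top"
    using c1(2) c2(2) evL
  proof eventually_elim
    case (elim x)
    then have "L x powr (1/3) > 0" by simp
    then show ?case using elim by (simp add: u_def L_def pos_le_divide_eq pos_divide_le_eq)
  qed
  have \<kappa>: "filterlim (\<lambda>x. real (\<kappa> x)) at_top at_top"
  proof (rule filterlim_at_top_mono)
    have "filterlim (\<lambda>y::real. c1 * y powr (1/3)) at_top at_top" using c1(1) by real_asymp
    from filterlim_compose[OF this Lt] show "filterlim (\<lambda>x. c1 * L x powr (1/3)) at_top at_top" .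
    show "eventually (\<lambda>x. c1 * L x powr (1/3) \<le> real (\<kappa> x)) at_top"
      using c1(2) by eventually_elim (simp add: L_def)
  qed
  have sm: "((\<lambda>x. real (\<kappa> x) / sqrt (L x)) \<longlongrightarrow> 0) at_top"
  proof (rule Lim_null_comparison)
    have "((\<lambda>y::real. c2 * y powr (1/3) / sqrt y) \<longlongrightarrow> 0) at_top" by real_asymp
    from filterlim_compose[OF this Lt] show "((\<lambda>x. c2 * L x powr (1/3) / sqrt (L x)) \<longlongrightarrow> 0) at_top" .
    show "eventually (\<lambda>x. norm (real (\<kappa> x) / sqrt (L x)) \<le> c2 * L x powr (1/3) / sqrt (L x)) at_top"
      using c2(2) evL by eventually_elim (auto simp: L_def intro!: divide_right_mono)
  qed
  have r0: "(r \<longlongrightarrow> 0) at_top"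
  proof (rule Lim_null_comparison)
    have "((\<lambda>x. sqrt (real (\<kappa> x) / sqrt (L x))) \<longlongrightarrow> sqrt 0) at_top" by (intro tendsto_real_sqrt sm)
    then show "((\<lambda>x. sqrt (real (\<kappa> x) / sqrt (L x))) \<longlongrightarrow> 0) at_top" by simp
    show "eventually (\<lambda>x. norm (r x) \<le> sqrt (real (\<kappa> x) / sqrt (L x))) at_top"
      using evL
    proof eventually_elim
      case (elim x)
      have "sqrt (L x) \<le> L x" using elim real_sqrt_le_mono[of 1 "L x"] real_sqrt_mult_self[of "L x"]
        mult_left_mono[of 1 "sqrt (L x)" "sqrt (L x)"] by simp
      then have "real (\<kappa> x) / L x \<le> real (\<kappa> x) / sqrt (L x)" using elim by (intro divide_left_mono) auto
      then show ?case using elim by (simp add: r_def)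
    qed
  qed
  have "eventually (\<lambda>x. r x < 1/6) at_top" using order_tendstoD(2)[OF r0, of "1/6"] by simp
  then have evr: "eventually (\<lambda>x. 0 \<le> r x \<and> r x < 1/6) at_top"
    using evL by eventually_elim (simp add: r_def)
  have b: "real (\<kappa> x) powr (3/2) / (6 * L x powr (1/2)) = L x * r x ^ 3 / 6"
    "real (\<kappa> x) powr (3/2) / (3 * L x powr (1/2)) = L x * r x ^ 3 / 3" if "L x \<ge> 1" for x
    using scale_cube[of "L x" "\<kappa> x"] that by (simp_all add: r_def)
  have cube: "eventually (\<lambda>x. c1 powr (3/2) \<le> L x * r x ^ 3 \<and> L x * r x ^ 3 \<le> c2 powr (3/2)) at_top"
    using u evL
  proof eventually_elim
    case (elim x)
    have "L x * r x ^ 3 = u x powr (3/2)" using elim scale_cube'[of "L x" "\<kappa> x"] by (simp add: r_def u_def)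
    then show ?case using elim c1(1) by (auto intro!: powr_mono2)
  qed
  define l where "l = (\<lambda>x. 1 + (-1) ^ \<kappa> x * exp (- (real (\<kappa> x) powr (3/2) / (3 * L x powr (1/2)))))"
  have l2: "\<bar>l x\<bar> \<le> 2" for x
  proof -
    have "exp (- (real (\<kappa> x) powr (3/2) / (3 * L x powr (1/2)))) \<le> 1" by simp
    then have "\<bar>(-1) ^ \<kappa> x * exp (- (real (\<kappa> x) powr (3/2) / (3 * L x powr (1/2))))\<bar> \<le> 1" by (simp add: abs_mult power_abs)
    then show ?thesis unfolding l_def by linarith
  qed
  \<comment> \<open>For odd k the two saddle points are subtracted. The lower bound for L r^3 keeps
    \<open>l\<close> at least \<open>c\<close>, so the additive limit can be divided by
    \<open>l\<close>.\<close>
  define c where "c = 1 - exp (- (c1 powr (3/2) / 3))"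
  have c: "c > 0" using c1(1) by (simp add: c_def)
  have lc: "eventually (\<lambda>x. c \<le> l x) at_top"
    using cube evL
  proof eventually_elim
    case (elim x)
    have "exp (- (L x * r x ^ 3 / 3)) \<le> exp (- (c1 powr (3/2) / 3))" using elim by simp
    moreover have "- exp (- (L x * r x ^ 3 / 3)) \<le> (-1) ^ \<kappa> x * exp (- (L x * r x ^ 3 / 3))"
      by (cases "even (\<kappa> x)") auto
    ultimately show ?case unfolding l_def c_def b(2)[OF elim(2)] by linarith
  qed
  have Lr: "((\<lambda>x. c2 powr (3/2) * r x) \<longlongrightarrow> 0) at_top"
    using tendsto_mult[OF tendsto_const[of "c2 powr (3/2)"] r0] by simp
  have "((\<lambda>x. 1 + (-1) ^ \<kappa> x * exp (L x * (exp_tail (- r x) - exp_tail (r x))) - l x) \<longlongrightarrow> 0) at_top"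
  proof (rule Lim_null_comparison[OF _ Lr])
    show "eventually (\<lambda>x. norm (1 + (-1) ^ \<kappa> x * exp (L x * (exp_tail (- r x) - exp_tail (r x))) - l x) \<le> c2 powr (3/2) * r x) at_top"
      using evL evr cube
    proof eventually_elim
      case (elim x)
      define A where "A = L x * (exp_tail (- r x) - exp_tail (r x))"
      define B where "B = - (L x * r x ^ 3 / 3)"
      have "exp_tail (- r x) - exp_tail (r x) \<le> 0"
        using elim exp_tail_real_bounds(2)[of "r x"] exp_tail_nonneg[of "r x"] by simp
      then have A: "A \<le> 0" using elim unfolding A_def by (intro mult_nonneg_nonpos) auto
      have B: "B \<le> 0" using elim by (simp add: B_def)
      have "norm (1 + (-1) ^ \<kappa> x * exp A - l x) = \<bar>(-1) ^ \<kappa> x * (exp A - exp B)\<bar>"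
        unfolding l_def b(2)[OF elim(1)] B_def[symmetric] by (simp add: algebra_simps)
      also have "\<dots> = \<bar>exp A - exp B\<bar>" by (simp add: abs_mult power_abs)
      also have "\<dots> \<le> \<bar>A - B\<bar>" by (rule exp_nonpos_lipschitz[OF A B])
      also have "A - B = - (L x * (exp_tail (r x) - exp_tail (- r x) - r x ^ 3 / 3))"
        by (simp add: A_def B_def algebra_simps)
      also have "\<bar>\<dots>\<bar> = L x * \<bar>exp_tail (r x) - exp_tail (- r x) - r x ^ 3 / 3\<bar>" using elim by (simp add: abs_mult)
      also have "\<dots> \<le> L x * (2 * r x ^ 5)" using elim by (intro mult_left_mono exp_tail_real_bounds) auto
      also have "\<dots> = (L x * r x ^ 3) * (2 * r x * r x)" by (simp add: eval_nat_numeral)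
      also have "\<dots> \<le> c2 powr (3/2) * (1 * r x)" using elim by (intro mult_mono) auto
      finally show ?case by (simp add: A_def)
    qed
  qed
  then have Y: "((\<lambda>x. ?R x - l x / 2) \<longlongrightarrow> 0) at_top"
    using omega_moment_ratio[of \<kappa> l] \<kappa> sm l2 unfolding L_def r_def by simp
  have "((\<lambda>x. L x * exp_tail (r x) - L x * r x ^ 3 / 6) \<longlongrightarrow> 0) at_top"
  proof (rule Lim_null_comparison[OF _ Lr])
    show "eventually (\<lambda>x. norm (L x * exp_tail (r x) - L x * r x ^ 3 / 6) \<le> c2 powr (3/2) * r x) at_top"
      using evL evr cube
    proof eventually_elim
      case (elim x)
      have "norm (L x * exp_tail (r x) - L x * r x ^ 3 / 6) = norm (L x * (exp_tail (r x) - r x ^ 3 / 6))"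
        by (simp add: right_diff_distrib)
      also have "\<dots> \<le> L x * r x ^ 4" using elim exp_tail_real_bounds(1)[of "r x"] by (simp add: abs_mult)
      also have "\<dots> = (L x * r x ^ 3) * r x" by (simp add: eval_nat_numeral)
      also have "\<dots> \<le> c2 powr (3/2) * r x" using elim by (intro mult_right_mono) auto
      finally show ?case .
    qed
  qed
  from tendsto_exp[OF this] have E: "((\<lambda>x. exp (L x * exp_tail (r x) - L x * r x ^ 3 / 6)) \<longlongrightarrow> 1) at_top" by simp
  have "((\<lambda>x. 2 * (?R x - l x / 2) / l x) \<longlongrightarrow> 0) at_top"
  proof (rule Lim_null_comparison)
    show "eventually (\<lambda>x. norm (2 * (?R x - l x / 2) / l x)
       \<le> 2 / c * \<bar>?R x - l x / 2\<bar>) at_top"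
      using lc
    proof eventually_elim
      case (elim x)
      define y where "y = ?R x - l x / 2"
      have "2 * \<bar>y\<bar> / l x \<le> 2 * \<bar>y\<bar> / c" using elim c by (intro divide_left_mono) auto
      then show ?case unfolding y_def[symmetric] using elim c by (simp add: abs_mult)
    qed
    show "((\<lambda>x. 2 / c * \<bar>?R x - l x / 2\<bar>) \<longlongrightarrow> 0) at_top"
      using tendsto_mult[OF tendsto_const[of "2 / c"] tendsto_rabs[OF Y]] by simp
  qed
  from tendsto_mult[OF tendsto_add[OF this tendsto_const[of 1]] E]
  have lim: "((\<lambda>x. (2 * (?R x - l x / 2) / l x + 1) * exp (L x * exp_tail (r x) - L x * r x ^ 3 / 6)) \<longlongrightarrow> 1) at_top"
    by simp
  have g: "eventually (\<lambda>x. g x = 1/2 * exp (L x * r x ^ 3 / 6) * l x) at_top"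
    using evL
  proof eventually_elim
    case (elim x)
    show ?case unfolding b(1)[OF elim, symmetric] unfolding g_def l_def L_def ..
  qed
  show "(\<lambda>x. inverse (gamma_moment (\<kappa> x)) * omega_moment x (\<kappa> x)) \<sim>[at_top] g"
  proof (rule asymp_equivI', rule Lim_transform_eventually[OF lim])
    show "eventually (\<lambda>x. (2 * (?R x - l x / 2) / l x + 1) * exp (L x * exp_tail (r x) - L x * r x ^ 3 / 6) =
       inverse (gamma_moment (\<kappa> x)) * omega_moment x (\<kappa> x) / g x) at_top"
      using g lc
    proof eventually_elim
      case (elim x)
      then have "l x \<noteq> 0" using c by auto
      then have "2 * (?R x - l x / 2) / l x + 1
         = 2 * (?R x) / l x"
        by (simp add: field_simps)
      moreover have "2 * (p * exp (- a)) / y * exp (a - b) = p / (1/2 * exp b * y)" for p a b y :: real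
      proof -
        have e: "exp (- a) * exp (a - b) = 1 / exp b" by (simp add: exp_diff exp_minus)
        have "2 * (p * exp (- a)) / y * exp (a - b) = 2 * p * (exp (- a) * exp (a - b)) / y" by simp
        then show ?thesis unfolding e by simp
      qed
      moreover have "inverse (gamma_moment (\<kappa> x)) * omega_moment x (\<kappa> x) = omega_moment x (\<kappa> x) / gamma_moment (\<kappa> x)"
        by (simp add: divide_inverse mult.commute)
      ultimately show ?case unfolding elim(1) by (simp only:)
    qed
  qed
  show "g \<in> \<Theta>[at_top](\<lambda>_. 1)"
  proof (rule bigthetaI)
    show "g \<in> O[at_top](\<lambda>_. 1)"
    proof (rule bigoI)
      show "eventually (\<lambda>x. norm (g x) \<le> exp (c2 powr (3/2)) * norm (1::real)) at_top"
        using g cube lc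
      proof eventually_elim
        case (elim x)
        have "L x * r x ^ 3 / 6 \<le> c2 powr (3/2)" using elim powr_ge_zero[of c2 "3/2"] by linarith
        then have "1/2 * exp (L x * r x ^ 3 / 6) * l x \<le> 1/2 * exp (c2 powr (3/2)) * 2"
          using elim l2[of x] c by (intro mult_mono) (auto simp: abs_le_iff)
        moreover have "0 \<le> 1/2 * exp (L x * r x ^ 3 / 6) * l x" using elim c by (intro mult_nonneg_nonneg) auto
        ultimately show ?case unfolding elim(1) by simp
      qed
    qed
    show "g \<in> \<Omega>[at_top](\<lambda>_. 1)"
    proof (rule landau_omega.bigI[of "c / 2"])
      show "eventually (\<lambda>x. norm (g x) \<ge> c / 2 * norm (1::real)) at_top"
        using g cube lc
      proof eventually_elim
        case (elim x)
        have "0 \<le> L x * r x ^ 3" using elim order.trans[OF powr_ge_zero] by blast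
        then have "1/2 * 1 * c \<le> 1/2 * exp (L x * r x ^ 3 / 6) * l x"
          using elim c by (intro mult_mono) auto
        then show ?case unfolding elim(1) using c by simp
      qed
    qed (use c in auto)
  qed
qed

section \<open>Moments of small order\<close>

lemma gamma_moment_pos: "gamma_moment k > 0"
  unfolding gamma_moment_def by (intro divide_pos_pos mult_pos_pos Gamma_real_pos) auto

text \<open>The limit in \<open>gamma_moment_asymp\<close> settles large k, and a minimum of
  positive values covers the rest. The left-hand side is the bound for \<open>gauss_mass\<close> in
  the scale of the moments, so saddle point errors become multiples of
  \<open>gamma_moment\<close>.\<close>

lemma gamma_moment_lower:
  obtains c where "c > 0" "\<And>k. k > 0 \<Longrightarrow> exp (real k / 2) / sqrt (real k) * (fact k / sqrt (real k) ^ k) \<le> c * gamma_moment k"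
proof -
  define s where "s = (\<lambda>k. gamma_moment k * sqrt k ^ k / fact k * (sqrt k * exp (- real k / 2)))"
  have spos: "s k > 0" if "k > 0" for k using that gamma_moment_pos[of k] by (simp add: s_def)
  have "eventually (\<lambda>k. s k > 1 / (2 * sqrt pi)) sequentially"
    using gamma_moment_asymp unfolding s_def by (rule order_tendstoD) (simp add: field_simps)
  then obtain N where N: "\<And>k. k \<ge> N \<Longrightarrow> s k > 1 / (2 * sqrt pi)" by (auto simp: eventually_sequentially)
  define d where "d = Min (insert (1 / (2 * sqrt pi)) (s ` {1..N}))"
  have d: "d > 0" using spos by (auto simp: d_def)
  have ds: "d \<le> s k" if "k > 0" for k
  proof (cases "k \<ge> N")
    case True
    have "d \<le> 1 / (2 * sqrt pi)" by (simp add: d_def)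
    then show ?thesis using N[OF True] by linarith
  next
    case False
    then have "s k \<in> insert (1 / (2 * sqrt pi)) (s ` {1..N})" using that by auto
    then show ?thesis unfolding d_def by (intro Min_le) auto
  qed
  show ?thesis
  proof (rule that[of "1 / d"])
    fix k :: nat assume k: "k > 0"
    define t where "t = exp (real k / 2) / sqrt (real k) * (fact k / sqrt (real k) ^ k)"
    have t: "t > 0" using k by (simp add: t_def)
    have "s k * t = gamma_moment k * (exp (- real k / 2) * exp (real k / 2))"
      using k by (simp add: s_def t_def)
    then have "s k * t = gamma_moment k" by (simp add: exp_add[symmetric])
    moreover have "d * t \<le> s k * t" using ds[OF k] t by (intro mult_right_mono) auto
    ultimately have "t \<le> 1 / d * gamma_moment k" using d by (simp add: field_simps)
    then show "exp (real k / 2) / sqrt (real k) * (fact k / sqrt (real k) ^ k) \<le> 1 / d * gamma_moment k" by (simp add: t_def)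
  qed (use d in auto)
qed

lemma gauss_moment_even_Suc: "gauss_moment (2 * m + 2) = real (2 * m + 1) * gauss_moment (2 * m)"
proof -
  have "gauss_moment (2 * m + 2) = fact (2 * m + 2) / (2 ^ (m + 1) * fact (m + 1))" by (simp add: gauss_moment_def)
  also have "\<dots> = (2 * real m + 2) * (2 * real m + 1) * fact (2 * m) / (2 * 2 ^ m * ((real m + 1) * fact m))"
    by (simp add: algebra_simps)
  also have "\<dots> = (2 * real m + 1) * fact (2 * m) / (2 ^ m * fact m)"
    by (simp add: divide_simps)
  finally show ?thesis by (simp add: gauss_moment_def)
qed

lemma gauss_moment_even_pos: "gauss_moment (2 * m) > 0"
  by (simp add: gauss_moment_def)

lemma gamma_moment_odd_le: "gamma_moment (2 * m + 1) \<le> 2 * sqrt (real (2 * m + 1)) * gauss_moment (2 * m)"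
proof -
  \<comment> \<open>The induction runs with the sharper shift 1/2. Squaring the required step gives
    two cubics in m differing only in the constant term, by 1/2; with the shift 1 of the claim the
    step would fail.\<close>
  have "gamma_moment (2 * m + 1) \<le> 2 * sqrt (2 * real m + 1/2) * gauss_moment (2 * m)"
  proof (induction m)
    case 0
    have "2 * sqrt (1/2) = sqrt (2::real)" using real_sqrt_mult[of 4 "1/2"] by simp
    moreover have "gamma_moment 1 = sqrt 2 / sqrt pi" using gamma_moment_odd[of 0] by (simp add: powr_half_sqrt)
    moreover have "sqrt 2 / sqrt pi \<le> sqrt 2 / 1" using pi_gt3 real_sqrt_ge_one[of pi] by (intro divide_left_mono) auto
    ultimately show ?case by (simp add: gauss_moment_def)
  next
    case (Suc m)
    have p: "2 powr (real (Suc m) + 1/2) = (2::real) * 2 powr (real m + 1/2)"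
    proof -
      have "real (Suc m) + 1/2 = 1 + (real m + 1/2)" by simp
      then show ?thesis by (simp only: powr_add) simp
    qed
    have "gamma_moment (2 * Suc m + 1) = (2 * real m + 2) * gamma_moment (2 * m + 1)"
      unfolding gamma_moment_odd p by (simp add: algebra_simps)
    also have "\<dots> \<le> (2 * real m + 2) * (2 * sqrt (2 * real m + 1/2) * gauss_moment (2 * m))"
      using Suc by (intro mult_left_mono) auto
    also have "\<dots> = 2 * ((2 * real m + 2) * sqrt (2 * real m + 1/2)) * gauss_moment (2 * m)" by simp
    also have "(2 * real m + 2) * sqrt (2 * real m + 1/2) \<le> (2 * real m + 1) * sqrt (2 * real m + 5/2)"
    proof (rule power2_le_imp_le)
      show "((2 * real m + 2) * sqrt (2 * real m + 1/2))\<^sup>2 \<le> ((2 * real m + 1) * sqrt (2 * real m + 5/2))\<^sup>2"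
        by (simp add: power_mult_distrib) (simp add: power2_eq_square algebra_simps)
    qed simp
    also have "2 * ((2 * real m + 1) * sqrt (2 * real m + 5/2)) * gauss_moment (2 * m) = 2 * sqrt (2 * real (Suc m) + 1/2) * gauss_moment (2 * Suc m)"
      using gauss_moment_even_Suc[of m] by (simp add: algebra_simps)
    finally show ?case using gauss_moment_even_pos[of m] by (simp add: mult_right_mono)
  qed
  also have "\<dots> \<le> 2 * sqrt (real (2 * m + 1)) * gauss_moment (2 * m)"
    using gauss_moment_even_pos[of m] by (intro mult_right_mono) auto
  finally show ?thesis .
qed

text \<open>At most one summand is nonzero: the first for even k, the second for odd k.\<close>

definition moment_main :: "nat \<Rightarrow> real \<Rightarrow> real" where
  "moment_main k L = gauss_moment k + (real k * (real k - 1) / 6 + real k * mertens_const) * (gauss_moment (k - 1) / sqrt L)"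

lemma moment_main_even: "even k \<Longrightarrow> k > 0 \<Longrightarrow> moment_main k L = gauss_moment k"
  by (auto simp: moment_main_def gauss_moment_def)

lemma moment_main_odd: "moment_main (2 * m + 1) L = (real (2 * m + 1) * real (2 * m) / 6 + real (2 * m + 1) * mertens_const) * (gauss_moment (2 * m) / sqrt L)"
  by (simp add: moment_main_def gauss_moment_def)

text \<open>The right-hand side is k! times the coefficient of s^k in exp (s^2 / 2) (s^3 / 6 + a s)
  / sqrt L with a = \<open>mertens_const\<close>, the form in which the saddle point integral
  delivers it. For k = 1 the cubic term does not reach this coefficient, hence the
  conditional.\<close>

lemma moment_main_odd_coeff:
  assumes k: "k = 2 * m + 1"
  shows "moment_main k L = fact k * ((if 3 \<le> k then gauss_moment (k - 3) / fact (k - 3) else 0) / 6 + mertens_const * (gauss_moment (k - 1) / fact (k - 1))) / sqrt L"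
proof -
  have f1: "fact k = real k * fact (k - 1)" by (simp add: k)
  have "fact k * ((if 3 \<le> k then gauss_moment (k - 3) / fact (k - 3) else 0) / 6) = real k * (real k - 1) / 6 * gauss_moment (k - 1)"
  proof (cases m)
    case (Suc j)
    have k': "k = 2 * j + 3" by (simp add: k Suc)
    have "fact k = (2 * real j + 3) * (2 * real j + 2) * (2 * real j + 1) * fact (2 * j)"
      by (simp add: k' eval_nat_numeral algebra_simps)
    then have "fact k * (gauss_moment (2 * j) / fact (2 * j) / 6) = (2 * real j + 3) * (2 * real j + 2) / 6 * (real (2 * j + 1) * gauss_moment (2 * j))"
      by (simp add: algebra_simps)
    then show ?thesis using gauss_moment_even_Suc[of j] by (simp add: k' algebra_simps)
  qed (simp add: k)
  moreover have "fact k * (mertens_const * (gauss_moment (k - 1) / fact (k - 1))) = real k * mertens_const * gauss_moment (k - 1)"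
    unfolding f1 by simp
  moreover have "gauss_moment k = 0" by (simp add: gauss_moment_def k)
  ultimately show ?thesis unfolding moment_main_def distrib_left by (simp add: algebra_simps add_divide_distrib)
qed

lemma exp_quarter_le: "L > 0 \<Longrightarrow> exp (- L / 4) \<le> 32 / L ^ 2" for L :: real
proof -
  assume L: "L > 0"
  have "(L / 4)\<^sup>2 / 2 \<le> exp (L / 4)" using exp_lower_Taylor_quadratic[of "L / 4"] L by simp
  then have "L ^ 2 / 32 \<le> exp (L / 4)" by (simp add: power_divide)
  then have "1 / exp (L / 4) \<le> 1 / (L ^ 2 / 32)" using L by (intro divide_left_mono) auto
  then show ?thesis by (simp add: exp_minus inverse_eq_divide)
qed

text \<open>Relative to \<open>gamma_moment k\<close> the main term has size 1 for even k, but only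
  the order of B = sqrt k ^ 3 / sqrt L for odd k. The exponents 2 and 3 thus both amount to a
  relative error B^2 = k^3 / L.\<close>

lemma omega_moment_error:
  assumes A: "A > 0"
  obtains C L0 where "C > 0" "L0 \<ge> 1"
    "\<And>x k L. x \<ge> 3 \<Longrightarrow> k > 0 \<Longrightarrow> L = ln (ln x) \<Longrightarrow> L \<ge> L0 \<Longrightarrow> real k \<le> A * L powr (1/3) \<Longrightarrow>
       \<bar>omega_moment x k - moment_main k L\<bar> \<le> C * (sqrt (real k) ^ 3 / sqrt L) ^ (if even k then 2 else 3) * gamma_moment k"
proof -
  obtain H :: "complex \<Rightarrow> complex" and K :: real
    where K: "K > 0" and H: "H holomorphic_on ball 0 (1/16)" "H 0 = 1" "deriv H 0 = of_real mertens_const"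
    and saddle: "\<And>x k L. x \<ge> 3 \<Longrightarrow> k > 0 \<Longrightarrow> L = ln (ln x) \<Longrightarrow> sqrt (real k / L) < 1/16 \<Longrightarrow>
      norm (of_real (omega_moment x k * sqrt k ^ k / fact k) - gauss_coeff k (\<lambda>z. tilt H L (of_real (sqrt (real k / L)) * z))) \<le> K * exp (- L / 4)"
    by (rule omega_moment_saddle) blast
  obtain C1 where C1: "C1 > 0"
    and even: "\<And>L w. L > 0 \<Longrightarrow> norm w \<le> 1/32 \<Longrightarrow> norm w \<le> L * norm w ^ 3 \<Longrightarrow> L * norm w ^ 3 \<le> sqrt (A ^ 3) \<Longrightarrow>
       norm (tilt H L w + tilt H L (- w) - 2) \<le> C1 * (L * norm w ^ 3) ^ 2"
    and odd: "\<And>L w. L > 0 \<Longrightarrow> norm w \<le> 1/32 \<Longrightarrow> norm w \<le> L * norm w ^ 3 \<Longrightarrow> L * norm w ^ 3 \<le> sqrt (A ^ 3) \<Longrightarrow>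
       norm (tilt H L w - tilt H L (- w) - (of_real L * w ^ 3 / 3 + 2 * deriv H 0 * w)) \<le> C1 * (L * norm w ^ 3) ^ 3"
    by (rule tilt_parity[OF H(1,2), of "sqrt (A ^ 3)"]) blast
  obtain c where c: "c > 0" "\<And>k. k > 0 \<Longrightarrow> exp (real k / 2) / sqrt (real k) * (fact k / sqrt (real k) ^ k) \<le> c * gamma_moment k"
    by (rule gamma_moment_lower) blast
  \<comment> \<open>This gives L^(2/3) at least 1024 A, hence k / L at most 1/1024 and r at most
    1/32, the range covered by \<open>tilt_parity\<close>.\<close>
  define L0 where "L0 = max 1 ((1024 * A) powr (3/2))"
  show ?thesis
  proof (rule that[of "(C1 + 32 * K) * c" L0])
    show "(C1 + 32 * K) * c > 0" using C1 K c by (intro mult_pos_pos add_pos_pos) auto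
    show "L0 \<ge> 1" by (simp add: L0_def)
    fix x L :: real and k :: nat
    assume x: "x \<ge> 3" and k: "k > 0" and L: "L = ln (ln x)" and LL0: "L \<ge> L0" and kA: "real k \<le> A * L powr (1/3)"
    have L1: "L \<ge> 1" using LL0 by (simp add: L0_def)
    define r where "r = sqrt (real k / L)"
    define B where "B = L * r ^ 3"
    define j where "j = (if even k then 2 else 3 :: nat)"
    have r: "r > 0" "r \<le> 1/32"
    proof -
      show "r > 0" using k L1 by (simp add: r_def)
      have "1024 * A = ((1024 * A) powr (3/2)) powr (2/3)" using A by (simp add: powr_powr)
      also have "\<dots> \<le> L powr (2/3)" using LL0 by (intro powr_mono2) (auto simp: L0_def)
      finally have "1024 * A * L powr (1/3) \<le> L powr (2/3) * L powr (1/3)" by (intro mult_right_mono) auto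
      also have "\<dots> = L" using L1 by (simp add: powr_add[symmetric])
      finally have "1024 * real k \<le> L" using kA by simp
      then have "real k / L \<le> (1/32)\<^sup>2" using L1 by (simp add: power2_eq_square field_simps)
      then have "r \<le> sqrt ((1/32)\<^sup>2)" unfolding r_def by (rule real_sqrt_le_mono)
      then show "r \<le> 1/32" by simp
    qed
    have Lr2: "L * r\<^sup>2 = real k" using L1 by (simp add: r_def)
    have Bkr: "B = real k * r" using Lr2 by (simp add: B_def power3_eq_cube power2_eq_square mult.assoc[symmetric])
    have rB: "r \<le> B" using k r by (simp add: Bkr)
    have B_eq: "B = sqrt (real k) ^ 3 / sqrt L"
    proof -
      have "B = (sqrt (real k) * sqrt (real k)) * (sqrt (real k) / sqrt L)" by (simp add: Bkr r_def real_sqrt_divide)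
      then show ?thesis by (simp add: power3_eq_cube)
    qed
    have Bb: "B \<le> sqrt (A ^ 3)"
    proof (rule real_le_rsqrt)
      have "r\<^sup>2 = real k / L" using L1 by (simp add: r_def)
      then have "B\<^sup>2 = real k ^ 3 / L" unfolding Bkr power_mult_distrib by (simp add: power3_eq_cube power2_eq_square)
      also have "\<dots> \<le> (A * L powr (1/3)) ^ 3 / L" using kA L1 by (intro divide_right_mono power_mono) auto
      also have "(A * L powr (1/3)) ^ 3 = A ^ 3 * L"
      proof -
        have "(L powr (1/3)) ^ 3 = (L powr (1/3)) powr real 3" using L1 by (subst powr_realpow) auto
        also have "\<dots> = L" using L1 by (simp add: powr_powr)
        finally show ?thesis by (simp add: power_mult_distrib)
      qed
      finally show "B\<^sup>2 \<le> A ^ 3" using L1 by simp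
    qed
    have sqrtL: "1 / sqrt L \<le> B"
    proof -
      have "1 \<le> sqrt (real k) ^ 3" using k by (intro one_le_power) auto
      then show ?thesis unfolding B_eq by (intro divide_right_mono) (use L1 in auto)
    qed
    have B0: "B > 0" using rB r by linarith
    have wn: "norm (of_real r * z) = r" if "norm z = 1" for z :: complex using that r by (simp add: norm_mult)
    define f where "f = (\<lambda>z. tilt H L (of_real r * z))"
    have fc: "continuous_on (sphere 0 1) f"
    proof -
      have "continuous_on (sphere 0 1) (\<lambda>z. H (of_real r * z))"
        by (rule continuous_on_compose2[OF holomorphic_on_imp_continuous_on[OF H(1)]])
          (use r in \<open>auto intro!: continuous_intros simp: norm_mult\<close>)
      then show ?thesis unfolding f_def tilt_def by (intro continuous_intros) auto
    qed
    define X where "X = omega_moment x k * sqrt k ^ k / fact k"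
    define Y where "Y = moment_main k L * sqrt k ^ k / fact k"
    have main: "norm (gauss_coeff k f - of_real Y) \<le> C1 * B ^ j * gauss_mass k"
    proof (cases "even k")
      case True
      have "gauss_coeff k f = gauss_coeff k (\<lambda>z. (f z - 1) + 1)" by simp
      also have "\<dots> = gauss_coeff k (\<lambda>z. f z - 1) + gauss_coeff k (\<lambda>_. 1)"
        by (intro gauss_coeff_add continuous_intros fc)
      also have "gauss_coeff k (\<lambda>_. 1) = of_real Y"
        using k True by (simp add: gauss_coeff_1 Y_def moment_main_even)
      finally have "gauss_coeff k f - of_real Y = gauss_coeff k (\<lambda>z. f z - 1)" by simp
      also have "norm \<dots> \<le> C1 * B ^ j * gauss_mass k"
      proof (rule gauss_coeff_bound)
        show "continuous_on (sphere 0 1) (\<lambda>z. f z - 1)" by (intro continuous_intros fc)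
        fix z :: complex assume z: "norm z = 1"
        have "norm (tilt H L (of_real r * z) + tilt H L (- (of_real r * z)) - 2) \<le> C1 * (L * norm (of_real r * z) ^ 3) ^ 2"
          using L1 r rB Bb unfolding B_def by (intro even) (simp_all only: wn[OF z])
        then show "norm (f z - 1 + (-1) ^ k * (f (- z) - 1)) \<le> C1 * B ^ j"
          using True unfolding wn[OF z] by (simp add: f_def B_def j_def algebra_simps)
      qed
      finally show ?thesis .
    next
      case False
      then obtain m where m: "k = 2 * m + 1" by (elim oddE)
      \<comment> \<open>At w = r z and s = sqrt k * z the approximation L w^3 / 3 + 2 a w to the odd
        difference is twice this polynomial in s. It is odd, so pairing z with -z doubles
        it.\<close>
      define G where "G = (\<lambda>z::complex. of_real (1 / (6 * sqrt L)) * (of_real (sqrt k) * z) ^ 3 + of_real (mertens_const / sqrt L) * (of_real (sqrt k) * z) ^ 1)"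
      have Gc: "continuous_on (sphere 0 1) G" unfolding G_def by (intro continuous_intros)
      have "gauss_coeff k G = of_real (1 / (6 * sqrt L)) * gauss_coeff k (\<lambda>z. (of_real (sqrt k) * z) ^ 3) + of_real (mertens_const / sqrt L) * gauss_coeff k (\<lambda>z. (of_real (sqrt k) * z) ^ 1)"
      proof -
        have c1: "continuous_on (sphere 0 1) (\<lambda>z. of_real (1 / (6 * sqrt L)) * (of_real (sqrt k) * z :: complex) ^ 3)"
          and c2: "continuous_on (sphere 0 1) (\<lambda>z. of_real (mertens_const / sqrt L) * (of_real (sqrt k) * z :: complex) ^ 1)"
          by (intro continuous_intros)+
        show ?thesis unfolding G_def gauss_coeff_add[OF c1 c2] gauss_coeff_cmult ..
      qed
      also have "\<dots> = of_real (1 / (6 * sqrt L) * (if 3 \<le> k then gauss_moment (k - 3) / fact (k - 3) * sqrt k ^ k else 0) + mertens_const / sqrt L * (gauss_moment (k - 1) / fact (k - 1) * sqrt k ^ k))"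
        unfolding gauss_coeff_power[OF k] using k by simp
      also have "\<dots> = of_real Y"
        unfolding Y_def moment_main_odd_coeff[OF m] by (simp add: algebra_simps add_divide_distrib)
      finally have GY: "gauss_coeff k G = of_real Y" .
      have "gauss_coeff k f = gauss_coeff k (\<lambda>z. (f z - G z) + G z)" by simp
      also have "\<dots> = gauss_coeff k (\<lambda>z. f z - G z) + gauss_coeff k G"
        by (intro gauss_coeff_add continuous_intros fc Gc)
      finally have "gauss_coeff k f - of_real Y = gauss_coeff k (\<lambda>z. f z - G z)" by (simp add: GY)
      also have "norm \<dots> \<le> C1 * B ^ j * gauss_mass k"
      proof (rule gauss_coeff_bound)
        show "continuous_on (sphere 0 1) (\<lambda>z. f z - G z)" by (intro continuous_intros fc Gc)
        fix z :: complex assume z: "norm z = 1"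
        have o: "norm (tilt H L (of_real r * z) - tilt H L (- (of_real r * z)) - (of_real L * (of_real r * z) ^ 3 / 3 + 2 * deriv H 0 * (of_real r * z))) \<le> C1 * (L * norm (of_real r * z) ^ 3) ^ 3"
          using L1 r rB Bb unfolding B_def by (intro odd) (simp_all only: wn[OF z])
        have "2 * G z = of_real L * (of_real r * z) ^ 3 / 3 + 2 * deriv H 0 * (of_real r * z)"
        proof -
          have e1: "complex_of_real L * of_real r ^ 3 = of_real (sqrt k) ^ 3 / of_real (sqrt L)"
            using B_eq unfolding B_def by (metis of_real_divide of_real_mult of_real_power)
          have e2: "complex_of_real r = of_real (sqrt k) / of_real (sqrt L)"
            by (simp add: r_def real_sqrt_divide)
          have "of_real L * (of_real r * z) ^ 3 / 3 = (complex_of_real L * of_real r ^ 3) * z ^ 3 / 3" by (simp add: power_mult_distrib)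
          then show ?thesis unfolding e1 H(3) unfolding e2 by (simp add: G_def power_mult_distrib mult_ac)
        qed
        moreover have "G (- z) = - G z" by (simp add: G_def)
        ultimately show "norm (f z - G z + (-1) ^ k * (f (- z) - G (- z))) \<le> C1 * B ^ j"
          using False o unfolding wn[OF z] by (simp add: f_def B_def j_def algebra_simps)
      qed
      finally show ?thesis .
    qed
    have ek: "1 \<le> exp (real k / 2) / sqrt (real k)"
    proof -
      have "real k \<le> exp (real k)" using exp_ge_add_one_self[of "real k"] by linarith
      then have "sqrt (real k) \<le> sqrt (exp (real k / 2) ^ 2)" by (simp add: exp_double[symmetric])
      then show ?thesis using k by simp
    qed
    \<comment> \<open>exp (-L/4) is below a multiple of the fourth power of 1 / sqrt L, and 1 / sqrt
      L is at most B because k is at least 1; so the model error fits under B^j for either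
      parity.\<close>
    have err: "K * exp (- L / 4) \<le> 32 * K * B ^ j * (exp (real k / 2) / sqrt (real k))"
    proof -
      have "32 / L ^ 2 = 32 * (1 / sqrt L) ^ 4"
      proof -
        have "sqrt L ^ 4 = (sqrt L ^ 2) ^ 2" by simp
        also have "\<dots> = L ^ 2" using L1 by simp
        finally show ?thesis by (simp add: power_one_over)
      qed
      also have "(1 / sqrt L) ^ 4 \<le> (1 / sqrt L) ^ j"
        using L1 by (intro power_decreasing) (auto simp: j_def)
      also have "(1 / sqrt L) ^ j \<le> B ^ j" using sqrtL L1 by (intro power_mono) auto
      finally have "exp (- L / 4) \<le> 32 * B ^ j" using exp_quarter_le[of L] L1 by linarith
      then have "K * exp (- L / 4) \<le> K * (32 * B ^ j)" using K by (intro mult_left_mono) auto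
      also have "\<dots> = 32 * K * B ^ j * 1" by simp
      also have "\<dots> \<le> 32 * K * B ^ j * (exp (real k / 2) / sqrt (real k))"
        using ek K B0 by (intro mult_left_mono) auto
      finally show ?thesis .
    qed
    have "norm (of_real X - gauss_coeff k f) \<le> K * exp (- L / 4)"
      unfolding X_def f_def r_def using r by (intro saddle x k L) (simp add: r_def)
    then have "norm ((of_real X - gauss_coeff k f) + (gauss_coeff k f - of_real Y)) \<le> K * exp (- L / 4) + C1 * B ^ j * gauss_mass k"
      using main by (rule norm_triangle_mono)
    also have "(of_real X - gauss_coeff k f) + (gauss_coeff k f - of_real Y) = of_real (X - Y)" by simp
    also have "C1 * B ^ j * gauss_mass k \<le> C1 * B ^ j * (exp (real k / 2) / sqrt (real k))"
      using gauss_mass_le[OF k] C1 B0 by (intro mult_left_mono) auto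
    finally have XY: "\<bar>X - Y\<bar> \<le> (C1 + 32 * K) * B ^ j * (exp (real k / 2) / sqrt (real k))"
      using err unfolding norm_of_real by (simp add: algebra_simps)
    have n: "fact k / sqrt (real k) ^ k > 0" using k by simp
    have "omega_moment x k - moment_main k L = (X - Y) * (fact k / sqrt (real k) ^ k)"
      using k by (simp add: X_def Y_def field_simps)
    then have "\<bar>omega_moment x k - moment_main k L\<bar> = \<bar>X - Y\<bar> * (fact k / sqrt (real k) ^ k)"
      using n by (simp add: abs_mult)
    also have "\<dots> \<le> (C1 + 32 * K) * B ^ j * (exp (real k / 2) / sqrt (real k)) * (fact k / sqrt (real k) ^ k)"
      using XY n by (intro mult_right_mono) auto
    also have "\<dots> = (C1 + 32 * K) * B ^ j * (exp (real k / 2) / sqrt (real k) * (fact k / sqrt (real k) ^ k))" by (simp only: mult.assoc)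
    also have "\<dots> \<le> (C1 + 32 * K) * B ^ j * (c * gamma_moment k)"
      using c(2)[OF k] C1 K B0 by (intro mult_left_mono) auto
    finally show "\<bar>omega_moment x k - moment_main k L\<bar> \<le> (C1 + 32 * K) * c * (sqrt (real k) ^ 3 / sqrt L) ^ (if even k then 2 else 3) * gamma_moment k"
      unfolding B_eq j_def by (simp only: mult_ac)
  qed
qed

text \<open>Both coefficients are at least the minimum, and k (k - 1) + k = k^2.\<close>

lemma moment_main_odd_ge:
  assumes "L > 0"
  shows "moment_main (2 * m + 1) L \<ge> min mertens_const (1/6) * real (2 * m + 1) ^ 2 * gauss_moment (2 * m) / sqrt L"
proof -
  define k where "k = real (2 * m + 1)"
  have k: "k \<ge> 1" by (simp add: k_def)
  have "min mertens_const (1/6) * k ^ 2 \<le> k * (k - 1) / 6 + k * mertens_const"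
  proof -
    have "min mertens_const (1/6) * (k * (k - 1)) \<le> 1/6 * (k * (k - 1))" using k by (intro mult_right_mono) auto
    moreover have "min mertens_const (1/6) * k \<le> mertens_const * k" using k by (intro mult_right_mono) auto
    moreover have "min mertens_const (1/6) * k ^ 2 = min mertens_const (1/6) * (k * (k - 1)) + min mertens_const (1/6) * k"
      by (simp add: power2_eq_square algebra_simps)
    moreover have "mertens_const * k = k * mertens_const" by simp
    ultimately show ?thesis by linarith
  qed
  then have "min mertens_const (1/6) * k ^ 2 * (gauss_moment (2 * m) / sqrt L) \<le> (k * (k - 1) / 6 + k * mertens_const) * (gauss_moment (2 * m) / sqrt L)"
    using assms gauss_moment_even_pos[of m] by (intro mult_right_mono) auto
  then show ?thesis unfolding moment_main_odd by (simp add: k_def)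
qed

lemma gauss_moment_even_ge_1: "gauss_moment (2 * m) \<ge> 1"
proof (induction m)
  case (Suc m)
  have "1 * 1 \<le> real (2 * m + 1) * gauss_moment (2 * m)" using Suc by (intro mult_mono) auto
  then show ?case using gauss_moment_even_Suc[of m] by simp
qed (simp add: gauss_moment_def)

lemma omega_moment_small:
  assumes A: "A > 0"
  obtains C L0 where "C > 0" "L0 \<ge> 1"
    "\<And>x k L. x \<ge> 3 \<Longrightarrow> k > 0 \<Longrightarrow> L = ln (ln x) \<Longrightarrow> L \<ge> L0 \<Longrightarrow> real k \<le> A * L powr (1/3) \<Longrightarrow>
       \<bar>omega_moment x k - moment_main k L\<bar> \<le> C * (real k ^ 3 / L) * moment_main k L \<and> moment_main k L > 0"
proof -
  obtain C L0 where C: "C > 0" "L0 \<ge> 1" and err: "\<And>x k L. x \<ge> 3 \<Longrightarrow> k > 0 \<Longrightarrow> L = ln (ln x) \<Longrightarrow> L \<ge> L0 \<Longrightarrow> real k \<le> A * L powr (1/3) \<Longrightarrow>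
       \<bar>omega_moment x k - moment_main k L\<bar> \<le> C * (sqrt (real k) ^ 3 / sqrt L) ^ (if even k then 2 else 3) * gamma_moment k"
    by (rule omega_moment_error[OF A]) blast
  define c where "c = min mertens_const (1/6)"
  have c: "c > 0" using mertens_const_pos by (simp add: c_def)
  show ?thesis
  proof (rule that[of "C + 2 * C / c" L0])
    show "C + 2 * C / c > 0" using C c by (simp add: add_pos_pos)
    show "L0 \<ge> 1" by (rule C)
    fix x L :: real and k :: nat
    assume *: "x \<ge> 3" "k > 0" "L = ln (ln x)" "L \<ge> L0" "real k \<le> A * L powr (1/3)"
    have L: "L > 0" using *(4) C(2) by linarith
    define B where "B = sqrt (real k) ^ 3 / sqrt L"
    have B2: "B ^ 2 = real k ^ 3 / L"
    proof -
      have "(sqrt (real k) ^ 3) ^ 2 = (sqrt (real k) ^ 2) ^ 3" by (simp only: power_mult[symmetric] mult.commute)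
      then show ?thesis using L by (simp add: B_def power_divide)
    qed
    have e: "\<bar>omega_moment x k - moment_main k L\<bar> \<le> C * B ^ (if even k then 2 else 3) * gamma_moment k"
      unfolding B_def by (rule err[OF *])
    have mp: "moment_main k L > 0 \<and> C * B ^ (if even k then 2 else 3) * gamma_moment k \<le> (C + 2 * C / c) * (real k ^ 3 / L) * moment_main k L"
    proof (cases "even k")
      case True
      then obtain m where m: "k = 2 * m" by (elim evenE)
      have mm: "moment_main k L = gauss_moment k" using True * by (intro moment_main_even) auto
      have pos: "gauss_moment k > 0" using gauss_moment_even_pos[of m] m by simp
      have "C * (real k ^ 3 / L) * gauss_moment k \<le> (C + 2 * C / c) * (real k ^ 3 / L) * gauss_moment k"
        using C c L pos by (intro mult_right_mono) auto
      then show ?thesis using True mm pos by (simp add: gamma_moment_even B2)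
    next
      case False
      then obtain m where m: "k = 2 * m + 1" by (elim oddE)
      define g where "g = gauss_moment (2 * m)"
      have g: "g > 0" using gauss_moment_even_pos by (simp add: g_def)
      have lower: "c * real k ^ 2 * g / sqrt L \<le> moment_main k L"
        using moment_main_odd_ge[OF L, of m] by (simp add: c_def g_def m)
      have "c * real k ^ 2 * g / sqrt L > 0" using c g L * by (intro divide_pos_pos mult_pos_pos) auto
      then have pos: "moment_main k L > 0" using lower by linarith
      have B0: "B \<ge> 0" using L by (simp add: B_def)
      have "C * B ^ 3 * gamma_moment k \<le> C * B ^ 3 * (2 * sqrt (real k) * g)"
        using gamma_moment_odd_le[of m] C B0 by (intro mult_left_mono) (auto simp: m g_def)
      \<comment> \<open>One factor B times sqrt k is k^2 / sqrt L, the order of the main term; the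
        remaining B^2 is the relative error k^3 / L.\<close>
      also have "\<dots> = 2 * C * B ^ 2 * (B * sqrt (real k)) * g" by (simp add: power3_eq_cube power2_eq_square)
      also have "B * sqrt (real k) = real k ^ 2 / sqrt L"
      proof -
        have "sqrt (real k) ^ 3 * sqrt (real k) = (sqrt (real k) ^ 2) ^ 2" by (simp only: power_mult[symmetric] power_Suc2[symmetric]) simp
        then show ?thesis by (simp add: B_def)
      qed
      also have "2 * C * B ^ 2 * (real k ^ 2 / sqrt L) * g = 2 * C / c * (real k ^ 3 / L) * (c * real k ^ 2 * g / sqrt L)"
        using c by (simp add: B2)
      also have "\<dots> \<le> 2 * C / c * (real k ^ 3 / L) * moment_main k L"
        using lower C c L by (intro mult_left_mono) auto
      also have "\<dots> \<le> (C + 2 * C / c) * (real k ^ 3 / L) * moment_main k L"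
        using C c L pos by (intro mult_right_mono) auto
      finally show ?thesis using False pos by simp
    qed
    then show "\<bar>omega_moment x k - moment_main k L\<bar> \<le> (C + 2 * C / c) * (real k ^ 3 / L) * moment_main k L \<and> moment_main k L > 0"
      using e by linarith
  qed
qed

text \<open>Serves the bounded range of x: even Gaussian moments are at least 1, and for odd k the
  main term is at least its value a / sqrt L at k = 1.\<close>

lemma moment_main_lower:
  assumes "0 < L" "L \<le> L0" "k > 0"
  shows "moment_main k L \<ge> min 1 (mertens_const / sqrt L0)"
proof (cases "even k")
  case True
  then obtain m where "k = 2 * m" by (elim evenE)
  then show ?thesis using moment_main_even[OF True assms(3)] gauss_moment_even_ge_1[of m] by simp
next
  case False
  then obtain m where m: "k = 2 * m + 1" by (elim oddE)
  have "mertens_const / sqrt L0 \<le> mertens_const / sqrt L"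
    using assms mertens_const_pos by (intro divide_left_mono) auto
  also have "\<dots> = (1 * mertens_const) * (1 / sqrt L)" by simp
  also have "\<dots> \<le> (real (2 * m + 1) * real (2 * m) / 6 + real (2 * m + 1) * mertens_const) * (gauss_moment (2 * m) / sqrt L)"
  proof (intro mult_mono divide_right_mono)
    have "1 * mertens_const \<le> real (2 * m + 1) * mertens_const"
      using mertens_const_pos by (intro mult_right_mono) auto
    moreover have "0 \<le> real (2 * m + 1) * real (2 * m) / 6" by simp
    ultimately show "1 * mertens_const \<le> real (2 * m + 1) * real (2 * m) / 6 + real (2 * m + 1) * mertens_const" by linarith
  qed (use assms mertens_const_pos gauss_moment_even_ge_1[of m] in \<open>auto intro!: add_nonneg_nonneg\<close>)
  also have "\<dots> = moment_main k L" unfolding m moment_main_odd ..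
  finally show ?thesis by simp
qed

lemma prime_omega_le: "n > 0 \<Longrightarrow> prime_omega n \<le> n"
proof -
  assume n: "n > 0"
  have "prime_factors n \<subseteq> {1..n}"
    using n by (auto simp: prime_factors_dvd Suc_le_eq prime_gt_0_nat dest: dvd_imp_le)
  from card_mono[OF _ this] show ?thesis by (simp add: prime_omega_def)
qed

text \<open>A crude bound for bounded x, where the number of prime factors of n is at most n and n
  is at most exp (exp L0). The base is made at least 1 so that the exponent may be raised to
  \<open>k0\<close>.\<close>

lemma omega_moment_bounded:
  assumes x: "x \<ge> 3" and L: "ln (ln x) \<le> L0" and k: "k \<le> k0" and l: "0 < l" "l \<le> ln (ln x)"
  shows "\<bar>omega_moment x k\<bar> \<le> (max 1 ((exp (exp L0) + L0) / sqrt l)) ^ k0"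
proof -
  define Q where "Q = max 1 ((exp (exp L0) + L0) / sqrt l)"
  define N where "N = nat \<lfloor>x\<rfloor>"
  have N: "real N > 0" "real N \<le> x" using x by (auto simp: N_def)
  have x_le: "x \<le> exp (exp L0)"
  proof -
    have "ln x > 0" using x ln_3_gt_1 by simp
    then have "ln x \<le> exp L0" using L exp_le_cancel_iff[of "ln (ln x)" L0] by simp
    then show ?thesis using exp_le_cancel_iff[of "ln x" "exp L0"] x by simp
  qed
  have bnd: "\<bar>((real (prime_omega n) - ln (ln x)) / sqrt (ln (ln x))) ^ k\<bar> \<le> Q ^ k0" if n: "n \<in> {1..N}" for n
  proof -
    have "real (prime_omega n) \<le> real N" using prime_omega_le[of n] n by simp
    then have "\<bar>real (prime_omega n) - ln (ln x)\<bar> \<le> exp (exp L0) + L0"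
      using N x_le L l by (simp add: abs_le_iff)
    then have "\<bar>real (prime_omega n) - ln (ln x)\<bar> / sqrt (ln (ln x)) \<le> (exp (exp L0) + L0) / sqrt l"
      using l by (intro frac_le) (auto simp: order.trans[OF abs_ge_zero])
    then have "\<bar>(real (prime_omega n) - ln (ln x)) / sqrt (ln (ln x))\<bar> \<le> Q" using l by (simp add: Q_def abs_divide)
    then have "\<bar>(real (prime_omega n) - ln (ln x)) / sqrt (ln (ln x))\<bar> ^ k \<le> Q ^ k" by (intro power_mono) auto
    also have "\<dots> \<le> Q ^ k0" using k by (intro power_increasing) (auto simp: Q_def)
    finally show ?thesis by (simp add: power_abs)
  qed
  have "\<bar>\<Sum>n=1..N. ((real (prime_omega n) - ln (ln x)) / sqrt (ln (ln x))) ^ k\<bar> \<le> (\<Sum>n=1..N. Q ^ k0)"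
    by (intro order.trans[OF sum_abs] sum_mono bnd)
  also have "\<dots> = real N * Q ^ k0" by simp
  finally have le: "\<bar>\<Sum>n=1..N. ((real (prime_omega n) - ln (ln x)) / sqrt (ln (ln x))) ^ k\<bar> \<le> real N * Q ^ k0" .
  have "\<bar>omega_moment x k\<bar> = \<bar>\<Sum>n=1..N. ((real (prime_omega n) - ln (ln x)) / sqrt (ln (ln x))) ^ k\<bar> / real N"
    using x by (subst omega_moment_eq_sum) (auto simp: N_def[symmetric] abs_divide)
  also have "\<dots> \<le> real N * Q ^ k0 / real N" by (rule divide_right_mono[OF le]) simp
  finally show ?thesis using N by (simp add: Q_def)
qed

lemma omega_moment_uniform:
  assumes A: "A > 0"
  shows "\<exists>C>0. \<forall>x\<ge>3. \<forall>k::nat. 1 \<le> k \<and> real k \<le> A * ln (ln x) powr (1/3) \<longrightarrow>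
        (\<exists>\<theta>::real. \<bar>\<theta>\<bar> \<le> C * (real k ^ 3 / ln (ln x)) \<and>
           omega_moment x k = moment_main k (ln (ln x)) * (1 + \<theta>))"
proof -
  obtain C L0 where C: "C > 0" "L0 \<ge> 1" and large: "\<And>x k L. x \<ge> 3 \<Longrightarrow> k > 0 \<Longrightarrow> L = ln (ln x) \<Longrightarrow> L \<ge> L0 \<Longrightarrow> real k \<le> A * L powr (1/3) \<Longrightarrow>
       \<bar>omega_moment x k - moment_main k L\<bar> \<le> C * (real k ^ 3 / L) * moment_main k L \<and> moment_main k L > 0"
    by (rule omega_moment_small[OF A]) blast
  \<comment> \<open>Positive because 3 > e; this bounds L away from 0 for all x at least 3.\<close>
  define l where "l = ln (ln (3::real))"
  have l: "l > 0" using ln_3_gt_1 by (simp add: l_def)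
  define k0 where "k0 = nat \<lfloor>A * L0 powr (1/3)\<rfloor>"
  define Q where "Q = (max 1 ((exp (exp L0) + L0) / sqrt l)) ^ k0"
  define d where "d = min 1 (mertens_const / sqrt L0)"
  have d: "d > 0" using mertens_const_pos C by (simp add: d_def)
  have Q: "Q \<ge> 0" by (simp add: Q_def)
  \<comment> \<open>For L at least L0 the constant C is enough. For smaller L the relative deviation
    is at most Q/d + 1, while k^3 / L is at least 1 / L0, so the second summand absorbs it.\<close>
  define C' where "C' = C + (Q / d + 1) * L0"
  have C': "C' > 0" using C d Q by (auto simp: C'_def intro!: add_pos_nonneg mult_nonneg_nonneg)
  show ?thesis
  proof (rule exI[of _ C'], intro conjI allI impI, rule C')
    fix x :: real and k :: nat
    assume x: "3 \<le> x" and kk: "1 \<le> k \<and> real k \<le> A * ln (ln x) powr (1/3)"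
    define L where "L = ln (ln x)"
    have k: "k > 0" "real k \<le> A * L powr (1/3)" using kk by (auto simp: L_def)
    have lL: "l \<le> L"
    proof -
      have "ln 3 \<le> ln x" using x by simp
      then show ?thesis unfolding l_def L_def using ln_3_gt_1 by (subst ln_le_cancel_iff) auto
    qed
    have L: "L > 0" using l lL by linarith
    define \<theta> where "\<theta> = omega_moment x k / moment_main k L - 1"
    have "moment_main k L > 0 \<and> \<bar>\<theta>\<bar> \<le> C' * (real k ^ 3 / L)"
    proof (cases "L \<ge> L0")
      case True
      have m: "\<bar>omega_moment x k - moment_main k L\<bar> \<le> C * (real k ^ 3 / L) * moment_main k L" "moment_main k L > 0"
        using large[OF x k(1) L_def True k(2)] by auto
      have "\<bar>\<theta>\<bar> = \<bar>omega_moment x k - moment_main k L\<bar> / moment_main k L"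
      proof -
        have "\<theta> = (omega_moment x k - moment_main k L) / moment_main k L"
          using m(2) by (simp add: \<theta>_def diff_divide_distrib)
        then show ?thesis using m(2) by (simp add: abs_divide)
      qed
      also have "\<dots> \<le> C * (real k ^ 3 / L)" using m by (simp add: pos_divide_le_eq)
      also have "\<dots> \<le> C' * (real k ^ 3 / L)"
        using L C Q d by (intro mult_right_mono) (auto simp: C'_def intro!: mult_nonneg_nonneg)
      finally show ?thesis using m by simp
    next
      case False
      have mm: "moment_main k L \<ge> d" unfolding d_def using False L k by (intro moment_main_lower) auto
      have "A * L powr (1/3) \<le> A * L0 powr (1/3)" using False L A by (intro mult_left_mono powr_mono2) auto
      then have "k \<le> k0" unfolding k0_def using k(2) by (simp add: le_nat_floor)
      then have om: "\<bar>omega_moment x k\<bar> \<le> Q"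
        unfolding Q_def using x False l lL by (intro omega_moment_bounded) (auto simp: L_def)
      have "\<bar>\<theta>\<bar> \<le> \<bar>omega_moment x k / moment_main k L\<bar> + 1" unfolding \<theta>_def by linarith
      also have "\<bar>omega_moment x k / moment_main k L\<bar> \<le> Q / d"
        using mm d om by (simp add: abs_divide frac_le)
      also have "Q / d + 1 = (Q / d + 1) * L0 * (1 / L0)" using C by simp
      also have "\<dots> \<le> C' * (real k ^ 3 / L)"
      proof (intro mult_mono)
        show "(Q / d + 1) * L0 \<le> C'" using C by (simp add: C'_def)
        have "1 ^ 3 \<le> real k ^ 3" using k by (intro power_mono) auto
        then show "1 / L0 \<le> real k ^ 3 / L" using False L C by (intro frac_le) auto
      qed (use C C' in auto)
      finally show ?thesis using mm d by simp
    qed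
    then show "\<exists>\<theta>. \<bar>\<theta>\<bar> \<le> C' * (real k ^ 3 / ln (ln x)) \<and> omega_moment x k = moment_main k (ln (ln x)) * (1 + \<theta>)"
      by (intro exI[of _ \<theta>]) (auto simp: \<theta>_def L_def)
  qed
qed

theorem theorem1p2:
  fixes A :: real
  assumes "A > 0"
  shows
    "(\<exists>C>0. \<forall>x\<ge>3. \<forall>k::nat. 1 \<le> k \<and> real k \<le> A * ln (ln x) powr (1/3) \<longrightarrow>
        (\<exists>\<theta>::real. \<bar>\<theta>\<bar> \<le> C * (real k ^ 3 / ln (ln x)) \<and>
           omega_moment x k =
             (gauss_moment k
               + (real k * (real k - 1) / 6 + real k * mertens_const)
                 * (gauss_moment (k - 1) / sqrt (ln (ln x)))) * (1 + \<theta>)))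
     \<and> (\<forall>k::real \<Rightarrow> nat.
        (\<lambda>x. real (k x)) \<in> \<Theta>[at_top](\<lambda>x. ln (ln x) powr (1/3)) \<longrightarrow>
        (let g = (\<lambda>x. 1/2 * exp (real (k x) powr (3/2) / (6 * ln (ln x) powr (1/2)))
                   * (1 + (-1) ^ k x * exp (- (real (k x) powr (3/2) / (3 * ln (ln x) powr (1/2))))))
         in (\<lambda>x. inverse (gamma_moment (k x)) * omega_moment x (k x)) \<sim>[at_top] g
            \<and> g \<in> \<Theta>[at_top](\<lambda>_. 1)))
     \<and> (\<forall>k::real \<Rightarrow> nat.
        filterlim (\<lambda>x. real (k x) / ln (ln x) powr (1/3)) at_top at_top \<and>
        (\<lambda>x. real (k x)) \<in> o[at_top](\<lambda>x. sqrt (ln (ln x))) \<longrightarrow>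
        (let r = (\<lambda>x. sqrt (real (k x) / ln (ln x)));
             g = (\<lambda>x. 1/2 * ln x powr (exp (r x) - (1 + r x + (r x)\<^sup>2 / 2)))
         in (\<lambda>x. inverse (gamma_moment (k x)) * omega_moment x (k x)) \<sim>[at_top] g
            \<and> filterlim g at_top at_top))"
  unfolding Let_def
  by (intro conjI allI impI omega_moment_uniform[OF assms, unfolded moment_main_def]
      omega_moment_critical omega_moment_large) auto

end
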